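(* Let $(\Omega_1,\Sigma_1,\mu)$ and $(\Omega_2,\Sigma_2,\nu)$ be (arbitrary) measure spaces. Then the following are equivalent: (i) $\mu$ or $\nu$ is a purely atomic measure. (ii) $\mathrm{NA}_\pi(L_1(\mu)\widehat{\otimes}_\pi L_1(\nu))=L_1(\mu)\widehat{\otimes}_\pi L_1(\nu)$.
   Context: The scalar field is $\mathbb K\in\{\mathbb R,\mathbb C\}$. $X\widehat{\otimes}_\pi Y$ denotes the projective tensor product. An element $u\in X\widehat{\otimes}_\pi Y$ attains its projective norm if there are $(x_i)\subseteq X$, $(y_i)\subseteq Y$ with $u=\sum_{i=1}^\infty x_i\otimes y_i$ and $\|u\|_\pi=\sum_{i=1}^\infty\|x_i\|\|y_i\|$; $\mathrm{NA}_\pi(X\widehat{\otimes}_\pi Y)$ is the set of such elements. For a measure space $(\Omega,\Sigma,\mu)$, a set $A\in\Sigma$ is an atom if $0<\mu(A)<\infty$ and every measurable $B\subseteq A$ has $\mu(B)=0$ or $\mu(B)=\mu(A)$. A set $E\in\Sigma$ with $0<\mu(E)<\infty$ is purely atomic if it coincides, modulo a null set, with the union of the (countably many, modulo null sets) atoms contained in $E$; $\mu$ is purely atomic if every $E\in\Sigma$ with $0<\mu(E)<\infty$ is purely atomic. *)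

theory Defs
  imports "HOL-Analysis.Analysis"
begin

section \<open>Normed spaces over a scalar field\<close>

text \<open>
  \<open>L\<^sub>1(\<mu>)\<close> depends on the value \<open>\<mu>\<close>, so normed spaces are records with an explicit carrier instead of
  types. The scalars \<open>'k\<close> are meant to be \<open>real\<close> or \<open>complex\<close>.
\<close>

record ('k, 'v) nvs =
  vcarrier :: "'v set"
  vzero :: 'v
  vadd :: "'v \<Rightarrow> 'v \<Rightarrow> 'v"
  vscale :: "'k \<Rightarrow> 'v \<Rightarrow> 'v"
  vnorm :: "'v \<Rightarrow> real"

definition vdist :: "('k::real_normed_field, 'v) nvs \<Rightarrow> 'v \<Rightarrow> 'v \<Rightarrow> real" where
  "vdist X x y = vnorm X (vadd X x (vscale X (-1) y))"

primrec vpartial_sum :: "('k::real_normed_field, 'v) nvs \<Rightarrow> (nat \<Rightarrow> 'v) \<Rightarrow> nat \<Rightarrow> 'v" where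
  "vpartial_sum X f 0 = vzero X"
| "vpartial_sum X f (Suc n) = vadd X (vpartial_sum X f n) (f n)"

definition vsums :: "('k::real_normed_field, 'v) nvs \<Rightarrow> (nat \<Rightarrow> 'v) \<Rightarrow> 'v \<Rightarrow> bool" where
  "vsums X f u \<longleftrightarrow> (\<lambda>n. vdist X (vpartial_sum X f n) u) \<longlonglongrightarrow> 0"

section \<open>Completion\<close>

definition vCauchy :: "('k::real_normed_field, 'v) nvs \<Rightarrow> (nat \<Rightarrow> 'v) \<Rightarrow> bool" where
  "vCauchy X s \<longleftrightarrow> (\<forall>n. s n \<in> vcarrier X) \<and>
     (\<forall>e>0. \<exists>N. \<forall>m\<ge>N. \<forall>n\<ge>N. vdist X (s m) (s n) < e)"

definition Cauchy_class :: "('k::real_normed_field, 'v) nvs \<Rightarrow> (nat \<Rightarrow> 'v) \<Rightarrow> (nat \<Rightarrow> 'v) set" where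
  "Cauchy_class X s = {t. vCauchy X t \<and> (\<lambda>n. vdist X (s n) (t n)) \<longlonglongrightarrow> 0}"

definition rep :: "'c set \<Rightarrow> 'c" where
  "rep C = (SOME c. c \<in> C)"

definition completion ::
    "('k::real_normed_field, 'v) nvs \<Rightarrow> ('k, (nat \<Rightarrow> 'v) set) nvs" where
  "completion X =
     \<lparr> vcarrier = Cauchy_class X ` {s. vCauchy X s},
       vzero = Cauchy_class X (\<lambda>n. vzero X),
       vadd = (\<lambda>U V. Cauchy_class X (\<lambda>n. vadd X (rep U n) (rep V n))),
       vscale = (\<lambda>a U. Cauchy_class X (\<lambda>n. vscale X a (rep U n))),
       vnorm = (\<lambda>U. lim (\<lambda>n. vnorm X (rep U n))) \<rparr>"

definition completion_embed :: "('k::real_normed_field, 'v) nvs \<Rightarrow> 'v \<Rightarrow> (nat \<Rightarrow> 'v) set" where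
  "completion_embed X x = Cauchy_class X (\<lambda>n. x)"

section \<open>Projective tensor product\<close>

definition bilinear_forms ::
    "('k::real_normed_field, 'v) nvs \<Rightarrow> ('k, 'w) nvs \<Rightarrow> ('v \<Rightarrow> 'w \<Rightarrow> 'k) set" where
  "bilinear_forms X Y = {B.
     (\<forall>x\<in>vcarrier X. \<forall>x'\<in>vcarrier X. \<forall>y\<in>vcarrier Y. B (vadd X x x') y = B x y + B x' y) \<and>
     (\<forall>x\<in>vcarrier X. \<forall>y\<in>vcarrier Y. \<forall>y'\<in>vcarrier Y. B x (vadd Y y y') = B x y + B x y') \<and>
     (\<forall>a. \<forall>x\<in>vcarrier X. \<forall>y\<in>vcarrier Y. B (vscale X a x) y = a * B x y) \<and>
     (\<forall>a. \<forall>x\<in>vcarrier X. \<forall>y\<in>vcarrier Y. B x (vscale Y a y) = a * B x y)}"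

text \<open>
  As in Ryan's book on tensor products of Banach spaces, the algebraic tensor product is realised
  inside the linear functionals on the space of all (not necessarily bounded) bilinear forms,
  \<open>x \<otimes> y\<close> being evaluation at \<open>(x, y)\<close>. Setting it to 0 off the bilinear forms makes equality of
  HOL functions coincide with equality of functionals.
\<close>

definition elem_tensor :: "('k::real_normed_field, 'v) nvs \<Rightarrow> ('k, 'w) nvs \<Rightarrow> 'v \<Rightarrow> 'w \<Rightarrow>
    ('v \<Rightarrow> 'w \<Rightarrow> 'k) \<Rightarrow> 'k" where
  "elem_tensor X Y x y = (\<lambda>B. if B \<in> bilinear_forms X Y then B x y else 0)"

definition tensor_rep :: "('k::real_normed_field, 'v) nvs \<Rightarrow> ('k, 'w) nvs \<Rightarrow>
    (('v \<Rightarrow> 'w \<Rightarrow> 'k) \<Rightarrow> 'k) \<Rightarrow> nat \<Rightarrow> (nat \<Rightarrow> 'v) \<Rightarrow> (nat \<Rightarrow> 'w) \<Rightarrow> bool" where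
  "tensor_rep X Y u n x y \<longleftrightarrow>
     (\<forall>i<n. x i \<in> vcarrier X \<and> y i \<in> vcarrier Y) \<and>
     u = (\<lambda>B. \<Sum>i<n. elem_tensor X Y (x i) (y i) B)"

definition proj_norm :: "('k::real_normed_field, 'v) nvs \<Rightarrow> ('k, 'w) nvs \<Rightarrow>
    (('v \<Rightarrow> 'w \<Rightarrow> 'k) \<Rightarrow> 'k) \<Rightarrow> real" where
  "proj_norm X Y u = Inf {\<Sum>i<n. vnorm X (x i) * vnorm Y (y i) | n x y. tensor_rep X Y u n x y}"

definition alg_tensor :: "('k::real_normed_field, 'v) nvs \<Rightarrow> ('k, 'w) nvs \<Rightarrow>
    ('k, ('v \<Rightarrow> 'w \<Rightarrow> 'k) \<Rightarrow> 'k) nvs" where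
  "alg_tensor X Y =
     \<lparr> vcarrier = {u. \<exists>n x y. tensor_rep X Y u n x y},
       vzero = (\<lambda>B. 0),
       vadd = (\<lambda>u v B. u B + v B),
       vscale = (\<lambda>a u B. a * u B),
       vnorm = proj_norm X Y \<rparr>"

definition proj_tensor :: "('k::real_normed_field, 'v) nvs \<Rightarrow> ('k, 'w) nvs \<Rightarrow>
    ('k, (nat \<Rightarrow> ('v \<Rightarrow> 'w \<Rightarrow> 'k) \<Rightarrow> 'k) set) nvs" where
  "proj_tensor X Y = completion (alg_tensor X Y)"

definition proj_elem_tensor :: "('k::real_normed_field, 'v) nvs \<Rightarrow> ('k, 'w) nvs \<Rightarrow> 'v \<Rightarrow> 'w \<Rightarrow>
    (nat \<Rightarrow> ('v \<Rightarrow> 'w \<Rightarrow> 'k) \<Rightarrow> 'k) set" where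
  "proj_elem_tensor X Y x y = completion_embed (alg_tensor X Y) (elem_tensor X Y x y)"

definition NA_proj :: "('k::real_normed_field, 'v) nvs \<Rightarrow> ('k, 'w) nvs \<Rightarrow>
    (nat \<Rightarrow> ('v \<Rightarrow> 'w \<Rightarrow> 'k) \<Rightarrow> 'k) set set" where
  "NA_proj X Y = {u \<in> vcarrier (proj_tensor X Y). \<exists>x y.
     (\<forall>i. x i \<in> vcarrier X) \<and> (\<forall>i. y i \<in> vcarrier Y) \<and>
     vsums (proj_tensor X Y) (\<lambda>i. proj_elem_tensor X Y (x i) (y i)) u \<and>
     (\<lambda>i. vnorm X (x i) * vnorm Y (y i)) sums vnorm (proj_tensor X Y) u}"

section \<open>The space \<open>L\<^sub>1(\<mu>)\<close>\<close>

definition L1_class :: "'a measure \<Rightarrow> ('a \<Rightarrow> 'k) \<Rightarrow>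
    ('a \<Rightarrow> 'k::{real_normed_field, banach, second_countable_topology}) set" where
  "L1_class M f = {g. integrable M g \<and> (AE x in M. f x = g x)}"

text \<open>The scalar field is an explicit \<open>itself\<close> argument because the measure does not determine it.\<close>

definition L1 :: "'k itself \<Rightarrow> 'a measure \<Rightarrow>
    ('k::{real_normed_field, banach, second_countable_topology}, ('a \<Rightarrow> 'k) set) nvs" where
  "L1 _ M =
     \<lparr> vcarrier = L1_class M ` {f. integrable M f},
       vzero = L1_class M (\<lambda>x. 0),
       vadd = (\<lambda>F G. L1_class M (\<lambda>x. rep F x + rep G x)),
       vscale = (\<lambda>a F. L1_class M (\<lambda>x. a * rep F x)),
       vnorm = (\<lambda>F. \<integral>x. norm (rep F x) \<partial>M) \<rparr>"

section \<open>Purely atomic measures\<close>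

definition atom :: "'a measure \<Rightarrow> 'a set \<Rightarrow> bool" where
  "atom M A \<longleftrightarrow> A \<in> sets M \<and> 0 < emeasure M A \<and> emeasure M A < \<infinity> \<and>
     (\<forall>B\<in>sets M. B \<subseteq> A \<longrightarrow> emeasure M B = 0 \<or> emeasure M B = emeasure M A)"

text \<open>
  Atoms are only meaningful modulo null sets: the union of the atoms contained in \<open>E\<close> is taken over
  a countable family that represents each of them up to a null set.
\<close>

definition purely_atomic_set :: "'a measure \<Rightarrow> 'a set \<Rightarrow> bool" where
  "purely_atomic_set M E \<longleftrightarrow> (\<exists>\<A>. countable \<A> \<and> (\<forall>A\<in>\<A>. atom M A \<and> A \<subseteq> E) \<and>
     (\<forall>A. atom M A \<and> A \<subseteq> E \<longrightarrow> (\<exists>A'\<in>\<A>. sym_diff A A' \<in> null_sets M)) \<and>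
     E - \<Union>\<A> \<in> null_sets M)"

definition purely_atomic :: "'a measure \<Rightarrow> bool" where
  "purely_atomic M \<longleftrightarrow>
     (\<forall>E\<in>sets M. 0 < emeasure M E \<and> emeasure M E < \<infinity> \<longrightarrow> purely_atomic_set M E)"

end

theory Submission
  imports Defs
begin

text \<open>
  If \<open>\<mu>\<close> is purely atomic, the countably many integrable functions that occur in the representations of
  a Cauchy sequence defining \<open>u\<close> live on disjoint atoms \<open>A\<^sub>i\<close>, and \<open>u = (\<Sum>i. e\<^sub>i \<otimes> z\<^sub>i)\<close> with
  \<open>e\<^sub>i = 1\<^sub>A\<^sub>i / \<mu>(A\<^sub>i)\<close> and \<open>z\<^sub>i\<close> the image of \<open>u\<close> under \<open>x \<otimes> y \<mapsto> (\<integral>\<^sub>A\<^sub>i x) y\<close>. Bilinear forms built from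
  the signs of the \<open>z\<^sub>i\<close> show \<open>(\<Sum>i. \<parallel>z\<^sub>i\<parallel>) \<le> \<parallel>u\<parallel>\<close>. The case of purely atomic \<open>\<nu>\<close> follows by swapping
  the factors.

  Otherwise there are atomless sets \<open>E\<close> and \<open>F\<close> of positive finite measure. Sierpinski's theorem divides
  both into nested equal cells indexed by words, the \<open>n\<close>-th letter having \<open>2^(n+2)\<close> values. Let \<open>u\<close> be
  the tensor of the indicator function of the set of pairs that differ in every letter. If \<open>u\<close> attained
  its norm at \<open>\<Sum>i. x\<^sub>i \<otimes> y\<^sub>i\<close>, testing with the bilinear forms \<open>Q\<^sub>n(x, y) = \<integral>\<integral> x y\<close> over the pairs
  that differ in the first \<open>n\<close> letters would force the rectangle supp \<open>x\<^sub>i \<times>\<close> supp \<open>y\<^sub>i\<close> to avoid all pairs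
  with a common letter. But late letters are almost equidistributed on every set of positive
  measure, so such a rectangle is null, while \<open>\<parallel>u\<parallel> > 0\<close>. Only finite sums of products of one-variable
  integrals enter, so no product measure is needed.
\<close>

section \<open>The projective norm\<close>

text \<open>In both directions the projective norm turns out to be an L1 norm in disguise: the sum
  of the norms of the slices over the atoms, or the product measure of the set whose indicator
  function is \<open>u\<close>. In the second case, equality of this measure with the sum of the
  \<open>\<parallel>x\<^sub>i\<parallel> \<parallel>y\<^sub>i\<parallel>\<close> leaves no mass to
  be cancelled outside the set. What is wanted is therefore a set of positive product measure that
  contains no rectangle of positive measure, even modulo null sets. With a fixed alphabet of K
  letters the pairs that differ in n letters would have density (1 - 1/K)^n, which tends to 0;
  growing alphabets keep the density at least 1/2 and still leave infinitely many letters to catch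
  every rectangle. An obstacle of a different kind is the completion: its points are classes of
  Cauchy sequences and its operations go through chosen representatives. Attainment is therefore
  first expressed by one representing sequence (\<open>attains\<close>); after that only the
  algebraic tensor product, its distance \<open>td\<close> and limits of real sequences
  occur.\<close>

lemma LIMSEQ_0_le:
  fixes f :: "nat \<Rightarrow> real"
  assumes "g \<longlonglongrightarrow> 0" "\<And>n. 0 \<le> f n" "\<And>n. f n \<le> g n"
  shows "f \<longlonglongrightarrow> 0"
  by (rule Lim_null_comparison[OF _ assms(1)]) (use assms in auto)

lemma elem_tensor_simps:
  "B \<in> bilinear_forms X Y \<Longrightarrow> elem_tensor X Y x y B = B x y"
  "B \<notin> bilinear_forms X Y \<Longrightarrow> elem_tensor X Y x y B = 0"
  by (simp_all add: elem_tensor_def)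

lemma alg_tensor_simps:
  "vcarrier (alg_tensor X Y) = {u. \<exists>n x y. tensor_rep X Y u n x y}"
  "vzero (alg_tensor X Y) = (\<lambda>B. 0)"
  "vadd (alg_tensor X Y) = (\<lambda>u v B. u B + v B)"
  "vscale (alg_tensor X Y) = (\<lambda>a u B. a * u B)"
  "vnorm (alg_tensor X Y) = proj_norm X Y"
  by (simp_all add: alg_tensor_def)

text \<open>These properties suffice for a seminorm on the tensor product: nonnegativity bounds the
  infimum from below, a sign is absorbed into the left factor, and the triangle inequality comes
  from concatenating representations. The assumptions are symmetric so that the factors can be
  exchanged.\<close>

locale norm_pair =
  fixes X :: "('k::real_normed_field, 'v) nvs" and Y :: "('k, 'w) nvs"
  assumes norm_nonneg_X: "x \<in> vcarrier X \<Longrightarrow> 0 \<le> vnorm X x"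
    and norm_nonneg_Y: "y \<in> vcarrier Y \<Longrightarrow> 0 \<le> vnorm Y y"
    and neg_X: "x \<in> vcarrier X \<Longrightarrow> vscale X (-1) x \<in> vcarrier X"
    and neg_Y: "y \<in> vcarrier Y \<Longrightarrow> vscale Y (-1) y \<in> vcarrier Y"
    and norm_neg_X: "x \<in> vcarrier X \<Longrightarrow> vnorm X (vscale X (-1) x) = vnorm X x"
    and norm_neg_Y: "y \<in> vcarrier Y \<Longrightarrow> vnorm Y (vscale Y (-1) y) = vnorm Y y"
begin

abbreviation T where "T \<equiv> alg_tensor X Y"
abbreviation pn where "pn \<equiv> proj_norm X Y"
abbreviation et where "et \<equiv> elem_tensor X Y"

lemma norm_pair_swap: "norm_pair Y X"
  by unfold_locales (auto simp: norm_nonneg_X norm_nonneg_Y neg_X neg_Y norm_neg_X norm_neg_Y)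

lemma rep_sum_nonneg: "tensor_rep X Y u n x y \<Longrightarrow> 0 \<le> (\<Sum>i<n. vnorm X (x i) * vnorm Y (y i))"
  unfolding tensor_rep_def by (intro sum_nonneg mult_nonneg_nonneg) (auto simp: norm_nonneg_X norm_nonneg_Y)

lemma pn_le: assumes "tensor_rep X Y u n x y"
  shows "pn u \<le> (\<Sum>i<n. vnorm X (x i) * vnorm Y (y i))"
  unfolding proj_norm_def
  by (intro cInf_lower bdd_belowI[of _ 0]) (use assms rep_sum_nonneg in auto)

lemma pn_nonneg: assumes "u \<in> vcarrier T" shows "0 \<le> pn u"
  unfolding proj_norm_def
  by (rule cInf_greatest) (use assms rep_sum_nonneg in \<open>auto simp: alg_tensor_simps\<close>)

lemma pn_approx:
  assumes "u \<in> vcarrier T" "0 < e"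
  obtains n x y where "tensor_rep X Y u n x y" "(\<Sum>i<n. vnorm X (x i) * vnorm Y (y i)) < pn u + e"
proof -
  let ?S = "{\<Sum>i<n. vnorm X (x i) * vnorm Y (y i) | n x y. tensor_rep X Y u n x y}"
  have "?S \<noteq> {}" using assms by (auto simp: alg_tensor_simps)
  moreover have "Inf ?S < pn u + e" unfolding proj_norm_def using assms by simp
  ultimately have "\<exists>s\<in>?S. s < pn u + e" by (rule cInf_lessD)
  then show ?thesis using that by auto
qed

text \<open>A bijection onto \<open>{..<card I}\<close> frees later tensors from numbered terms:
  their sums run over disjoint unions and over pairs of words.\<close>

lemma finite_sum_rep:
  assumes "finite I" and xy: "\<And>i. i \<in> I \<Longrightarrow> x i \<in> vcarrier X" "\<And>i. i \<in> I \<Longrightarrow> y i \<in> vcarrier Y"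
  shows finite_sum_in: "(\<lambda>B. \<Sum>i\<in>I. et (x i) (y i) B) \<in> vcarrier T"
    and finite_sum_pn: "pn (\<lambda>B. \<Sum>i\<in>I. et (x i) (y i) B) \<le> (\<Sum>i\<in>I. vnorm X (x i) * vnorm Y (y i))"
proof -
  obtain h where h: "bij_betw h {..<card I} I"
    using ex_bij_betw_nat_finite[OF \<open>finite I\<close>] by (auto simp: atLeast0LessThan)
  have r: "tensor_rep X Y (\<lambda>B. \<Sum>i\<in>I. et (x i) (y i) B) (card I) (x \<circ> h) (y \<circ> h)"
    unfolding tensor_rep_def
  proof (intro conjI allI impI ext)
    fix i assume "i < card I"
    then have "h i \<in> I" using bij_betwE[OF h] by auto
    then show "(x \<circ> h) i \<in> vcarrier X" "(y \<circ> h) i \<in> vcarrier Y" using xy by auto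
  next
    fix B show "(\<Sum>i\<in>I. et (x i) (y i) B) = (\<Sum>i<card I. et ((x \<circ> h) i) ((y \<circ> h) i) B)"
      using sum.reindex_bij_betw[OF h, of "\<lambda>i. et (x i) (y i) B"] by simp
  qed
  then show "(\<lambda>B. \<Sum>i\<in>I. et (x i) (y i) B) \<in> vcarrier T"
    unfolding alg_tensor_simps by blast
  show "pn (\<lambda>B. \<Sum>i\<in>I. et (x i) (y i) B) \<le> (\<Sum>i\<in>I. vnorm X (x i) * vnorm Y (y i))"
    using pn_le[OF r] sum.reindex_bij_betw[OF h, of "\<lambda>i. vnorm X (x i) * vnorm Y (y i)"] by simp
qed

lemma tensor_add_rep:
  assumes "tensor_rep X Y u n x y" "tensor_rep X Y v m x' y'"
  shows tensor_add_in: "(\<lambda>B. u B + v B) \<in> vcarrier T"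
    and tensor_add_pn: "pn (\<lambda>B. u B + v B) \<le>
      (\<Sum>i<n. vnorm X (x i) * vnorm Y (y i)) + (\<Sum>i<m. vnorm X (x' i) * vnorm Y (y' i))"
proof -
  \<comment> \<open>The disjoint union of the index sets concatenates the two
    representations.\<close>
  let ?I = "{..<n} <+> {..<m}" and ?x = "case_sum x x'" and ?y = "case_sum y y'"
  have eq: "(\<lambda>B. u B + v B) = (\<lambda>B. \<Sum>i\<in>?I. et (?x i) (?y i) B)"
    using assms by (simp add: sum.Plus tensor_rep_def)
  have c: "\<And>i. i \<in> ?I \<Longrightarrow> ?x i \<in> vcarrier X" "\<And>i. i \<in> ?I \<Longrightarrow> ?y i \<in> vcarrier Y"
    using assms by (auto simp: tensor_rep_def)
  show "(\<lambda>B. u B + v B) \<in> vcarrier T"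
    unfolding eq by (rule finite_sum_in) (use c in auto)
  show "pn (\<lambda>B. u B + v B) \<le>
      (\<Sum>i<n. vnorm X (x i) * vnorm Y (y i)) + (\<Sum>i<m. vnorm X (x' i) * vnorm Y (y' i))"
    unfolding eq using finite_sum_pn[of ?I ?x ?y] c by (simp add: sum.Plus)
qed

lemma add_in: "u \<in> vcarrier T \<Longrightarrow> v \<in> vcarrier T \<Longrightarrow> (\<lambda>B. u B + v B) \<in> vcarrier T"
  using tensor_add_in unfolding alg_tensor_simps(1)[of X Y] mem_Collect_eq by blast

lemma pn_triangle:
  assumes u: "u \<in> vcarrier T" and v: "v \<in> vcarrier T"
  shows "pn (\<lambda>B. u B + v B) \<le> pn u + pn v"
proof (rule field_le_epsilon)
  fix e :: real assume "0 < e"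
  then have e: "0 < e/2" by simp
  obtain n x y where 1: "tensor_rep X Y u n x y" "(\<Sum>i<n. vnorm X (x i) * vnorm Y (y i)) < pn u + e/2"
    using pn_approx[OF u e] .
  obtain m x' y' where 2: "tensor_rep X Y v m x' y'" "(\<Sum>i<m. vnorm X (x' i) * vnorm Y (y' i)) < pn v + e/2"
    using pn_approx[OF v e] .
  show "pn (\<lambda>B. u B + v B) \<le> pn u + pn v + e"
    using tensor_add_pn[OF 1(1) 2(1)] 1(2) 2(2) by linarith
qed

lemma neg_rep: assumes "tensor_rep X Y u n x y"
  shows "tensor_rep X Y (\<lambda>B. - u B) n (\<lambda>i. vscale X (-1) (x i)) y"
proof -
  have "et (vscale X (-1) a) b B = - et a b B" if "a \<in> vcarrier X" "b \<in> vcarrier Y" for a b B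
  proof (cases "B \<in> bilinear_forms X Y")
    case True
    then have "B (vscale X (-1) a) b = (-1) * B a b"
      using that unfolding bilinear_forms_def by blast
    with True show ?thesis by (simp add: elem_tensor_simps)
  qed (simp add: elem_tensor_simps)
  moreover have "- (\<Sum>i<n. et (x i) (y i) B) = (\<Sum>i<n. - et (x i) (y i) B)" for B
    by (rule sum_negf[symmetric])
  ultimately show ?thesis
    using assms unfolding tensor_rep_def by (auto simp: neg_X fun_eq_iff intro!: sum.cong)
qed

lemma neg_in: "u \<in> vcarrier T \<Longrightarrow> (\<lambda>B. - u B) \<in> vcarrier T"
  unfolding alg_tensor_simps using neg_rep by blast

lemma pn_neg_le: assumes u: "u \<in> vcarrier T" shows "pn (\<lambda>B. - u B) \<le> pn u"
proof (rule field_le_epsilon)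
  fix e :: real assume "0 < e"
  then obtain n x y where 1: "tensor_rep X Y u n x y" "(\<Sum>i<n. vnorm X (x i) * vnorm Y (y i)) < pn u + e"
    using pn_approx[OF u] by blast
  have "(\<Sum>i<n. vnorm X (vscale X (-1) (x i)) * vnorm Y (y i)) = (\<Sum>i<n. vnorm X (x i) * vnorm Y (y i))"
    using 1(1) by (intro sum.cong) (auto simp: tensor_rep_def norm_neg_X)
  then show "pn (\<lambda>B. - u B) \<le> pn u + e"
    using pn_le[OF neg_rep[OF 1(1)]] 1(2) by linarith
qed

lemma pn_neg: assumes "u \<in> vcarrier T" shows "pn (\<lambda>B. - u B) = pn u"
proof (rule antisym)
  show "pn (\<lambda>B. - u B) \<le> pn u" by (rule pn_neg_le[OF assms])
  have "pn (\<lambda>B. - (- u B)) \<le> pn (\<lambda>B. - u B)" by (rule pn_neg_le[OF neg_in[OF assms]])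
  then show "pn u \<le> pn (\<lambda>B. - u B)" by (simp only: minus_minus)
qed

lemma zero_in: "(\<lambda>B. 0) \<in> vcarrier T"
proof -
  have "(\<lambda>B. \<Sum>i\<in>{}. et undefined undefined B) \<in> vcarrier T"
    by (rule finite_sum_in) simp_all
  then show ?thesis by simp
qed

lemma pn_zero: "pn (\<lambda>B. 0) = 0"
proof -
  have "pn (\<lambda>B. \<Sum>i\<in>{}. et undefined undefined B) \<le> (\<Sum>i\<in>{}. vnorm X undefined * vnorm Y undefined)"
    using finite_sum_pn[where I="{}" and x="\<lambda>i::nat. undefined" and y="\<lambda>i. undefined"] by simp
  then show ?thesis using pn_nonneg[OF zero_in] by simp
qed

lemma diff_in: "u \<in> vcarrier T \<Longrightarrow> v \<in> vcarrier T \<Longrightarrow> (\<lambda>B. u B - v B) \<in> vcarrier T"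
  using add_in[OF _ neg_in] by simp

definition td where "td u v = pn (\<lambda>B. u B - v B)"

lemma vdist_T: "vdist T u v = td u v"
  by (simp add: vdist_def alg_tensor_simps td_def)

lemma td_commute: "u \<in> vcarrier T \<Longrightarrow> v \<in> vcarrier T \<Longrightarrow> td u v = td v u"
  unfolding td_def using pn_neg[OF diff_in, of u v] by simp

lemma td_triangle: "u \<in> vcarrier T \<Longrightarrow> v \<in> vcarrier T \<Longrightarrow> w \<in> vcarrier T \<Longrightarrow> td u w \<le> td u v + td v w"
  unfolding td_def using pn_triangle[OF diff_in diff_in, of u v v w] by simp

lemma td_nonneg: "u \<in> vcarrier T \<Longrightarrow> v \<in> vcarrier T \<Longrightarrow> 0 \<le> td u v"
  unfolding td_def by (intro pn_nonneg diff_in)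

lemma td_refl: "td u u = 0"
  by (simp add: td_def pn_zero)

lemma td_zero: "td u (\<lambda>B. 0) = pn u"
  by (simp add: td_def)

text \<open>The easy half of the duality between the projective norm and bounded bilinear forms. The
  nontrivial lower bounds on \<open>pn\<close> in both directions of the theorem rest on it.\<close>

lemma form_bound:
  assumes u: "u \<in> vcarrier T" and B: "B \<in> bilinear_forms X Y" and C: "0 \<le> C"
    and bd: "\<And>x y. x \<in> vcarrier X \<Longrightarrow> y \<in> vcarrier Y \<Longrightarrow> norm (B x y) \<le> C * (vnorm X x * vnorm Y y)"
  shows "norm (u B) \<le> C * pn u"
proof (rule field_le_epsilon)
  fix e :: real assume e: "0 < e"
  \<comment> \<open>Dividing by \<open>C + 1\<close> instead of \<open>C\<close> covers
    \<open>C = 0\<close>.\<close>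
  then have "0 < e / (C + 1)" using C by simp
  then obtain n x y where 1: "tensor_rep X Y u n x y" "(\<Sum>i<n. vnorm X (x i) * vnorm Y (y i)) < pn u + e/(C+1)"
    using pn_approx[OF u] by blast
  have "norm (u B) \<le> (\<Sum>i<n. norm (B (x i) (y i)))"
    using 1(1) B by (auto simp: tensor_rep_def elem_tensor_simps intro: norm_sum)
  also have "\<dots> \<le> (\<Sum>i<n. C * (vnorm X (x i) * vnorm Y (y i)))"
    using 1(1) by (intro sum_mono bd) (auto simp: tensor_rep_def)
  also have "\<dots> = C * (\<Sum>i<n. vnorm X (x i) * vnorm Y (y i))"
    by (simp add: sum_distrib_left)
  also have "\<dots> \<le> C * (pn u + e/(C+1))"
    using 1(2) C by (intro mult_left_mono) auto
  also have "\<dots> \<le> C * pn u + e"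
    using C e by (simp add: field_simps)
  finally show "norm (u B) \<le> C * pn u + e" .
qed

section \<open>Completion\<close>

abbreviation cauchy where "cauchy \<equiv> vCauchy T"
abbreviation cls where "cls \<equiv> Cauchy_class T"

lemma cauchy_in: "cauchy s \<Longrightarrow> s n \<in> vcarrier T"
  by (simp add: vCauchy_def)

lemma cauchy_iff: "cauchy s \<longleftrightarrow> (\<forall>n. s n \<in> vcarrier T) \<and> (\<forall>e>0. \<exists>N. \<forall>m\<ge>N. \<forall>n\<ge>N. td (s m) (s n) < e)"
  by (simp add: vCauchy_def vdist_T)

lemma cauchy_td: assumes s: "cauchy s" and t: "cauchy t"
  shows "convergent (\<lambda>n. td (s n) (t n))"
proof (rule Cauchy_convergent, rule CauchyI)
  fix e :: real assume "0 < e"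
  then have e: "0 < e/2" by simp
  obtain N where N: "\<And>m n. m \<ge> N \<Longrightarrow> n \<ge> N \<Longrightarrow> td (s m) (s n) < e/2"
    using s e unfolding cauchy_iff by meson
  obtain M where M: "\<And>m n. m \<ge> M \<Longrightarrow> n \<ge> M \<Longrightarrow> td (t m) (t n) < e/2"
    using t e unfolding cauchy_iff by meson
  have 1: "td (s m) (t m) - td (s n) (t n) < e" if "m \<ge> max N M" "n \<ge> max N M" for m n
    using td_triangle[of "s m" "s n" "t m"] td_triangle[of "s n" "t n" "t m"] N[of m n] M[of n m]
      cauchy_in[OF s] cauchy_in[OF t] that by simp
  then have "norm (td (s m) (t m) - td (s n) (t n)) < e" if "m \<ge> max N M" "n \<ge> max N M" for m n
    using 1[of m n] 1[of n m] that by (auto simp: abs_less_iff)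
  then show "\<exists>M. \<forall>m\<ge>M. \<forall>n\<ge>M. norm (td (s m) (t m) - td (s n) (t n)) < e" by blast
qed

lemma cauchy_const: "u \<in> vcarrier T \<Longrightarrow> cauchy (\<lambda>n. u)"
  by (simp add: cauchy_iff td_refl)

lemma cauchy_pn: "cauchy s \<Longrightarrow> convergent (\<lambda>n. pn (s n))"
  using cauchy_td[OF _ cauchy_const[OF zero_in]] by (simp add: td_zero)

lemma cauchy_add: assumes s: "cauchy s" and t: "cauchy t"
  shows "cauchy (\<lambda>n B. s n B + t n B)"
  unfolding cauchy_iff
proof (intro conjI allI impI)
  show "(\<lambda>B. s n B + t n B) \<in> vcarrier T" for n by (intro add_in cauchy_in s t)
  fix e :: real assume "0 < e"
  then have e: "0 < e/2" by simp
  obtain N where N: "\<And>m n. m \<ge> N \<Longrightarrow> n \<ge> N \<Longrightarrow> td (s m) (s n) < e/2"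
    using s e unfolding cauchy_iff by meson
  obtain M where M: "\<And>m n. m \<ge> M \<Longrightarrow> n \<ge> M \<Longrightarrow> td (t m) (t n) < e/2"
    using t e unfolding cauchy_iff by meson
  have "td (\<lambda>B. s m B + t m B) (\<lambda>B. s n B + t n B) < e" if "m \<ge> max N M" "n \<ge> max N M" for m n
  proof -
    have "td (\<lambda>B. s m B + t m B) (\<lambda>B. s n B + t n B) \<le> td (s m) (s n) + td (t m) (t n)"
      unfolding td_def using pn_triangle[OF diff_in diff_in, of "s m" "s n" "t m" "t n"]
        cauchy_in[OF s] cauchy_in[OF t] by (simp add: algebra_simps)
    then show ?thesis using N[of m n] M[of m n] that by simp
  qed
  then show "\<exists>N. \<forall>m\<ge>N. \<forall>n\<ge>N. td (\<lambda>B. s m B + t m B) (\<lambda>B. s n B + t n B) < e" by blast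
qed

lemma cauchy_neg: assumes s: "cauchy s" shows "cauchy (\<lambda>n B. - s n B)"
proof -
  have "td (\<lambda>B. - s m B) (\<lambda>B. - s n B) = td (s n) (s m)" for m n
    by (simp add: td_def)
  then show ?thesis using s by (simp add: cauchy_iff neg_in) blast
qed

lemma in_cls: "t \<in> cls s \<longleftrightarrow> cauchy t \<and> (\<lambda>n. td (s n) (t n)) \<longlonglongrightarrow> 0"
  by (simp add: Cauchy_class_def vdist_T)

text \<open>The class contains \<open>s\<close> itself, so the choice made by \<open>rep\<close> is
  genuine and yields a sequence equivalent to \<open>s\<close>.\<close>

lemma rep_cls: assumes "cauchy s"
  shows cauchy_rep: "cauchy (rep (cls s))" and rep_lim: "(\<lambda>n. td (s n) (rep (cls s) n)) \<longlonglongrightarrow> 0"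
proof -
  have "s \<in> cls s" using assms by (simp add: in_cls td_refl)
  then have "rep (cls s) \<in> cls s" unfolding rep_def by (rule someI[of "\<lambda>c. c \<in> cls s"])
  then show "cauchy (rep (cls s))" "(\<lambda>n. td (s n) (rep (cls s) n)) \<longlonglongrightarrow> 0" by (auto simp: in_cls)
qed

lemma td_lim_trans:
  assumes "cauchy s" "cauchy t" "cauchy r" "(\<lambda>n. td (s n) (t n)) \<longlonglongrightarrow> 0" "(\<lambda>n. td (t n) (r n)) \<longlonglongrightarrow> 0"
  shows "(\<lambda>n. td (s n) (r n)) \<longlonglongrightarrow> 0"
proof (rule LIMSEQ_0_le)
  show "(\<lambda>n. td (s n) (t n) + td (t n) (r n)) \<longlonglongrightarrow> 0" using tendsto_add[OF assms(4,5)] by simp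
qed (intro td_nonneg td_triangle cauchy_in assms)+

lemma cls_eqI:
  assumes st: "cauchy s" "cauchy t" and "(\<lambda>n. td (s n) (t n)) \<longlonglongrightarrow> 0"
  shows "cls s = cls t"
proof -
  have "(\<lambda>n. td (t n) (s n)) \<longlonglongrightarrow> 0"
    using assms(3) td_commute[OF cauchy_in[OF st(1)] cauchy_in[OF st(2)]] by simp
  then show ?thesis
    using td_lim_trans[OF st(1,2)] td_lim_trans[OF st(2,1)] assms(3) by (auto simp: in_cls)
qed

text \<open>The norm of the completion is computed from chosen representatives; this makes it
  independent of the choice.\<close>

lemma td_lim_cong:
  assumes s: "cauchy s" "cauchy s'" and t: "cauchy t" "cauchy t'"
   and ss: "(\<lambda>n. td (s n) (s' n)) \<longlonglongrightarrow> 0" and tt: "(\<lambda>n. td (t n) (t' n)) \<longlonglongrightarrow> 0"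
  shows "lim (\<lambda>n. td (s n) (t n)) = lim (\<lambda>n. td (s' n) (t' n))"
proof -
  obtain L where L: "(\<lambda>n. td (s n) (t n)) \<longlonglongrightarrow> L" using cauchy_td[OF s(1) t(1)] by (auto simp: convergent_def)
  have "(\<lambda>n. td (s n) (t n) - td (s' n) (t' n)) \<longlonglongrightarrow> 0"
  proof (rule Lim_null_comparison)
    show "\<forall>\<^sub>F n in sequentially. norm (td (s n) (t n) - td (s' n) (t' n)) \<le> td (s n) (s' n) + td (t n) (t' n)"
    proof (rule always_eventually, rule allI)
      fix n
      have c: "s n \<in> vcarrier T" "s' n \<in> vcarrier T" "t n \<in> vcarrier T" "t' n \<in> vcarrier T"
        using cauchy_in s t by auto
      show "norm (td (s n) (t n) - td (s' n) (t' n)) \<le> td (s n) (s' n) + td (t n) (t' n)"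
        using td_triangle[of "s n" "s' n" "t n"] td_triangle[of "s' n" "t' n" "t n"]
          td_triangle[of "s' n" "s n" "t' n"] td_triangle[of "s n" "t n" "t' n"]
          td_commute[of "s n" "s' n"] td_commute[of "t n" "t' n"] c by simp
    qed
    show "(\<lambda>n. td (s n) (s' n) + td (t n) (t' n)) \<longlonglongrightarrow> 0" using tendsto_add[OF ss tt] by simp
  qed
  from tendsto_diff[OF L this] have "(\<lambda>n. td (s' n) (t' n)) \<longlonglongrightarrow> L" by simp
  with L show ?thesis by (simp add: limI)
qed

lemma completion_norm: assumes "cauchy s" shows "vnorm (completion T) (cls s) = lim (\<lambda>n. pn (s n))"
proof -
  have z: "cauchy (\<lambda>n B. 0)" by (rule cauchy_const[OF zero_in])
  show ?thesis
    using td_lim_cong[OF assms cauchy_rep[OF assms] z z rep_lim[OF assms]]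
    by (simp add: completion_def alg_tensor_simps td_zero pn_zero)
qed

lemma completion_add: assumes s: "cauchy s" and t: "cauchy t"
  shows "vadd (completion T) (cls s) (cls t) = cls (\<lambda>n B. s n B + t n B)"
proof -
  let ?r = "rep (cls s)" and ?q = "rep (cls t)"
  have "cls (\<lambda>n B. s n B + t n B) = cls (\<lambda>n B. ?r n B + ?q n B)"
  proof (rule cls_eqI)
    show "cauchy (\<lambda>n B. s n B + t n B)" by (intro cauchy_add s t)
    show "cauchy (\<lambda>n B. ?r n B + ?q n B)" by (intro cauchy_add cauchy_rep s t)
    show "(\<lambda>n. td (\<lambda>B. s n B + t n B) (\<lambda>B. ?r n B + ?q n B)) \<longlonglongrightarrow> 0"
    proof (rule LIMSEQ_0_le)
      show "(\<lambda>n. td (s n) (?r n) + td (t n) (?q n)) \<longlonglongrightarrow> 0"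
        using tendsto_add[OF rep_lim[OF s] rep_lim[OF t]] by simp
      show "td (\<lambda>B. s n B + t n B) (\<lambda>B. ?r n B + ?q n B) \<le> td (s n) (?r n) + td (t n) (?q n)" for n
        unfolding td_def using pn_triangle[OF diff_in diff_in, of "s n" "?r n" "t n" "?q n"]
          cauchy_in[OF s] cauchy_in[OF t] cauchy_in[OF cauchy_rep[OF s]] cauchy_in[OF cauchy_rep[OF t]]
        by (simp add: algebra_simps)
    qed (intro td_nonneg add_in cauchy_in cauchy_rep s t)+
  qed
  then show ?thesis by (simp add: completion_def alg_tensor_simps)
qed

lemma completion_neg: assumes s: "cauchy s"
  shows "vscale (completion T) (-1) (cls s) = cls (\<lambda>n B. - s n B)"
proof -
  let ?r = "rep (cls s)"
  have "cls (\<lambda>n B. - s n B) = cls (\<lambda>n B. - ?r n B)"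
  proof (rule cls_eqI)
    have "td (\<lambda>B. - s n B) (\<lambda>B. - ?r n B) = td (s n) (?r n)" for n
      using td_commute[OF cauchy_in[OF s] cauchy_in[OF cauchy_rep[OF s]], of n n] by (simp add: td_def)
    then show "(\<lambda>n. td (\<lambda>B. - s n B) (\<lambda>B. - ?r n B)) \<longlonglongrightarrow> 0" using rep_lim[OF s] by simp
  qed (intro cauchy_neg cauchy_rep s)+
  then show ?thesis by (simp add: completion_def alg_tensor_simps)
qed

lemma completion_dist: assumes s: "cauchy s" and t: "cauchy t"
  shows "vdist (completion T) (cls s) (cls t) = lim (\<lambda>n. td (s n) (t n))"
  unfolding vdist_def completion_neg[OF t] completion_add[OF s cauchy_neg[OF t]]
    completion_norm[OF cauchy_add[OF s cauchy_neg[OF t]]] by (simp add: td_def)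

lemma completion_partial_sum:
  assumes "\<And>i. x i \<in> vcarrier X" "\<And>i. y i \<in> vcarrier Y"
  shows "vpartial_sum (proj_tensor X Y) (\<lambda>i. proj_elem_tensor X Y (x i) (y i)) n
    = cls (\<lambda>k B. \<Sum>i<n. et (x i) (y i) B)"
proof (induction n)
  case 0
  show ?case by (simp add: proj_tensor_def completion_def alg_tensor_simps)
next
  case (Suc n)
  have "cauchy (\<lambda>k B. \<Sum>i<n. et (x i) (y i) B)"
    by (intro cauchy_const finite_sum_in) (use assms in auto)
  moreover have "cauchy (\<lambda>k B. et (x n) (y n) B)"
    using finite_sum_in[of "{n}" x y] assms by (intro cauchy_const) simp
  ultimately show ?case
    using completion_add[of "\<lambda>k B. \<Sum>i<n. et (x i) (y i) B" "\<lambda>k B. et (x n) (y n) B"]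
      Suc.IH by (simp add: proj_tensor_def proj_elem_tensor_def completion_embed_def)
qed

text \<open>Membership of the class of \<open>s\<close> in \<open>NA_proj\<close>, expressed by
  \<open>s\<close> alone. A partial sum is the class of a constant sequence, so its distance to the
  class of \<open>s\<close> is the inner limit over \<open>k\<close>.\<close>

definition attains where
  "attains s \<longleftrightarrow> (\<exists>x y. (\<forall>i. x i \<in> vcarrier X) \<and> (\<forall>i. y i \<in> vcarrier Y) \<and>
     (\<lambda>n. lim (\<lambda>k. td (\<lambda>B. \<Sum>i<n. et (x i) (y i) B) (s k))) \<longlonglongrightarrow> 0 \<and>
     (\<lambda>i. vnorm X (x i) * vnorm Y (y i)) sums lim (\<lambda>k. pn (s k)))"

lemma cls_in_NA: assumes s: "cauchy s" shows "cls s \<in> NA_proj X Y \<longleftrightarrow> attains s"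
proof -
  have c: "cls s \<in> vcarrier (proj_tensor X Y)"
    using s by (simp add: proj_tensor_def completion_def)
  have "vsums (proj_tensor X Y) (\<lambda>i. proj_elem_tensor X Y (x i) (y i)) (cls s) \<longleftrightarrow>
    (\<lambda>n. lim (\<lambda>k. td (\<lambda>B. \<Sum>i<n. et (x i) (y i) B) (s k))) \<longlonglongrightarrow> 0"
    if "\<forall>i. x i \<in> vcarrier X" "\<forall>i. y i \<in> vcarrier Y" for x y
  proof -
    have "cauchy (\<lambda>k B. \<Sum>i<n. et (x i) (y i) B)" for n
      by (intro cauchy_const finite_sum_in) (use that in auto)
    from completion_dist[OF this s] show ?thesis
      unfolding vsums_def using that by (simp add: completion_partial_sum) (simp add: proj_tensor_def)
  qed
  moreover have "vnorm (proj_tensor X Y) (cls s) = lim (\<lambda>k. pn (s k))"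
    using completion_norm[OF s] by (simp add: proj_tensor_def)
  ultimately show ?thesis
    unfolding NA_proj_def attains_def using c by auto
qed

text \<open>From here on, classes and their representatives can be forgotten.\<close>

lemma NA_all_iff: "NA_proj X Y = vcarrier (proj_tensor X Y) \<longleftrightarrow> (\<forall>s. cauchy s \<longrightarrow> attains s)"
proof -
  have 1: "vcarrier (proj_tensor X Y) = cls ` {s. cauchy s}"
    by (simp add: proj_tensor_def completion_def)
  have 2: "NA_proj X Y \<subseteq> vcarrier (proj_tensor X Y)" by (auto simp: NA_proj_def)
  show ?thesis using cls_in_NA 2 unfolding 1 by blast
qed

end

section \<open>Swapping the factors\<close>

text \<open>The canonical isometry between the two orders of the factors: a functional on forms is
  composed with transposition.\<close>

definition flip where "flip u = (\<lambda>B. u (\<lambda>x y. B y x))"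

lemma flip_flip [simp]: "flip (flip u) = u"
  by (simp add: flip_def)

text \<open>Transposition maps bilinear forms to bilinear forms and other functions to other
  functions, so the default value 0 is preserved as well.\<close>

lemma flip_elem_tensor: "flip (elem_tensor X Y x y) = elem_tensor Y X y x"
proof
  fix B
  have "(\<lambda>x y. B y x) \<in> bilinear_forms X Y \<longleftrightarrow> B \<in> bilinear_forms Y X"
    unfolding bilinear_forms_def mem_Collect_eq by blast
  then show "flip (elem_tensor X Y x y) B = elem_tensor Y X y x B"
    by (simp add: flip_def elem_tensor_def)
qed

lemma flip_sum_elem_tensor:
  "flip (\<lambda>B. \<Sum>i\<in>I. elem_tensor X Y (x i) (y i) B) = (\<lambda>B. \<Sum>i\<in>I. elem_tensor Y X (y i) (x i) B)"
proof -
  have "elem_tensor X Y x y (\<lambda>x y. B y x) = elem_tensor Y X y x B" for x y B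
    using flip_elem_tensor[of X Y x y] by (simp add: flip_def fun_eq_iff)
  then show ?thesis by (simp add: flip_def)
qed

lemma tensor_rep_flipI:
  assumes "tensor_rep X Y u n x y" shows "tensor_rep Y X (flip u) n y x"
proof -
  have "u = (\<lambda>B. \<Sum>i<n. elem_tensor X Y (x i) (y i) B)" using assms by (simp add: tensor_rep_def)
  then have "flip u = (\<lambda>B. \<Sum>i<n. elem_tensor Y X (y i) (x i) B)"
    by (simp only: flip_sum_elem_tensor)
  with assms show ?thesis by (simp add: tensor_rep_def)
qed

lemma tensor_rep_flip: "tensor_rep Y X (flip u) n y x \<longleftrightarrow> tensor_rep X Y u n x y"
  using tensor_rep_flipI[of X Y u] tensor_rep_flipI[of Y X "flip u"] by auto

lemma proj_norm_flip: "proj_norm Y X (flip u) = proj_norm X Y u"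
  unfolding proj_norm_def
proof (rule arg_cong[where f=Inf], intro set_eqI iffI)
  fix r assume "r \<in> {\<Sum>i<n. vnorm Y (x i) * vnorm X (y i) | n x y. tensor_rep Y X (flip u) n x y}"
  then obtain n x y where "r = (\<Sum>i<n. vnorm Y (x i) * vnorm X (y i))" "tensor_rep Y X (flip u) n x y"
    by blast
  then show "r \<in> {\<Sum>i<n. vnorm X (x i) * vnorm Y (y i) | n x y. tensor_rep X Y u n x y}"
    by (intro CollectI exI[of _ n] exI[of _ y] exI[of _ x]) (simp add: tensor_rep_flip mult.commute)
next
  fix r assume "r \<in> {\<Sum>i<n. vnorm X (x i) * vnorm Y (y i) | n x y. tensor_rep X Y u n x y}"
  then obtain n x y where "r = (\<Sum>i<n. vnorm X (x i) * vnorm Y (y i))" "tensor_rep X Y u n x y"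
    by blast
  then show "r \<in> {\<Sum>i<n. vnorm Y (x i) * vnorm X (y i) | n x y. tensor_rep Y X (flip u) n x y}"
    by (intro CollectI exI[of _ n] exI[of _ y] exI[of _ x]) (simp add: tensor_rep_flip mult.commute)
qed

lemma alg_tensor_flip: "flip u \<in> vcarrier (alg_tensor Y X) \<longleftrightarrow> u \<in> vcarrier (alg_tensor X Y)"
  unfolding alg_tensor_simps mem_Collect_eq tensor_rep_flip by blast

context norm_pair begin

lemma NA_all_swap:
  assumes "NA_proj Y X = vcarrier (proj_tensor Y X)"
  shows "NA_proj X Y = vcarrier (proj_tensor X Y)"
  unfolding NA_all_iff
proof (intro allI impI)
  interpret S: norm_pair Y X by (rule norm_pair_swap)
  have d: "S.td (flip u) (flip v) = td u v" for u v
    using proj_norm_flip[of Y X "\<lambda>B. u B - v B"] by (simp add: td_def S.td_def flip_def)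
  fix s assume s: "cauchy s"
  then have "S.cauchy (\<lambda>n. flip (s n))"
    by (simp add: S.cauchy_iff cauchy_iff d alg_tensor_flip)
  then have "S.attains (\<lambda>n. flip (s n))" using assms unfolding S.NA_all_iff by blast
  then obtain y x where "\<forall>i. y i \<in> vcarrier Y" "\<forall>i. x i \<in> vcarrier X"
    and 1: "(\<lambda>n. lim (\<lambda>k. S.td (\<lambda>B. \<Sum>i<n. S.et (y i) (x i) B) (flip (s k)))) \<longlonglongrightarrow> 0"
    and 2: "(\<lambda>i. vnorm Y (y i) * vnorm X (x i)) sums lim (\<lambda>k. S.pn (flip (s k)))"
    unfolding S.attains_def by auto
  moreover have "S.td (\<lambda>B. \<Sum>i<n. S.et (y i) (x i) B) (flip (s k)) = td (\<lambda>B. \<Sum>i<n. et (x i) (y i) B) (s k)" for n k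
    using d[of "\<lambda>B. \<Sum>i<n. et (x i) (y i) B" "s k"] by (simp add: flip_sum_elem_tensor)
  ultimately show "attains s"
    unfolding attains_def by (intro exI[of _ x] exI[of _ y]) (simp add: proj_norm_flip mult.commute)
qed

end

section \<open>The space \<open>L\<^sub>1\<close>\<close>

lemma L1_class_eqI:
  assumes "integrable M f" "integrable M g" "AE x in M. f x = g x"
  shows "L1_class M f = L1_class M g"
  unfolding L1_class_def using assms(3) by (intro Collect_cong conj_cong refl) auto

lemma rep_L1_class:
  assumes "integrable M f"
  shows integrable_rep_L1_class: "integrable M (rep (L1_class M f))"
    and AE_rep_L1_class: "AE x in M. rep (L1_class M f) x = f x"
proof -
  have "f \<in> L1_class M f" using assms by (simp add: L1_class_def)
  then have "rep (L1_class M f) \<in> L1_class M f" 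
    unfolding rep_def by (rule someI[of "\<lambda>c. c \<in> L1_class M f"])
  then show "integrable M (rep (L1_class M f))" "AE x in M. rep (L1_class M f) x = f x"
    by (auto simp: L1_class_def)
qed

lemma L1_class_in: "integrable M f \<Longrightarrow> L1_class M f \<in> vcarrier (L1 TYPE('k) M)"
  for f :: "'a \<Rightarrow> 'k::{real_normed_field, banach, second_countable_topology}"
  by (simp add: L1_def)

lemma L1_carrierE:
  assumes "F \<in> vcarrier (L1 TYPE('k::{real_normed_field, banach, second_countable_topology}) M)"
  obtains f where "integrable M f" "F = L1_class M f"
  using assms by (auto simp: L1_def)

lemma integrable_rep: "F \<in> vcarrier (L1 TYPE('k::{real_normed_field, banach, second_countable_topology}) M)
    \<Longrightarrow> integrable M (rep F)"
  by (elim L1_carrierE) (simp add: integrable_rep_L1_class)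

lemma L1_norm_class: 
  fixes f :: "'a \<Rightarrow> 'k::{real_normed_field, banach, second_countable_topology}"
  assumes "integrable M f"
  shows "vnorm (L1 TYPE('k) M) (L1_class M f) = (\<integral>x. norm (f x) \<partial>M)"
proof -
  have "(\<integral>x. norm (rep (L1_class M f) x) \<partial>M) = (\<integral>x. norm (f x) \<partial>M)"
    using rep_L1_class[OF assms] assms by (intro integral_cong_AE) auto
  then show ?thesis by (simp add: L1_def)
qed

lemma L1_norm: "vnorm (L1 TYPE('k::{real_normed_field, banach, second_countable_topology}) M) F
    = (\<integral>x. norm (rep F x) \<partial>M)"
  by (simp add: L1_def)

lemma L1_norm_nonneg: "0 \<le> vnorm (L1 TYPE('k::{real_normed_field, banach, second_countable_topology}) M) F"
  by (simp add: L1_norm)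

lemma L1_add: "vadd (L1 TYPE('k::{real_normed_field, banach, second_countable_topology}) M) F G
    = L1_class M (\<lambda>x. rep F x + rep G x)"
  by (simp add: L1_def)

lemma L1_scale: "vscale (L1 TYPE('k::{real_normed_field, banach, second_countable_topology}) M) a F
    = L1_class M (\<lambda>x. a * rep F x)"
  by (simp add: L1_def)

lemma L1_norm_pair: 
  "norm_pair (L1 TYPE('k::{real_normed_field, banach, second_countable_topology}) M) (L1 TYPE('k) N)"
proof -
  have *: "vscale (L1 TYPE('k) M) (-1) F \<in> vcarrier (L1 TYPE('k) M)"
    "vnorm (L1 TYPE('k) M) (vscale (L1 TYPE('k) M) (-1) F) = vnorm (L1 TYPE('k) M) F"
    if "F \<in> vcarrier (L1 TYPE('k) M)" for M :: "'c measure" and F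
    using integrable_rep[OF that] by (auto simp: L1_scale L1_norm_class L1_class_in) (simp add: L1_norm)
  show ?thesis by unfold_locales (auto simp: L1_norm_nonneg *)
qed

subsection \<open>Bounded functions as functionals\<close>

text \<open>Stands for the elements of the dual of L1 that are needed. The test functions are
  indicators and signs, which are bounded at every point, so no essential supremum is
  involved.\<close>

definition bdd_fun :: "'a measure \<Rightarrow> ('a \<Rightarrow> 'k::{real_normed_field, banach, second_countable_topology}) \<Rightarrow> bool" where
  "bdd_fun M h \<longleftrightarrow> h \<in> borel_measurable M \<and> (\<exists>C. \<forall>x. norm (h x) \<le> C)"

definition pairing :: "'a measure \<Rightarrow> ('a \<Rightarrow> 'k::{real_normed_field, banach, second_countable_topology}) \<Rightarrow> ('a \<Rightarrow> 'k) set \<Rightarrow> 'k" where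
  "pairing M h F = (\<integral>x. h x * rep F x \<partial>M)"

lemma bdd_fun_indicator [simp]: "A \<in> sets M \<Longrightarrow> bdd_fun M (indicator A)"
  unfolding bdd_fun_def by (intro conjI exI[of _ 1]) (auto simp: indicator_def)

lemma bdd_fun_integrable:
  assumes h: "bdd_fun M h" and f: "integrable M f"
  shows "integrable M (\<lambda>x. h x * f x)"
proof -
  obtain C where C: "\<And>x. norm (h x) \<le> C" using h by (auto simp: bdd_fun_def)
  have m: "h \<in> borel_measurable M" using h by (simp add: bdd_fun_def)
  show ?thesis
  proof (rule Bochner_Integration.integrable_bound)
    show "integrable M (\<lambda>x. C * norm (f x))" using f by simp
    show "(\<lambda>x. h x * f x) \<in> borel_measurable M" using m f by measurable
    show "AE x in M. norm (h x * f x) \<le> norm (C * norm (f x))"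
      using mult_right_mono[OF C norm_ge_zero] by (auto simp: norm_mult intro!: order_trans[OF _ abs_ge_self])
  qed
qed

lemma pairing_class:
  assumes h: "bdd_fun M h" and f: "integrable M f"
  shows "pairing M h (L1_class M f) = (\<integral>x. h x * f x \<partial>M)"
  unfolding pairing_def
proof (rule integral_cong_AE)
  show "(\<lambda>x. h x * rep (L1_class M f) x) \<in> borel_measurable M" "(\<lambda>x. h x * f x) \<in> borel_measurable M"
    using bdd_fun_integrable[OF h f] bdd_fun_integrable[OF h integrable_rep_L1_class[OF f]]
    by (auto intro: borel_measurable_integrable)
  show "AE x in M. h x * rep (L1_class M f) x = h x * f x"
    using AE_rep_L1_class[OF f] by auto
qed

lemma pairing_add:
  assumes h: "bdd_fun M h" and F: "F \<in> vcarrier (L1 TYPE('k::{real_normed_field, banach, second_countable_topology}) M)" 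
    and G: "G \<in> vcarrier (L1 TYPE('k) M)"
  shows "pairing M h (vadd (L1 TYPE('k) M) F G) = pairing M h F + pairing M h G"
  using pairing_class[OF h, of "\<lambda>x. rep F x + rep G x"] integrable_rep[OF F] integrable_rep[OF G]
    bdd_fun_integrable[OF h integrable_rep[OF F]] bdd_fun_integrable[OF h integrable_rep[OF G]]
  by (simp add: L1_add pairing_def distrib_left)

lemma pairing_scale:
  assumes h: "bdd_fun M h" and F: "F \<in> vcarrier (L1 TYPE('k::{real_normed_field, banach, second_countable_topology}) M)" 
  shows "pairing M h (vscale (L1 TYPE('k) M) a F) = a * pairing M h F"
proof -
  have "(\<integral>x. h x * (a * rep F x) \<partial>M) = (\<integral>x. a * (h x * rep F x) \<partial>M)"
    by (simp add: ac_simps)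
  then show ?thesis
    using pairing_class[OF h, of "\<lambda>x. a * rep F x"] integrable_rep[OF F] 
    by (simp add: L1_scale pairing_def)
qed

lemma pairing_norm:
  "norm (pairing M h F) \<le> (\<integral>x. norm (h x) * norm (rep F x) \<partial>M)"
  unfolding pairing_def using integral_norm_bound[of M "\<lambda>x. h x * rep F x"] by (simp add: norm_mult)

lemma pairing_sum_form:
  fixes h :: "'i \<Rightarrow> 'a \<Rightarrow> 'k::{real_normed_field, banach, second_countable_topology}"
  assumes "\<And>i. i \<in> I \<Longrightarrow> bdd_fun M (h i)" "\<And>i. i \<in> I \<Longrightarrow> bdd_fun N (g i)"
  shows "(\<lambda>F G. \<Sum>i\<in>I. pairing M (h i) F * pairing N (g i) G) \<in> bilinear_forms (L1 TYPE('k) M) (L1 TYPE('k) N)"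
proof -
  have 1: "(\<Sum>i\<in>I. pairing M (h i) (vadd (L1 TYPE('k) M) F F') * pairing N (g i) G)
    = (\<Sum>i\<in>I. pairing M (h i) F * pairing N (g i) G) + (\<Sum>i\<in>I. pairing M (h i) F' * pairing N (g i) G)"
    if "F \<in> vcarrier (L1 TYPE('k) M)" "F' \<in> vcarrier (L1 TYPE('k) M)" for F F' G
    unfolding sum.distrib[symmetric] using assms that
    by (intro sum.cong refl) (simp add: pairing_add distrib_right)
  have 2: "(\<Sum>i\<in>I. pairing M (h i) F * pairing N (g i) (vadd (L1 TYPE('k) N) G G'))
    = (\<Sum>i\<in>I. pairing M (h i) F * pairing N (g i) G) + (\<Sum>i\<in>I. pairing M (h i) F * pairing N (g i) G')"
    if "G \<in> vcarrier (L1 TYPE('k) N)" "G' \<in> vcarrier (L1 TYPE('k) N)" for F G G'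
    unfolding sum.distrib[symmetric] using assms that
    by (intro sum.cong refl) (simp add: pairing_add distrib_left)
  have 3: "(\<Sum>i\<in>I. pairing M (h i) (vscale (L1 TYPE('k) M) a F) * pairing N (g i) G)
    = a * (\<Sum>i\<in>I. pairing M (h i) F * pairing N (g i) G)"
    if "F \<in> vcarrier (L1 TYPE('k) M)" for a F G
    unfolding sum_distrib_left using assms that
    by (intro sum.cong refl) (simp add: pairing_scale)
  have 4: "(\<Sum>i\<in>I. pairing M (h i) F * pairing N (g i) (vscale (L1 TYPE('k) N) a G))
    = a * (\<Sum>i\<in>I. pairing M (h i) F * pairing N (g i) G)"
    if "G \<in> vcarrier (L1 TYPE('k) N)" for a F G
    unfolding sum_distrib_left using assms that
    by (intro sum.cong refl) (simp add: pairing_scale)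
  show ?thesis
    unfolding bilinear_forms_def mem_Collect_eq using 1 2 3 4 by blast
qed

text \<open>The function \<open>norm f / f\<close> plays the role of the conjugate sign for a general scalar field.\<close>

lemma bdd_fun_sign:
  fixes f :: "'a \<Rightarrow> 'k::{real_normed_field, banach, second_countable_topology}"
  assumes f: "f \<in> borel_measurable M"
  shows "bdd_fun M (\<lambda>x. of_real (norm (f x)) / f x)" "norm (of_real (norm (f x)) / f x) \<le> 1"
    "of_real (norm (f x)) / f x * f x = of_real (norm (f x))"
proof -
  \<comment> \<open>At zeros of \<open>f\<close> the quotient is 0, as division by 0 gives
    0.\<close>
  show 1: "norm (of_real (norm (f x)) / f x) \<le> 1" for x
    by (simp add: norm_divide)
  show "bdd_fun M (\<lambda>x. of_real (norm (f x)) / f x)"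
    unfolding bdd_fun_def using f 1 by (intro conjI exI[of _ 1]) auto
qed simp

subsection \<open>Completeness\<close>

text \<open>Riesz-Fischer: a subsequence with summable increments converges almost everywhere, and
  Fatou's lemma passes the Cauchy estimate to its limit.\<close>

lemma L1_complete:
  fixes f :: "nat \<Rightarrow> 'a \<Rightarrow> 'b::{banach, second_countable_topology}"
  assumes f: "\<And>n. integrable M (f n)"
    and Cauchy: "\<And>e. 0 < e \<Longrightarrow> \<exists>N. \<forall>m\<ge>N. \<forall>n\<ge>N. (\<integral>x. norm (f m x - f n x) \<partial>M) < e"
  obtains g where "integrable M g" "(\<lambda>n. \<integral>x. norm (f n x - g x) \<partial>M) \<longlonglongrightarrow> 0"
proof -
  note [measurable] = borel_measurable_integrable[OF f]
  have "\<exists>N. \<forall>m\<ge>N. \<forall>n\<ge>N. (\<integral>x. norm (f m x - f n x) \<partial>M) < (1/2)^k" for k :: nat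
    by (rule Cauchy) simp
  then obtain N where N: "\<And>k m n. m \<ge> N k \<Longrightarrow> n \<ge> N k \<Longrightarrow> (\<integral>x. norm (f m x - f n x) \<partial>M) < (1/2)^k"
    by metis
  \<comment> \<open>Summing the thresholds gives indices that are monotone and still exceed
    \<open>N k\<close>.\<close>
  define r where "r k = (\<Sum>i\<le>k. N i)" for k
  have rN: "N k \<le> r k" for k unfolding r_def by (rule member_le_sum) auto
  have r_mono: "r k \<le> r j" if "k \<le> j" for k j
    unfolding r_def using that by (intro sum_mono2) auto
  define d where "d k x = f (r (Suc k)) x - f (r k) x" for k x
  have d: "integrable M (d k)" for k unfolding d_def using f by simp
  have d_le: "(\<integral>x. norm (d k x) \<partial>M) \<le> (1/2)^k" for k
    unfolding d_def using N[of k "r (Suc k)" "r k"] rN[of k] r_mono[of k "Suc k"] by simp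
  have [measurable]: "d k \<in> borel_measurable M" for k using d by auto
  have "(\<integral>\<^sup>+x. (\<Sum>k. ennreal (norm (d k x))) \<partial>M) = (\<Sum>k. \<integral>\<^sup>+x. norm (d k x) \<partial>M)"
    by (rule nn_integral_suminf) auto
  also have "\<dots> = (\<Sum>k. ennreal (\<integral>x. norm (d k x) \<partial>M))"
    using d by (simp add: nn_integral_eq_integral)
  also have "\<dots> \<le> (\<Sum>k. ennreal ((1/2)^k))"
    using d_le by (intro suminf_le summableI) (auto intro: ennreal_leI)
  also have "\<dots> = ennreal (\<Sum>k. (1/2)^k)"
    by (intro suminf_ennreal2) auto
  finally have "(\<integral>\<^sup>+x. (\<Sum>k. ennreal (norm (d k x))) \<partial>M) \<noteq> \<infinity>" by (auto simp: top_unique)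
  then have "AE x in M. (\<Sum>k. ennreal (norm (d k x))) \<noteq> \<infinity>"
    by (intro nn_integral_PInf_AE) auto
  then have conv: "AE x in M. convergent (\<lambda>k. f (r k) x)"
  proof eventually_elim
    case (elim x)
    then have "summable (\<lambda>k. norm (d k x))" by (intro summable_suminf_not_top) auto
    then have "summable (\<lambda>k. d k x)" by (rule summable_norm_cancel)
    then have "convergent (\<lambda>n. \<Sum>k<n. d k x)" by (simp add: summable_iff_convergent)
    then have "convergent (\<lambda>n. (\<Sum>k<n. d k x) + f (r 0) x)"
      by (intro convergent_add convergent_const)
    moreover have "(\<Sum>k<n. d k x) + f (r 0) x = f (r n) x" for n
      unfolding d_def by (simp add: sum_lessThan_telescope[of "\<lambda>k. f (r k) x"])
    ultimately show ?case by simp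
  qed
  define g where "g x = lim (\<lambda>k. f (r k) x)" for x
  have [measurable]: "g \<in> borel_measurable M" unfolding g_def by measurable
  have g: "AE x in M. (\<lambda>k. f (r k) x) \<longlonglongrightarrow> g x"
    using conv by eventually_elim (simp add: g_def convergent_LIMSEQ_iff)
  \<comment> \<open>With \<open>n\<close> fixed only the subsequence index tends to infinity. This
    controls the whole sequence, and it also yields the integrability of \<open>g\<close>.\<close>
  have Fatou: "(\<integral>\<^sup>+x. norm (f n x - g x) \<partial>M) \<le> ennreal ((1/2)^k)" if n: "n \<ge> N k" for n k
  proof -
    have "(\<integral>\<^sup>+x. norm (f n x - g x) \<partial>M) = (\<integral>\<^sup>+x. liminf (\<lambda>j. ennreal (norm (f n x - f (r j) x))) \<partial>M)"
    proof (rule nn_integral_cong_AE)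
      show "AE x in M. ennreal (norm (f n x - g x)) = liminf (\<lambda>j. ennreal (norm (f n x - f (r j) x)))"
        using g
      proof eventually_elim
        case (elim x)
        then have "(\<lambda>j. ennreal (norm (f n x - f (r j) x))) \<longlonglongrightarrow> ennreal (norm (f n x - g x))"
          by (intro tendsto_intros)
        then show ?case by (intro lim_imp_Liminf[symmetric]) simp_all
      qed
    qed
    also have "\<dots> \<le> liminf (\<lambda>j. \<integral>\<^sup>+x. norm (f n x - f (r j) x) \<partial>M)"
      by (rule nn_integral_liminf) auto
    also have "\<dots> \<le> limsup (\<lambda>j. \<integral>\<^sup>+x. norm (f n x - f (r j) x) \<partial>M)"
      by (rule Liminf_le_Limsup) simp
    also have "\<dots> \<le> ennreal ((1/2)^k)"
    proof (rule Limsup_bounded)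
      show "\<forall>\<^sub>F j in sequentially. (\<integral>\<^sup>+x. norm (f n x - f (r j) x) \<partial>M) \<le> ennreal ((1/2)^k)"
        using eventually_ge_at_top[of k]
      proof eventually_elim
        case (elim j)
        then have "(\<integral>x. norm (f n x - f (r j) x) \<partial>M) < (1/2)^k"
          using N[of k n "r j"] n rN[of k] r_mono[of k j] by simp
        then have "ennreal (\<integral>x. norm (f n x - f (r j) x) \<partial>M) \<le> ennreal ((1/2)^k)"
          by (intro ennreal_leI) simp
        then show ?case using f by (simp add: nn_integral_eq_integral)
      qed
    qed
    finally show ?thesis .
  qed
  have fg: "integrable M (\<lambda>x. f n x - g x)" if "n \<ge> N k" for n k
    using Fatou[OF that] by (intro integrableI_bounded) (auto simp: top_unique less_top[symmetric])
  have gi: "integrable M g"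
    using Bochner_Integration.integrable_diff[OF f[of "N 0"] fg[of 0 "N 0"]] by simp
  have "(\<integral>x. norm (f n x - g x) \<partial>M) \<le> (1/2)^k" if "n \<ge> N k" for n k
    using Fatou[OF that] fg[OF that] by (simp add: nn_integral_eq_integral)
  note bd = this
  have "(\<lambda>n. \<integral>x. norm (f n x - g x) \<partial>M) \<longlonglongrightarrow> 0"
  proof (rule LIMSEQ_I)
    fix e :: real assume "0 < e"
    then obtain k where k: "(1/2)^k < e" using real_arch_pow_inv[of e "1/2"] by auto
    then show "\<exists>n0. \<forall>n\<ge>n0. norm ((\<integral>x. norm (f n x - g x) \<partial>M) - 0) < e"
      using bd[of k] by (intro exI[of _ "N k"]) (auto intro: le_less_trans)
  qed
  with gi show ?thesis by (rule that)
qed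

section \<open>Purely atomic measures\<close>

text \<open>For each of countably many basic open sets, either the part of \<open>A\<close> mapped
  into it or the rest of \<open>A\<close> is null. Once all these null parts are removed, basic open
  sets no longer separate the remaining values, so by the Hausdorff property only one value is
  left.\<close>

lemma AE_const_on_atom:
  fixes f :: "'a \<Rightarrow> 'b::{second_countable_topology, t2_space}"
  assumes f: "f \<in> borel_measurable M" and A: "A \<in> sets M"
    and atom: "\<And>B. B \<in> sets M \<Longrightarrow> B \<subseteq> A \<Longrightarrow> B \<in> null_sets M \<or> A - B \<in> null_sets M"
  shows "\<exists>c. AE x in M. x \<in> A \<longrightarrow> f x = c"
proof (cases "A \<in> null_sets M")
  case True
  have "AE x in M. x \<in> A \<longrightarrow> f x = undefined" using AE_not_in[OF True] by eventually_elim auto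
  then show ?thesis by blast
next
  case False
  obtain \<B> :: "'b set set" where \<B>: "countable \<B>" "topological_basis \<B>"
    using ex_countable_basis by blast
  have meas: "{x\<in>A. f x \<in> U} \<in> sets M" if "U \<in> \<B>" for U
  proof -
    have "f -` U \<inter> space M \<in> sets M"
      using f topological_basis_open[OF \<B>(2) that] by (auto intro: measurable_sets)
    then have "(f -` U \<inter> space M) \<inter> A \<in> sets M" using A by auto
    moreover have "(f -` U \<inter> space M) \<inter> A = {x\<in>A. f x \<in> U}" using sets.sets_into_space[OF A] by auto
    ultimately show ?thesis by simp
  qed
  \<comment> \<open>The null one of the two parts into which \<open>U\<close> divides
    \<open>A\<close>.\<close>
  define S where "S U = (if {x\<in>A. f x \<in> U} \<in> null_sets M then {x\<in>A. f x \<in> U} else A - {x\<in>A. f x \<in> U})" for U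
  have S: "S U \<in> null_sets M" if "U \<in> \<B>" for U
    using atom[OF meas[OF that]] by (auto simp: S_def)
  have null: "(\<Union>U\<in>\<B>. S U) \<in> null_sets M"
    using null_sets_UN'[OF \<B>(1) S] .
  then have "A - (\<Union>U\<in>\<B>. S U) \<noteq> {}"
    using False null_sets_subset[OF null A] by blast
  then obtain a where a: "a \<in> A" "\<And>U. U \<in> \<B> \<Longrightarrow> a \<notin> S U" by blast
  have "f x = f a" if "x \<in> A" "x \<notin> (\<Union>U\<in>\<B>. S U)" for x
  proof (rule ccontr)
    assume "f x \<noteq> f a"
    then obtain V W where V: "open V" "open W" "f x \<in> W" "f a \<in> V" "V \<inter> W = {}"
      using hausdorff[OF \<open>f x \<noteq> f a\<close>[symmetric]] by (elim exE conjE) (rule that)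
    obtain U where U: "U \<in> \<B>" "f a \<in> U" "U \<subseteq> V"
      using topological_basisE[OF \<B>(2) V(1,4)] .
    then have "f x \<notin> U" using V(3,5) by auto
    then show False using a(1) a(2)[OF U(1)] U that by (auto simp: S_def split: if_splits)
  qed
  then have "AE x in M. x \<in> A \<longrightarrow> f x = f a"
    using AE_not_in[OF null] by (auto elim!: eventually_mono)
  then show ?thesis by blast
qed

text \<open>An atom or a null set. Unlike \<open>atom\<close>, this notion passes to measurable
  subsets, so it survives making a sequence of atoms disjoint.\<close>

definition null_or_full :: "'a measure \<Rightarrow> 'a set \<Rightarrow> bool" where
  "null_or_full M A \<longleftrightarrow> A \<in> fmeasurable M \<and>
     (\<forall>B\<in>sets M. B \<subseteq> A \<longrightarrow> B \<in> null_sets M \<or> A - B \<in> null_sets M)"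

lemma null_or_full_atom: assumes "atom M A" shows "null_or_full M A"
  unfolding null_or_full_def
proof (intro conjI ballI impI)
  show "A \<in> fmeasurable M" using assms by (auto simp: atom_def fmeasurable_def)
  fix B assume B: "B \<in> sets M" "B \<subseteq> A"
  then consider "emeasure M B = 0" | "emeasure M B = emeasure M A" using assms by (auto simp: atom_def)
  then show "B \<in> null_sets M \<or> A - B \<in> null_sets M"
  proof cases
    case 2
    then have "emeasure M (A - B) = 0"
      using emeasure_Diff[of M B A] B assms by (auto simp: atom_def)
    then show ?thesis using B assms by (auto simp: atom_def)
  qed (use B in auto)
qed

lemma null_or_full_subset:
  assumes A: "null_or_full M A" and B: "B \<in> sets M" "B \<subseteq> A"
  shows "null_or_full M B"
  unfolding null_or_full_def
proof (intro conjI ballI impI)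
  show "B \<in> fmeasurable M"
    using A B by (auto simp: null_or_full_def intro: fmeasurableI2)
  fix C assume C: "C \<in> sets M" "C \<subseteq> B"
  then have "C \<in> null_sets M \<or> A - C \<in> null_sets M"
    using A B by (auto simp: null_or_full_def)
  moreover have "B - C \<in> null_sets M" if "A - C \<in> null_sets M"
    by (rule null_sets_subset[OF that]) (use B C in auto)
  ultimately show "C \<in> null_sets M \<or> B - C \<in> null_sets M" by blast
qed

lemma purely_atomic_cover:
  assumes pa: "purely_atomic M" and E: "E \<in> fmeasurable M"
  obtains \<A> where "countable \<A>" "\<And>A. A \<in> \<A> \<Longrightarrow> atom M A" "E - \<Union>\<A> \<in> null_sets M"
proof (cases "emeasure M E = 0")
  case True
  then show ?thesis using E by (intro that[of "{}"]) (auto simp: fmeasurable_def)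
next
  case False
  then have "purely_atomic_set M E"
    using pa E by (auto simp: purely_atomic_def fmeasurable_def zero_less_iff_neq_zero)
  then show ?thesis unfolding purely_atomic_set_def by (elim exE conjE) (rule that, auto)
qed

lemma integrable_level_set:
  fixes f :: "'a \<Rightarrow> 'b::{banach, second_countable_topology}"
  assumes f: "integrable M f" and "0 < c"
  shows "{x\<in>space M. c \<le> norm (f x)} \<in> fmeasurable M"
proof -
  have "emeasure M {x\<in>space M. norm (f x) \<ge> c} \<le> ennreal ((1/c) * (\<integral>x. norm (f x) \<partial>M))"
    using assms by (intro integral_Markov_inequality) auto
  also have "\<dots> < \<infinity>" by simp
  finally show ?thesis
    using f by (auto simp: fmeasurable_def intro!: borel_measurable_integrable)
qed

text \<open>Pure atomicity speaks only of sets of finite measure, and \<open>M\<close> need not be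
  sigma-finite. The support of an integrable function is, however, a countable union of level sets
  of finite measure by Markov's inequality; the atoms of all these level sets are collected and made
  disjoint.\<close>

lemma purely_atomic_supports:
  fixes f :: "nat \<Rightarrow> 'a \<Rightarrow> 'b::{banach, second_countable_topology}"
  assumes pa: "purely_atomic M" and f: "\<And>n. integrable M (f n)"
  obtains A :: "nat \<Rightarrow> 'a set" where "disjoint_family A" "\<And>i. null_or_full M (A i)"
    "\<And>n. AE x in M. f n x \<noteq> 0 \<longrightarrow> x \<in> (\<Union>i. A i)"
proof -
  define E where "E n j = {x\<in>space M. 1 / real (Suc j) \<le> norm (f n x)}" for n j
  have "\<exists>\<A>. countable \<A> \<and> (\<forall>A\<in>\<A>. atom M A) \<and> E n j - \<Union>\<A> \<in> null_sets M" for n j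
  proof -
    have "E n j \<in> fmeasurable M" unfolding E_def by (rule integrable_level_set[OF f]) simp
    from purely_atomic_cover[OF pa this] show ?thesis by metis
  qed
  then obtain \<A> where \<A>: "\<And>n j. countable (\<A> n j)" "\<And>n j A. A \<in> \<A> n j \<Longrightarrow> atom M A"
     "\<And>n j. E n j - \<Union>(\<A> n j) \<in> null_sets M" by metis
  \<comment> \<open>The empty set guarantees that there is something to enumerate.\<close>
  define \<C> where "\<C> = insert {} (\<Union>n j. \<A> n j)"
  have \<C>: "countable \<C>" "\<C> \<noteq> {}" unfolding \<C>_def using \<A>(1) by auto
  define A where "A = disjointed (from_nat_into \<C>)"
  have range: "range (from_nat_into \<C>) = \<C>" by (rule range_from_nat_into[OF \<C>(2,1)])
  have nf: "null_or_full M C" if "C \<in> \<C>" for C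
    using that \<A>(2) by (auto simp: \<C>_def intro: null_or_full_atom) (auto simp: null_or_full_def)
  have nf': "null_or_full M (from_nat_into \<C> i)" for i using nf range by blast
  then have sets: "range (from_nat_into \<C>) \<subseteq> sets M" by (auto simp: null_or_full_def)
  show ?thesis
  proof
    show "disjoint_family A" unfolding A_def by (rule disjoint_family_disjointed)
    show "null_or_full M (A i)" for i
      unfolding A_def by (rule null_or_full_subset[OF nf' _ disjointed_subset])
        (use sets.range_disjointed_sets[OF sets] in auto)
    fix n
    have "AE x in M. \<forall>j. x \<notin> E n j - \<Union>(\<A> n j)"
      unfolding AE_all_countable by (intro allI AE_not_in \<A>(3))
    with AE_space show "AE x in M. f n x \<noteq> 0 \<longrightarrow> x \<in> (\<Union>i. A i)"
    proof eventually_elim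
      case (elim x)
      show ?case
      proof
        assume "f n x \<noteq> 0"
        then obtain j where "1 / real (Suc j) < norm (f n x)" 
          using reals_Archimedean[of "norm (f n x)"] by (auto simp: divide_inverse)
        then have "x \<in> E n j" using elim by (auto simp: E_def)
        then obtain C where "C \<in> \<A> n j" "x \<in> C" using elim by blast
        have "C \<in> (\<Union>n j. \<A> n j)" 
          using \<open>C \<in> \<A> n j\<close> by (intro UN_I[of n] UN_I[of j]) auto
        then have "C \<in> \<C>" by (simp add: \<C>_def)
        with \<open>x \<in> C\<close> have "x \<in> \<Union>\<C>" by (rule UnionI[rotated])
        then show "x \<in> (\<Union>i. A i)" unfolding A_def UN_disjointed_eq range .
      qed
    qed
  qed
qed

section \<open>Calculus of tensors over L1 and a criterion for attainment\<close>

lemma L1_add_class: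
  fixes f g :: "'a \<Rightarrow> 'k::{real_normed_field, banach, second_countable_topology}"
  assumes "integrable M f" "integrable M g"
  shows "vadd (L1 TYPE('k) M) (L1_class M f) (L1_class M g) = L1_class M (\<lambda>x. f x + g x)"
  unfolding L1_add using assms AE_rep_L1_class[OF assms(1)] AE_rep_L1_class[OF assms(2)]
  by (intro L1_class_eqI) (auto simp: integrable_rep_L1_class)

lemma L1_scale_class:
  fixes f :: "'a \<Rightarrow> 'k::{real_normed_field, banach, second_countable_topology}"
  assumes "integrable M f"
  shows "vscale (L1 TYPE('k) M) a (L1_class M f) = L1_class M (\<lambda>x. a * f x)"
  unfolding L1_scale using assms AE_rep_L1_class[OF assms(1)]
  by (intro L1_class_eqI) (auto simp: integrable_rep_L1_class)

lemma L1_class_rep: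
  assumes "F \<in> vcarrier (L1 TYPE('k::{real_normed_field, banach, second_countable_topology}) M)"
  shows "L1_class M (rep F) = F"
proof -
  obtain f where f: "integrable M f" "F = L1_class M f" using assms by (rule L1_carrierE)
  show ?thesis unfolding f(2) using rep_L1_class[OF f(1)] f(1) by (intro L1_class_eqI)
qed

lemma norm_indicator: "norm (indicator A x :: 'k::real_normed_field) = indicator A x"
  by (simp add: indicator_def)

context norm_pair begin

text \<open>An element of the tensor product is a functional on all functions of two arguments and
  is additive only on bilinear ones. A representation reduces the claim to exchanging two
  sums.\<close>

lemma form_sum:
  assumes u: "u \<in> vcarrier T" and B: "\<And>i. i \<in> I \<Longrightarrow> B i \<in> bilinear_forms X Y"
    and BS: "(\<lambda>x y. \<Sum>i\<in>I. B i x y) \<in> bilinear_forms X Y"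
  shows "u (\<lambda>x y. \<Sum>i\<in>I. B i x y) = (\<Sum>i\<in>I. u (B i))"
proof -
  obtain n x y where "tensor_rep X Y u n x y"
    using u unfolding alg_tensor_simps by blast
  then have u: "u = (\<lambda>B. \<Sum>k<n. et (x k) (y k) B)" by (simp add: tensor_rep_def)
  have "u (\<lambda>x y. \<Sum>i\<in>I. B i x y) = (\<Sum>k<n. \<Sum>i\<in>I. B i (x k) (y k))"
    using BS by (simp add: u elem_tensor_simps)
  also have "\<dots> = (\<Sum>i\<in>I. \<Sum>k<n. B i (x k) (y k))" by (rule sum.swap)
  also have "\<dots> = (\<Sum>i\<in>I. u (B i))"
    using B by (intro sum.cong) (simp_all add: u elem_tensor_simps)
  finally show ?thesis .
qed

text \<open>For a series converging to the class of \<open>s\<close>, the triangle inequality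
  already bounds the norm by the sum of the products. Only the opposite estimate has to be supplied,
  and it may be checked on partial sums.\<close>

lemma attainsI:
  assumes s: "cauchy s" and x: "\<And>i. x i \<in> vcarrier X" and y: "\<And>i. y i \<in> vcarrier Y"
    and lim: "(\<lambda>n. lim (\<lambda>k. td (\<lambda>B. \<Sum>i<n. et (x i) (y i) B) (s k))) \<longlonglongrightarrow> 0"
    and le: "\<And>n. (\<Sum>i<n. vnorm X (x i) * vnorm Y (y i)) \<le> lim (\<lambda>k. pn (s k))"
  shows "attains s"
  unfolding attains_def
proof (intro exI conjI allI)
  let ?p = "\<lambda>i. vnorm X (x i) * vnorm Y (y i)" and ?T = "\<lambda>n B. \<Sum>i<n. et (x i) (y i) B"
  have p0: "0 \<le> ?p i" for i by (simp add: norm_nonneg_X norm_nonneg_Y x y)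
  have sm: "summable ?p"
    by (rule bounded_imp_summable[OF p0, where B="lim (\<lambda>k. pn (s k))"]) (use le[of "Suc n" for n] in \<open>simp add: lessThan_Suc_atMost\<close>)
  have T: "?T n \<in> vcarrier T" for n by (intro finite_sum_in) (use x y in auto)
  have "lim (\<lambda>k. pn (s k)) \<le> (\<Sum>i<n. ?p i) + lim (\<lambda>k. td (?T n) (s k))" for n
  proof (rule LIMSEQ_le)
    show "(\<lambda>k. pn (s k)) \<longlonglongrightarrow> lim (\<lambda>k. pn (s k))"
      using cauchy_pn[OF s] by (simp add: convergent_LIMSEQ_iff)
    show "(\<lambda>k. (\<Sum>i<n. ?p i) + td (?T n) (s k)) \<longlonglongrightarrow> (\<Sum>i<n. ?p i) + lim (\<lambda>k. td (?T n) (s k))"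
      using cauchy_td[OF cauchy_const[OF T] s] by (intro tendsto_intros) (simp add: convergent_LIMSEQ_iff)
    have "pn (s k) \<le> (\<Sum>i<n. ?p i) + td (?T n) (s k)" for k
      using td_triangle[OF cauchy_in[OF s] T zero_in, of k n] td_commute[OF cauchy_in[OF s] T, of k n]
        finite_sum_pn[of "{..<n}" x y] x y by (simp add: td_zero)
    then show "\<exists>N. \<forall>k\<ge>N. pn (s k) \<le> (\<Sum>i<n. ?p i) + td (?T n) (s k)" by blast
  qed
  moreover have "(\<lambda>n. (\<Sum>i<n. ?p i) + lim (\<lambda>k. td (?T n) (s k))) \<longlonglongrightarrow> suminf ?p + 0"
    by (intro tendsto_add lim summable_LIMSEQ sm)
  ultimately have "lim (\<lambda>k. pn (s k)) \<le> suminf ?p"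
    by (intro LIMSEQ_le_const[where X="\<lambda>n. (\<Sum>i<n. ?p i) + lim (\<lambda>k. td (?T n) (s k))"]) auto
  moreover have "suminf ?p \<le> lim (\<lambda>k. pn (s k))" by (rule suminf_le_const[OF sm le])
  ultimately show "?p sums lim (\<lambda>k. pn (s k))" using summable_sums[OF sm] by simp
qed (use x y lim in auto)

end

text \<open>\<open>K\<close> carries the scalar field, which neither measure mentions.\<close>

locale L1_tensor =
  fixes M :: "'a measure" and N :: "'b measure"
    and K :: "'k::{real_normed_field, banach, second_countable_topology} itself"
begin

abbreviation X :: "('k, ('a \<Rightarrow> 'k) set) nvs" where "X \<equiv> L1 TYPE('k) M"
abbreviation Y :: "('k, ('b \<Rightarrow> 'k) set) nvs" where "Y \<equiv> L1 TYPE('k) N"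

sublocale norm_pair X Y by (rule L1_norm_pair)

lemma et_add_left:
  assumes "integrable M f" "integrable M g" "y \<in> vcarrier Y"
  shows "et (L1_class M (\<lambda>x. f x + g x)) y B = et (L1_class M f) y B + et (L1_class M g) y B"
proof (cases "B \<in> bilinear_forms X Y")
  case True
  then have "B (vadd X (L1_class M f) (L1_class M g)) y = B (L1_class M f) y + B (L1_class M g) y"
    using assms L1_class_in unfolding bilinear_forms_def by blast
  with True show ?thesis using assms by (simp add: L1_add_class elem_tensor_simps)
qed (simp add: elem_tensor_simps)

lemma et_scale_left:
  assumes "integrable M f" "y \<in> vcarrier Y"
  shows "et (L1_class M (\<lambda>x. c * f x)) y B = c * et (L1_class M f) y B"
proof (cases "B \<in> bilinear_forms X Y")
  case True
  then have "B (vscale X c (L1_class M f)) y = c * B (L1_class M f) y"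
    using assms L1_class_in unfolding bilinear_forms_def by blast
  with True show ?thesis using assms by (simp add: L1_scale_class elem_tensor_simps)
qed (simp add: elem_tensor_simps)

lemma et_add_right:
  assumes "integrable N f" "integrable N g" "y \<in> vcarrier X"
  shows "et y (L1_class N (\<lambda>x. f x + g x)) B = et y (L1_class N f) B + et y (L1_class N g) B"
proof (cases "B \<in> bilinear_forms X Y")
  case True
  then have "B y (vadd Y (L1_class N f) (L1_class N g)) = B y (L1_class N f) + B y (L1_class N g)"
    using assms L1_class_in unfolding bilinear_forms_def by blast
  with True show ?thesis using assms by (simp add: L1_add_class elem_tensor_simps)
qed (simp add: elem_tensor_simps)

lemma et_scale_right:
  assumes "integrable N f" "y \<in> vcarrier X"
  shows "et y (L1_class N (\<lambda>x. c * f x)) B = c * et y (L1_class N f) B"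
proof (cases "B \<in> bilinear_forms X Y")
  case True
  then have "B y (vscale Y c (L1_class N f)) = c * B y (L1_class N f)"
    using assms L1_class_in unfolding bilinear_forms_def by blast
  with True show ?thesis using assms by (simp add: L1_scale_class elem_tensor_simps)
qed (simp add: elem_tensor_simps)

lemma et_zero_left: "y \<in> vcarrier Y \<Longrightarrow> et (L1_class M (\<lambda>x. 0)) y B = 0"
  using et_scale_left[of "\<lambda>x. 0" y 0] by simp

lemma et_zero_right: "x \<in> vcarrier X \<Longrightarrow> et x (L1_class N (\<lambda>x. 0)) B = 0"
  using et_scale_right[of "\<lambda>x. 0" x 0] by simp

lemma et_sum_left:
  assumes "finite I" "\<And>i. i \<in> I \<Longrightarrow> integrable M (f i)" "y \<in> vcarrier Y"
  shows "et (L1_class M (\<lambda>x. \<Sum>i\<in>I. c i * f i x)) y B = (\<Sum>i\<in>I. c i * et (L1_class M (f i)) y B)"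
  using assms(1,2)
proof (induction I)
  case (insert i I)
  then have "integrable M (\<lambda>x. \<Sum>i\<in>I. c i * f i x)" by auto
  with insert assms(3) show ?case by (simp add: et_add_left et_scale_left)
qed (simp add: et_zero_left assms(3))

lemma et_sum_right:
  assumes "finite I" "\<And>i. i \<in> I \<Longrightarrow> integrable N (f i)" "x \<in> vcarrier X"
  shows "et x (L1_class N (\<lambda>y. \<Sum>i\<in>I. c i * f i y)) B = (\<Sum>i\<in>I. c i * et x (L1_class N (f i)) B)"
  using assms(1,2)
proof (induction I)
  case (insert i I)
  then have "integrable N (\<lambda>x. \<Sum>i\<in>I. c i * f i x)" by auto
  with insert assms(3) show ?case by (simp add: et_add_right et_scale_right)
qed (simp add: et_zero_right assms(3))

lemma et_diff_left:
  assumes "integrable M f" "integrable M g" "y \<in> vcarrier Y"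
  shows "et (L1_class M (\<lambda>x. f x - g x)) y B = et (L1_class M f) y B - et (L1_class M g) y B"
  using et_add_left[of f "\<lambda>x. (-1) * g x" y B] et_scale_left[of g y "-1" B] assms by simp

lemma et_diff_right:
  assumes "integrable N f" "integrable N g" "x \<in> vcarrier X"
  shows "et x (L1_class N (\<lambda>y. f y - g y)) B = et x (L1_class N f) B - et x (L1_class N g) B"
  using et_add_right[of f "\<lambda>x. (-1) * g x" x B] et_scale_right[of g x "-1" B] assms by simp

lemma form_pairing:
  assumes "bdd_fun M h" "bdd_fun N g"
  shows "(\<lambda>F G. pairing M h F * pairing N g G) \<in> bilinear_forms X Y"
  using pairing_sum_form[of "{()}" M "\<lambda>_. h" N "\<lambda>_. g"] assms by simp

text \<open>\<open>slice A u g\<close> says that \<open>g\<close> is the image of \<open>u\<close> under \<open>x \<otimes> y \<mapsto> (\<integral>\<^sub>A x) y\<close>.\<close>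

definition slice where
  "slice A u g \<longleftrightarrow> integrable N g \<and> (\<forall>h. bdd_fun N h \<longrightarrow>
     u (\<lambda>F G. pairing M (indicator A) F * pairing N h G) = (\<integral>y. h y * g y \<partial>N))"

lemma slice_rep:
  assumes r: "tensor_rep X Y u n x y" and A: "A \<in> sets M"
  shows "slice A u (\<lambda>t. \<Sum>k<n. pairing M (indicator A) (x k) * rep (y k) t)"
  unfolding slice_def
proof (intro conjI allI impI)
  have y: "integrable N (rep (y k))" if "k < n" for k
    using r that by (auto simp: tensor_rep_def intro: integrable_rep)
  then show "integrable N (\<lambda>t. \<Sum>k<n. pairing M (indicator A) (x k) * rep (y k) t)" by auto
  fix h :: "'b \<Rightarrow> 'k" assume h: "bdd_fun N h"
  have "(\<integral>t. h t * (\<Sum>k<n. pairing M (indicator A) (x k) * rep (y k) t) \<partial>N)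
    = (\<integral>t. (\<Sum>k<n. pairing M (indicator A) (x k) * (h t * rep (y k) t)) \<partial>N)"
    by (simp add: sum_distrib_left ac_simps)
  also have "\<dots> = (\<Sum>k<n. pairing M (indicator A) (x k) * pairing N h (y k))"
    using bdd_fun_integrable[OF h y] by (subst Bochner_Integration.integral_sum) (auto simp: pairing_def)
  finally show "u (\<lambda>F G. pairing M (indicator A) F * pairing N h G) =
      (\<integral>t. h t * (\<Sum>k<n. pairing M (indicator A) (x k) * rep (y k) t) \<partial>N)"
    using r form_pairing[OF bdd_fun_indicator[OF A] h] by (simp add: tensor_rep_def elem_tensor_simps)
qed

lemma slice_diff:
  assumes "slice A u f" "slice A v g"
  shows "slice A (\<lambda>B. u B - v B) (\<lambda>t. f t - g t)"
  using assms bdd_fun_integrable[of N _ f] bdd_fun_integrable[of N _ g]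
  by (auto simp: slice_def right_diff_distrib)

text \<open>The form pairing each \<open>\<integral>\<^sub>A\<^sub>i x\<close> with the integral of
  \<open>y\<close> against the sign of \<open>g i\<close> has norm at most 1: signs are bounded by
  1, and disjoint sets share out the norm of \<open>x\<close>. Its value at \<open>u\<close> is the
  sum on the left. Applied to differences, the lemma makes the slices Cauchy.\<close>

lemma slice_norm:
  assumes u: "u \<in> vcarrier T" and I: "finite I" and A: "\<And>i. i \<in> I \<Longrightarrow> A i \<in> sets M"
    and disj: "disjoint_family_on A I" and g: "\<And>i. i \<in> I \<Longrightarrow> slice (A i) u (g i)"
  shows "(\<Sum>i\<in>I. \<integral>t. norm (g i t) \<partial>N) \<le> pn u"
proof -
  define h where "h i t = of_real (norm (g i t)) / g i t" for i t
  have gi: "integrable N (g i)" if "i \<in> I" for i using g[OF that] by (simp add: slice_def)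
  have h: "bdd_fun N (h i)" "norm (h i t) \<le> 1" "h i t * g i t = of_real (norm (g i t))" if "i \<in> I" for i t
    unfolding h_def using bdd_fun_sign[OF borel_measurable_integrable[OF gi[OF that]]] by auto
  have ind: "bdd_fun M (indicator (A i) :: 'a \<Rightarrow> 'k)" if "i \<in> I" for i using A that by auto
  define B where "B F G = (\<Sum>i\<in>I. pairing M (indicator (A i)) F * pairing N (h i) G)" for F G
  have B: "B \<in> bilinear_forms X Y" unfolding B_def using h ind by (intro pairing_sum_form) auto
  have "norm (B F G) \<le> 1 * (vnorm X F * vnorm Y G)" if F: "F \<in> vcarrier X" and G: "G \<in> vcarrier Y" for F G
  proof -
    have iF: "integrable M (rep F)" and iG: "integrable N (rep G)" using F G by (auto intro: integrable_rep)
    have 1: "norm (pairing N (h i) G) \<le> vnorm Y G" if "i \<in> I" for i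
    proof -
      have m: "(\<lambda>x. norm (h i x) * norm (rep G x)) = (\<lambda>x. norm (h i x * rep G x))" by (simp add: norm_mult)
      have "(\<integral>x. norm (h i x) * norm (rep G x) \<partial>N) \<le> (\<integral>x. norm (rep G x) \<partial>N)"
        using integrable_norm[OF bdd_fun_integrable[OF h(1)[OF that] iG]] iG h(2)[OF that]
        unfolding m[symmetric] by (intro integral_mono) (auto simp: norm_mult intro: mult_left_le_one_le)
      then show ?thesis using pairing_norm[of N "h i" G] by (simp add: L1_norm)
    qed
    have ii: "integrable M (\<lambda>x. indicator (A i) x * norm (rep F x))" if "i \<in> I" for i
      using bdd_fun_integrable[of M "indicator (A i)" "\<lambda>x. norm (rep F x)"] A[OF that] iF by auto
    \<comment> \<open>Disjointness enters here: the indicators add up to one indicator, so the sum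
      does not exceed the norm of \<open>F\<close>.\<close>
    have "(\<Sum>i\<in>I. norm (pairing M (indicator (A i)) F)) \<le> (\<Sum>i\<in>I. \<integral>x. indicator (A i) x * norm (rep F x) \<partial>M)"
      using pairing_norm[of M "indicator (A i)" F for i] by (intro sum_mono) (simp add: norm_indicator)
    also have "\<dots> = (\<integral>x. (\<Sum>i\<in>I. indicator (A i) x) * norm (rep F x) \<partial>M)"
      using ii by (subst Bochner_Integration.integral_sum[symmetric]) (auto simp: sum_distrib_right)
    also have "\<dots> = (\<integral>x. indicator (\<Union>i\<in>I. A i) x * norm (rep F x) \<partial>M)"
      by (simp add: indicator_UN_disjoint[OF I disj])
    also have "\<dots> \<le> (\<integral>x. norm (rep F x) \<partial>M)"
    proof (rule integral_mono)
      have "(\<Union>i\<in>I. A i) \<in> sets M" using A I by auto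
      then show "integrable M (\<lambda>x. indicator (\<Union>i\<in>I. A i) x * norm (rep F x))"
        using iF by (intro bdd_fun_integrable) auto
    qed (use iF in \<open>auto simp: indicator_def\<close>)
    finally have 2: "(\<Sum>i\<in>I. norm (pairing M (indicator (A i)) F)) \<le> vnorm X F" by (simp add: L1_norm)
    have "norm (B F G) \<le> (\<Sum>i\<in>I. norm (pairing M (indicator (A i)) F) * norm (pairing N (h i) G))"
      unfolding B_def by (rule sum_norm_le) (simp add: norm_mult)
    also have "\<dots> \<le> (\<Sum>i\<in>I. norm (pairing M (indicator (A i)) F) * vnorm Y G)"
      by (intro sum_mono mult_left_mono 1) auto
    also have "\<dots> \<le> vnorm X F * vnorm Y G"
      unfolding sum_distrib_right[symmetric] by (intro mult_right_mono 2 L1_norm_nonneg)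
    finally show ?thesis by simp
  qed
  then have "norm (u B) \<le> 1 * pn u" by (intro form_bound[OF u B]) auto
  moreover have "u B = (\<Sum>i\<in>I. u (\<lambda>F G. pairing M (indicator (A i)) F * pairing N (h i) G))"
    unfolding B_def by (rule form_sum[OF u]) (use h ind B in \<open>auto simp: B_def[abs_def] intro: form_pairing\<close>)
  moreover have "\<dots> = (\<Sum>i\<in>I. of_real (\<integral>t. norm (g i t) \<partial>N))"
    using g h by (intro sum.cong) (auto simp: slice_def)
  moreover have "norm (\<Sum>i\<in>I. of_real (\<integral>t. norm (g i t) \<partial>N) :: 'k) = (\<Sum>i\<in>I. \<integral>t. norm (g i t) \<partial>N)"
    unfolding of_real_sum[symmetric] norm_of_real by (simp add: sum_nonneg)
  ultimately show ?thesis by simp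
qed

end

section \<open>Purely atomic measures: the series over the atoms\<close>

lemma L1_triangle:
  fixes f g h :: "'a \<Rightarrow> 'b::{banach, second_countable_topology}"
  assumes "integrable M f" "integrable M g" "integrable M h"
  shows "(\<integral>x. norm (f x - h x) \<partial>M) \<le> (\<integral>x. norm (f x - g x) \<partial>M) + (\<integral>x. norm (g x - h x) \<partial>M)"
proof -
  have "(\<integral>x. norm (f x - h x) \<partial>M) \<le> (\<integral>x. norm (f x - g x) + norm (g x - h x) \<partial>M)"
    using assms norm_triangle_ineq[of "f x - g x" "g x - h x" for x] by (intro integral_mono) auto
  also have "\<dots> = (\<integral>x. norm (f x - g x) \<partial>M) + (\<integral>x. norm (g x - h x) \<partial>M)"
    using assms by (intro Bochner_Integration.integral_add) auto
  finally show ?thesis .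
qed

text \<open>On each \<open>A i\<close> the function is almost everywhere constant, hence equal to
  its mean value, so the m-th partial sum is \<open>f\<close> cut down to the first \<open>m\<close>
  sets. Dominated convergence does the rest.\<close>

lemma atomic_expansion:
  fixes f :: "'a \<Rightarrow> 'k::{real_normed_field, banach, second_countable_topology}"
  assumes disj: "disjoint_family A" and A: "\<And>i. null_or_full M (A i)"
    and f: "integrable M f" and supp: "AE x in M. f x \<noteq> 0 \<longrightarrow> x \<in> (\<Union>i. A i)"
  shows "(\<lambda>m. \<integral>x. norm (f x - (\<Sum>i<m. (\<integral>x. indicator (A i) x * f x \<partial>M) *
           of_real (indicator (A i) x / measure M (A i)))) \<partial>M) \<longlonglongrightarrow> 0"
proof -
  define c where "c i = (\<integral>x. indicator (A i) x * f x \<partial>M)" for i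
  define e :: "nat \<Rightarrow> 'a \<Rightarrow> 'k" where "e i x = of_real (indicator (A i) x / measure M (A i))" for i x
  have sA: "A i \<in> sets M" "A i \<in> fmeasurable M" for i using A[of i] by (auto simp: null_or_full_def)
  have 1: "AE x in M. x \<in> A i \<longrightarrow> c i * e i x = f x" for i
  proof -
    have "\<exists>d. AE x in M. x \<in> A i \<longrightarrow> f x = d"
      by (rule AE_const_on_atom[OF borel_measurable_integrable[OF f] sA(1)])
        (use A[of i] in \<open>auto simp: null_or_full_def\<close>)
    then obtain d where d: "AE x in M. x \<in> A i \<longrightarrow> f x = d" by blast
    show ?thesis
    proof (cases "measure M (A i) = 0")
      case True
      then have "A i \<in> null_sets M" 
        using emeasure_eq_measure2[OF sA(2), of i] sA(1)[of i] by (intro null_setsI) simp_all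
      from AE_not_in[OF this] show ?thesis by eventually_elim auto
    next
      case False
      have "c i = (\<integral>x. indicat_real (A i) x *\<^sub>R d \<partial>M)"
        unfolding c_def
      proof (rule integral_cong_AE)
        show "AE x in M. indicator (A i) x * f x = indicat_real (A i) x *\<^sub>R d"
          using d by eventually_elim (auto simp: indicator_def)
      qed (use f sA in auto)
      also have "\<dots> = measure M (A i) *\<^sub>R d"
        using sA sets.sets_into_space[OF sA(1), of i] by (subst integral_scaleR_left) (auto simp: fmeasurable_def Int_absorb2)
      finally have "c i = of_real (measure M (A i)) * d" by (simp add: scaleR_conv_of_real)
      with False have ce: "c i * e i x = d" if "x \<in> A i" for x using that by (simp add: e_def)
      from d show ?thesis by eventually_elim (simp add: ce)
    qed
  qed
  have all: "AE x in M. (\<forall>i. x \<in> A i \<longrightarrow> c i * e i x = f x) \<and> (f x \<noteq> 0 \<longrightarrow> x \<in> (\<Union>i. A i))"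
    using 1 supp by (simp add: AE_all_countable)
  define r where "r m x = norm (f x - (\<Sum>i<m. c i * e i x))" for m x
  \<comment> \<open>A point lies in at most one of the sets: the remainder vanishes if that set is
    among the first \<open>m\<close>, and is all of \<open>f x\<close> otherwise.\<close>
  have r: "r m x = norm (f x) \<and> (\<forall>j<m. x \<notin> A j) \<or> r m x = 0 \<and> (\<exists>j<m. x \<in> A j)"
    if x: "\<And>i. x \<in> A i \<Longrightarrow> c i * e i x = f x" for x m
  proof (cases "\<exists>j<m. x \<in> A j")
    case True
    then obtain j where j: "j < m" "x \<in> A j" by blast
    have "e i x = 0" if "i \<noteq> j" for i
    proof -
      have "A i \<inter> A j = {}" using disj that by (auto simp: disjoint_family_on_def)
      then have "x \<notin> A i" using j by auto
      then show ?thesis by (simp add: e_def)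
    qed
    then have "(\<Sum>i<m. c i * e i x) = (\<Sum>i\<in>{j}. c i * e i x)"
      using j by (intro sum.mono_neutral_right) auto
    then show ?thesis using x[OF j(2)] True by (simp add: r_def)
  qed (simp add: r_def e_def)
  have "(\<lambda>m. \<integral>x. r m x \<partial>M) \<longlonglongrightarrow> (\<integral>x. 0 \<partial>M)"
  proof (rule integral_dominated_convergence[where w="\<lambda>x. norm (f x)"])
    show "integrable M (\<lambda>x. norm (f x))" using f by simp
    show "r m \<in> borel_measurable M" for m unfolding r_def e_def using f sA by measurable
    show "AE x in M. norm (r m x) \<le> norm (f x)" for m
      using all
    proof eventually_elim
      case (elim x)
      then show ?case using r[of x m] by auto
    qed
    show "AE x in M. (\<lambda>m. r m x) \<longlonglongrightarrow> 0"
      using all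
    proof eventually_elim
      case (elim x)
      have "eventually (\<lambda>m. r m x = 0) sequentially"
      proof (cases "\<exists>j. x \<in> A j")
        case True
        then obtain j where j: "x \<in> A j" by blast
        show ?thesis using eventually_gt_at_top[of j]
          by eventually_elim (use r[of x] elim j in blast)
      next
        case False
        then show ?thesis using r[of x] elim by auto
      qed
      then show ?case by (rule tendsto_eventually)
    qed
  qed simp
  then show ?thesis by (simp add: r_def c_def e_def)
qed

context L1_tensor begin

text \<open>The partial sums \<open>S m\<close> of the candidate are compared with
  \<open>s K\<close> through \<open>V K m\<close>, the expansion of \<open>s K\<close> cut off after
  \<open>m\<close> atoms. The distance from \<open>S m\<close> to \<open>V K m\<close> is bounded by
  differences of slices, uniformly in \<open>m\<close>; that from \<open>V K m\<close> to
  \<open>s K\<close> tends to 0 for fixed \<open>K\<close> by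
  \<open>atomic_expansion\<close>.\<close>

theorem purely_atomic_attains:
  assumes pa: "purely_atomic M" and s: "cauchy s"
  shows "attains s"
proof -
  have "\<exists>n x y. tensor_rep X Y (s k) n x y" for k
    using cauchy_in[OF s, of k] unfolding alg_tensor_simps by blast
  then obtain n x y where r: "\<And>k. tensor_rep X Y (s k) (n k) (x k) (y k)" by metis
  have x: "x k l \<in> vcarrier X" and y: "y k l \<in> vcarrier Y" if "l < n k" for k l
    using r[of k] that by (auto simp: tensor_rep_def)
  have ix: "integrable M (rep (x k l))" and iy: "integrable N (rep (y k l))" if "l < n k" for k l
    using x[OF that] y[OF that] by (auto intro: integrable_rep)
  \<comment> \<open>All left factors of all representations in one sequence, padded with 0 where
    \<open>l\<close> exceeds the length of the k-th representation.\<close>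
  define f where "f j = (case prod_decode j of (k, l) \<Rightarrow> if l < n k then rep (x k l) else (\<lambda>_. 0))" for j
  have fi: "integrable M (f j)" for j unfolding f_def using ix by (auto split: prod.split)
  obtain A :: "nat \<Rightarrow> 'a set" where disj: "disjoint_family A" and A: "\<And>i. null_or_full M (A i)"
    and supp: "\<And>j. AE z in M. f j z \<noteq> 0 \<longrightarrow> z \<in> (\<Union>i. A i)"
    by (rule purely_atomic_supports[of M f, OF pa fi]) (rule that)
  have sA: "A i \<in> sets M" "A i \<in> fmeasurable M" for i using A[of i] by (auto simp: null_or_full_def)
  have supp: "AE z in M. rep (x k l) z \<noteq> 0 \<longrightarrow> z \<in> (\<Union>i. A i)" if "l < n k" for k l
    using supp[of "prod_encode (k, l)"] that by (simp add: f_def)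
  define c where "c k l i = pairing M (indicator (A i)) (x k l)" for k l i
  define g where "g i k t = (\<Sum>l<n k. c k l i * rep (y k l) t)" for i k t
  have slice: "slice (A i) (s k) (g i k)" for i k
    using slice_rep[OF r sA(1)] unfolding g_def c_def .
  have g: "integrable N (g i k)" for i k using slice by (simp add: slice_def)
  have disj': "disjoint_family_on A I" for I using disj by (auto simp: disjoint_family_on_def)
  \<comment> \<open>One bound for all finite sets of atoms at once; this uniformity later makes the
    order of the choices of \<open>K\<close> and \<open>m\<close> work.\<close>
  have sum_diff: "(\<Sum>i\<in>I. \<integral>t. norm (g i k t - g i k' t) \<partial>N) \<le> td (s k) (s k')" if "finite I" for I k k'
    unfolding td_def using cauchy_in[OF s] sA slice_diff[OF slice slice] disj'
    by (intro slice_norm[OF _ that, where A=A]) (auto intro: diff_in)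
  have sum_le: "(\<Sum>i<m. \<integral>t. norm (g i k t) \<partial>N) \<le> pn (s k)" for m k
    using cauchy_in[OF s] sA slice disj' by (intro slice_norm[where A=A]) auto
  have "\<exists>z. integrable N z \<and> (\<lambda>k. \<integral>t. norm (g i k t - z t) \<partial>N) \<longlonglongrightarrow> 0" for i
  proof -
    have "\<exists>K. \<forall>k\<ge>K. \<forall>k'\<ge>K. (\<integral>t. norm (g i k t - g i k' t) \<partial>N) < e" if e: "0 < e" for e
    proof -
      obtain K where "\<And>k k'. k \<ge> K \<Longrightarrow> k' \<ge> K \<Longrightarrow> td (s k) (s k') < e"
        using s e unfolding cauchy_iff by meson
      moreover have "(\<integral>t. norm (g i k t - g i k' t) \<partial>N) \<le> td (s k) (s k')" for k k'
        using sum_diff[of "{i}"] by simp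
      ultimately show ?thesis by (meson le_less_trans)
    qed
    from L1_complete[OF g this] show ?thesis by metis
  qed
  then obtain z where z: "\<And>i. integrable N (z i)" and zl: "\<And>i. (\<lambda>k. \<integral>t. norm (g i k t - z i t) \<partial>N) \<longlonglongrightarrow> 0"
    by metis
  have zsum: "(\<lambda>k. \<Sum>i<m. \<integral>t. norm (g i k t - z i t) \<partial>N) \<longlonglongrightarrow> 0" for m
    using tendsto_sum[of "{..<m}" "\<lambda>i k. \<integral>t. norm (g i k t - z i t) \<partial>N" "\<lambda>i. 0"] zl by simp
  \<comment> \<open>The estimate for \<open>k\<close> and \<open>k'\<close> is kept while
    \<open>k'\<close> tends to infinity, which replaces \<open>g i k'\<close> by its limit
    \<open>z i\<close>.\<close>
  have tail: "(\<Sum>i<m. \<integral>t. norm (z i t - g i k t) \<partial>N) \<le> e" if e: "\<And>k'. k' \<ge> k \<Longrightarrow> td (s k') (s k) \<le> e" for m k e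
  proof (rule LIMSEQ_le_const)
    show "(\<lambda>k'. (\<Sum>i<m. \<integral>t. norm (g i k' t - z i t) \<partial>N) + e) \<longlonglongrightarrow> e"
      using tendsto_add[OF zsum[of m] tendsto_const[of e]] by simp
    have "(\<Sum>i<m. \<integral>t. norm (z i t - g i k t) \<partial>N) \<le> (\<Sum>i<m. \<integral>t. norm (g i k' t - z i t) \<partial>N) + e" if "k' \<ge> k" for k'
    proof -
      have "(\<Sum>i<m. \<integral>t. norm (z i t - g i k t) \<partial>N)
          \<le> (\<Sum>i<m. (\<integral>t. norm (z i t - g i k' t) \<partial>N) + (\<integral>t. norm (g i k' t - g i k t) \<partial>N))"
        by (intro sum_mono L1_triangle z g)
      also have "\<dots> \<le> (\<Sum>i<m. \<integral>t. norm (g i k' t - z i t) \<partial>N) + e"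
        using sum_diff[of "{..<m}" k' k] e[OF that] by (simp add: sum.distrib norm_minus_commute)
      finally show ?thesis .
    qed
    then show "\<exists>N'. \<forall>k'\<ge>N'. (\<Sum>i<m. \<integral>t. norm (z i t - g i k t) \<partial>N) \<le> (\<Sum>i<m. \<integral>t. norm (g i k' t - z i t) \<partial>N) + e"
      by blast
  qed
  have znorm: "(\<Sum>i<m. \<integral>t. norm (z i t) \<partial>N) \<le> lim (\<lambda>k. pn (s k))" for m
  proof (rule LIMSEQ_le_const)
    have "(\<lambda>k. pn (s k)) \<longlonglongrightarrow> lim (\<lambda>k. pn (s k))"
      using cauchy_pn[OF s] by (simp add: convergent_LIMSEQ_iff)
    then show "(\<lambda>k. (\<Sum>i<m. \<integral>t. norm (g i k t - z i t) \<partial>N) + pn (s k)) \<longlonglongrightarrow> lim (\<lambda>k. pn (s k))"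
      using tendsto_add[OF zsum[of m]] by fastforce
    have "(\<Sum>i<m. \<integral>t. norm (z i t) \<partial>N) \<le> (\<Sum>i<m. \<integral>t. norm (g i k t - z i t) \<partial>N) + pn (s k)" for k
    proof -
      have "(\<integral>t. norm (z i t) \<partial>N) \<le> (\<integral>t. norm (g i k t - z i t) \<partial>N) + (\<integral>t. norm (g i k t) \<partial>N)" for i
        using L1_triangle[OF z[of i] g[of i k], of "\<lambda>_. 0"] by (simp add: norm_minus_commute)
      then have "(\<Sum>i<m. \<integral>t. norm (z i t) \<partial>N)
          \<le> (\<Sum>i<m. (\<integral>t. norm (g i k t - z i t) \<partial>N) + (\<integral>t. norm (g i k t) \<partial>N))"
        by (rule sum_mono)
      then show ?thesis using sum_le[of k m] by (simp add: sum.distrib)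
    qed
    then show "\<exists>N'. \<forall>k\<ge>N'. (\<Sum>i<m. \<integral>t. norm (z i t) \<partial>N) \<le> (\<Sum>i<m. \<integral>t. norm (g i k t - z i t) \<partial>N) + pn (s k)"
      by blast
  qed
  define e :: "nat \<Rightarrow> 'a \<Rightarrow> 'k" where "e i z = of_real (indicator (A i) z / measure M (A i))" for i z
  have e: "integrable M (e i)" for i
    unfolding e_def using sA[of i] by (auto simp: fmeasurable_def intro!: integrable_of_real)
  \<comment> \<open>The integral is 1 on an atom and 0 on a null \<open>A i\<close>, where division
    by 0 makes \<open>e i\<close> vanish; the inequality covers both.\<close>
  have e1: "(\<integral>z. norm (e i z) \<partial>M) \<le> 1" for i
  proof -
    have "norm (e i z) = indicat_real (A i) z / measure M (A i)" for z
      unfolding e_def norm_of_real by (simp add: indicator_def)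
    then show ?thesis using sets.sets_into_space[OF sA(1), of i] by (simp add: Int_absorb2)
  qed
  define xs where "xs i = L1_class M (e i)" for i
  define ys where "ys i = L1_class N (z i)" for i
  have xs: "xs i \<in> vcarrier X" and ys: "ys i \<in> vcarrier Y" for i
    unfolding xs_def ys_def by (intro L1_class_in e z)+
  have xs1: "vnorm X (xs i) \<le> 1" for i unfolding xs_def using e1 by (simp add: L1_norm_class e)
  define V where "V k m B = (\<Sum>i<m. et (xs i) (L1_class N (g i k)) B)" for k m B
  define S where "S m B = (\<Sum>i<m. et (xs i) (ys i) B)" for m B
  have V: "V k m \<in> vcarrier T" for k m unfolding V_def using xs g by (intro finite_sum_in) (auto intro: L1_class_in)
  have S: "S m \<in> vcarrier T" for m unfolding S_def using xs ys by (intro finite_sum_in) auto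
  have SV: "td (S m) (V k m) \<le> (\<Sum>i<m. \<integral>t. norm (z i t - g i k t) \<partial>N)" for m k
  proof -
    have "S m B - V k m B = (\<Sum>i<m. et (xs i) (L1_class N (\<lambda>t. z i t - g i k t)) B)" for B
      unfolding S_def V_def ys_def sum_subtractf[symmetric] using z g xs by (simp add: et_diff_right)
    then have "td (S m) (V k m) \<le> (\<Sum>i<m. vnorm X (xs i) * vnorm Y (L1_class N (\<lambda>t. z i t - g i k t)))"
      unfolding td_def using z g xs
      by (simp only:) (intro finite_sum_pn, auto intro: L1_class_in)
    also have "\<dots> \<le> (\<Sum>i<m. 1 * (\<integral>t. norm (z i t - g i k t) \<partial>N))"
      using z g by (intro sum_mono mult_mono xs1) (auto simp: L1_norm_class L1_norm_nonneg)
    finally show ?thesis by simp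
  qed
  have sV: "td (s k) (V k m) \<le> (\<Sum>l<n k. (\<integral>w. norm (rep (x k l) w - (\<Sum>i<m. c k l i * e i w)) \<partial>M) * vnorm Y (y k l))" for k m
  proof -
    have id: "integrable M (\<lambda>w. rep (x k l) w - (\<Sum>i<m. c k l i * e i w))" if "l < n k" for l
      using ix[OF that] e by auto
    have "V k m B = (\<Sum>i<m. \<Sum>l<n k. c k l i * et (xs i) (y k l) B)" for B
      unfolding V_def g_def
    proof (intro sum.cong refl)
      fix i
      have "et (xs i) (L1_class N (\<lambda>t. \<Sum>l<n k. c k l i * rep (y k l) t)) B
        = (\<Sum>l<n k. c k l i * et (xs i) (L1_class N (rep (y k l))) B)"
        by (rule et_sum_right) (use iy xs in auto)
      also have "\<dots> = (\<Sum>l<n k. c k l i * et (xs i) (y k l) B)"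
        using y by (intro sum.cong refl) (simp add: L1_class_rep)
      finally show "et (xs i) (L1_class N (\<lambda>t. \<Sum>l<n k. c k l i * rep (y k l) t)) B
        = (\<Sum>l<n k. c k l i * et (xs i) (y k l) B)" .
    qed
    also have "\<dots> B = (\<Sum>l<n k. \<Sum>i<m. c k l i * et (xs i) (y k l) B)" for B by (rule sum.swap)
    finally have "s k B - V k m B = (\<Sum>l<n k. et (x k l) (y k l) B - (\<Sum>i<m. c k l i * et (xs i) (y k l) B))" for B
      using r[of k] by (simp add: tensor_rep_def sum_subtractf)
    also have "\<dots> B = (\<Sum>l<n k. et (L1_class M (\<lambda>w. rep (x k l) w - (\<Sum>i<m. c k l i * e i w))) (y k l) B)" for B
    proof (intro sum.cong refl)
      fix l assume "l \<in> {..<n k}"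
      then have l: "l < n k" by simp
      have "et (L1_class M (\<lambda>w. \<Sum>i<m. c k l i * e i w)) (y k l) B = (\<Sum>i<m. c k l i * et (xs i) (y k l) B)"
        unfolding xs_def by (rule et_sum_left) (use e y[OF l] in auto)
      then show "et (x k l) (y k l) B - (\<Sum>i<m. c k l i * et (xs i) (y k l) B)
        = et (L1_class M (\<lambda>w. rep (x k l) w - (\<Sum>i<m. c k l i * e i w))) (y k l) B"
        using ix[OF l] x[OF l] y[OF l] e by (simp add: et_diff_left L1_class_rep)
    qed
    finally have "td (s k) (V k m) \<le> (\<Sum>l<n k. vnorm X (L1_class M (\<lambda>w. rep (x k l) w - (\<Sum>i<m. c k l i * e i w))) * vnorm Y (y k l))"
      unfolding td_def using id y by (simp only:) (intro finite_sum_pn, auto intro: L1_class_in)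
    also have "\<dots> = (\<Sum>l<n k. (\<integral>w. norm (rep (x k l) w - (\<Sum>i<m. c k l i * e i w)) \<partial>M) * vnorm Y (y k l))"
      using id by (intro sum.cong refl) (simp add: L1_norm_class)
    finally show ?thesis .
  qed
  have "(\<lambda>m. td (s k) (V k m)) \<longlonglongrightarrow> 0" for k
  proof (rule LIMSEQ_0_le)
    have "(\<lambda>m. \<integral>w. norm (rep (x k l) w - (\<Sum>i<m. c k l i * e i w)) \<partial>M) \<longlonglongrightarrow> 0" if "l < n k" for l
      using atomic_expansion[OF disj A ix[OF that] supp[OF that]] unfolding c_def e_def pairing_def .
    then have "(\<lambda>m. \<Sum>l<n k. (\<integral>w. norm (rep (x k l) w - (\<Sum>i<m. c k l i * e i w)) \<partial>M) * vnorm Y (y k l))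
      \<longlonglongrightarrow> (\<Sum>l<n k. 0 * vnorm Y (y k l))"
      by (intro tendsto_sum tendsto_mult tendsto_const) auto
    then show "(\<lambda>m. \<Sum>l<n k. (\<integral>w. norm (rep (x k l) w - (\<Sum>i<m. c k l i * e i w)) \<partial>M) * vnorm Y (y k l)) \<longlonglongrightarrow> 0"
      by simp
  qed (intro sV td_nonneg cauchy_in s V)+
  note sV0 = this
  show ?thesis
  proof (rule attainsI[OF s xs ys])
    show "(\<lambda>m. lim (\<lambda>k. td (\<lambda>B. \<Sum>i<m. et (xs i) (ys i) B) (s k))) \<longlonglongrightarrow> 0"
      unfolding S_def[symmetric, abs_def]
    proof (rule LIMSEQ_I)
      fix \<epsilon> :: real assume "0 < \<epsilon>"
      then have \<epsilon>: "0 < \<epsilon>/4" by simp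
      \<comment> \<open>\<open>K\<close> is fixed before \<open>m\<close>: the bound between
        \<open>S m\<close> and \<open>V K m\<close> holds for every \<open>m\<close>, whereas
        \<open>m0\<close> may depend on \<open>K\<close>.\<close>
      obtain K where K: "\<And>k k'. k \<ge> K \<Longrightarrow> k' \<ge> K \<Longrightarrow> td (s k) (s k') < \<epsilon>/4"
        using s \<epsilon> unfolding cauchy_iff by meson
      obtain m0 where m0: "\<And>m. m \<ge> m0 \<Longrightarrow> td (s K) (V K m) < \<epsilon>/4"
        using order_tendstoD(2)[OF sV0 \<epsilon>, of K] unfolding eventually_sequentially by blast
      have "norm (lim (\<lambda>k. td (S m) (s k)) - 0) < \<epsilon>" if "m \<ge> m0" for m
      proof -
        have l: "(\<lambda>k. td (S m) (s k)) \<longlonglongrightarrow> lim (\<lambda>k. td (S m) (s k))"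
          using cauchy_td[OF cauchy_const[OF S] s] by (simp add: convergent_LIMSEQ_iff)
        have "td (S m) (s k) \<le> 3 * (\<epsilon>/4)" if k: "k \<ge> K" for k
        proof -
          have "td (S m) (s k) \<le> td (S m) (V K m) + td (V K m) (s K) + td (s K) (s k)"
            using td_triangle[of "S m" "V K m" "s k", OF S V cauchy_in[OF s]] 
              td_triangle[of "V K m" "s K" "s k", OF V cauchy_in[OF s] cauchy_in[OF s]] by simp
          moreover have "td (S m) (V K m) \<le> \<epsilon>/4"
            using SV[of m K] tail[of K "\<epsilon>/4" m] K[of _ K] by (force intro: less_imp_le)
          moreover have "td (V K m) (s K) < \<epsilon>/4"
            using m0[OF \<open>m \<ge> m0\<close>] td_commute[of "V K m" "s K", OF V cauchy_in[OF s]] by simp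
          ultimately show ?thesis using K[of K k] k by simp
        qed
        then have "lim (\<lambda>k. td (S m) (s k)) \<le> 3 * (\<epsilon>/4)"
          by (intro LIMSEQ_le_const2[OF l]) blast
        moreover have "0 \<le> lim (\<lambda>k. td (S m) (s k))"
          by (intro LIMSEQ_le_const[OF l]) (auto intro!: td_nonneg S cauchy_in s)
        ultimately show ?thesis using \<open>0 < \<epsilon>\<close> by simp
      qed
      then show "\<exists>m0. \<forall>m\<ge>m0. norm (lim (\<lambda>k. td (S m) (s k)) - 0) < \<epsilon>" by blast
    qed
    fix m
    have "(\<Sum>i<m. vnorm X (xs i) * vnorm Y (ys i)) \<le> (\<Sum>i<m. 1 * (\<integral>t. norm (z i t) \<partial>N))"
      using z by (intro sum_mono mult_mono xs1) (auto simp: ys_def L1_norm_class)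
    then show "(\<Sum>i<m. vnorm X (xs i) * vnorm Y (ys i)) \<le> lim (\<lambda>k. pn (s k))"
      using znorm[of m] by simp
  qed
qed

end

section \<open>Atomless sets\<close>

locale atomless =
  fixes M :: "'a measure" and E :: "'a set"
  assumes E: "E \<in> fmeasurable M" and no_atom: "A \<subseteq> E \<Longrightarrow> \<not> atom M A"
begin

lemma fmeasurable_subset: "A \<in> sets M \<Longrightarrow> A \<subseteq> E \<Longrightarrow> A \<in> fmeasurable M"
  using E by (rule fmeasurableI2)

lemma measure_subset_diff:
  assumes "A \<in> sets M" "A \<subseteq> E" "B \<in> sets M" "B \<subseteq> A"
  shows "measure M (A - B) = measure M A - measure M B"
  by (rule measurable_measure_Diff[OF fmeasurable_subset[OF assms(1,2)] assms(3,4)])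

text \<open>As \<open>A\<close> is not an atom, some subset has measure strictly between 0 and that
  of \<open>A\<close>; either it or its complement in \<open>A\<close> is small enough.\<close>

lemma ex_subset_half:
  assumes A: "A \<in> sets M" "A \<subseteq> E" "0 < measure M A"
  shows "\<exists>B\<in>sets M. B \<subseteq> A \<and> 0 < measure M B \<and> measure M B \<le> measure M A / 2"
proof -
  have em: "emeasure M C = ennreal (measure M C)" if "C \<in> sets M" "C \<subseteq> A" for C
    using emeasure_eq_measure2[OF fmeasurable_subset[of C]] that A by auto
  from no_atom[OF A(2)] obtain B where B: "B \<in> sets M" "B \<subseteq> A" "emeasure M B \<noteq> 0" "emeasure M B \<noteq> emeasure M A"
    using A em[OF A(1)] by (auto simp: atom_def)
  have pos: "0 < measure M B" using B em[of B] by (auto simp: zero_less_measure_iff)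
  have lt: "measure M B < measure M A"
    using B A em[of B] em[of A] measure_mono_fmeasurable[OF B(2,1) fmeasurable_subset[OF A(1,2)]] by auto
  show ?thesis
  proof (cases "measure M B \<le> measure M A / 2")
    case False
    then show ?thesis
      using measure_subset_diff[OF A(1,2) B(1,2)] lt B A by (intro bexI[of _ "A - B"]) auto
  qed (use B pos in auto)
qed

lemma ex_subset_small:
  assumes A: "A \<in> sets M" "A \<subseteq> E" "0 < measure M A" and "0 < e"
  shows "\<exists>B\<in>sets M. B \<subseteq> A \<and> 0 < measure M B \<and> measure M B < e"
proof -
  have "\<exists>B\<in>sets M. B \<subseteq> A \<and> 0 < measure M B \<and> measure M B \<le> measure M A / 2^n" for n
  proof (induction n)
    case 0
    then show ?case using A by auto
  next
    case (Suc n)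
    then obtain B where B: "B \<in> sets M" "B \<subseteq> A" "0 < measure M B" "measure M B \<le> measure M A / 2^n" by blast
    obtain C where "C \<in> sets M" "C \<subseteq> B" "0 < measure M C" "measure M C \<le> measure M B / 2"
      using ex_subset_half[of B] B A(2) by blast
    with B show ?case by (intro bexI[of _ C]) auto
  qed
  moreover obtain n where "measure M A / 2^n < e"
  proof -
    obtain n where "measure M A / e < 2^n" using real_arch_pow[of 2] by auto
    then show ?thesis using that[of n] \<open>0 < e\<close> by (simp add: field_simps)
  qed
  ultimately show ?thesis by (meson le_less_trans)
qed

text \<open>Sierpinski's theorem: at each step the greedy enlargement gains at least half of what is possible.\<close>

lemma ex_subset_measure_eq:
  assumes A: "A \<in> sets M" "A \<subseteq> E" and t: "0 \<le> t" "t \<le> measure M A"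
  shows "\<exists>B\<in>sets M. B \<subseteq> A \<and> measure M B = t"
proof -
  define P where "P B \<longleftrightarrow> B \<in> sets M \<and> B \<subseteq> A \<and> measure M B \<le> t" for B
  define R where "R B B' \<longleftrightarrow> B \<subseteq> B' \<and> (\<forall>C. P C \<longrightarrow> B \<subseteq> C \<longrightarrow> measure M C - measure M B \<le> 2 * (measure M B' - measure M B))" for B B'
  have step: "\<exists>B'. P B' \<and> R B B'" if B: "P B" for B
  proof -
    define S where "S = measure M ` {C. P C \<and> B \<subseteq> C}"
    have S: "measure M B \<in> S" "bdd_above S" using B by (auto simp: S_def P_def intro!: bdd_aboveI[of _ t])
    have up: "measure M C \<le> Sup S" if "P C" "B \<subseteq> C" for C
      using that S by (intro cSup_upper) (auto simp: S_def)
    show ?thesis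
    proof (cases "Sup S \<le> measure M B")
      case True
      then show ?thesis using B up by (intro exI[of _ B]) (auto simp: R_def intro: order_trans)
    next
      case False
      then have "(Sup S + measure M B) / 2 < Sup S" by simp
      moreover have "S \<noteq> {}" using S by auto
      ultimately obtain x where "x \<in> S" "(Sup S + measure M B) / 2 < x" by (rule less_cSupE)
      then obtain C where C: "P C" "B \<subseteq> C" "(Sup S + measure M B) / 2 < measure M C" by (auto simp: S_def)
      have "measure M D - measure M B \<le> 2 * (measure M C - measure M B)" if "P D" "B \<subseteq> D" for D
        using up[OF that] C(3) by simp
      then show ?thesis using C by (auto simp: R_def)
    qed
  qed
  have P0: "P {}" using t by (simp add: P_def)
  obtain B where B: "\<And>n. P (B n)" "\<And>n. R (B n) (B (Suc n))"
    using dependent_nat_choice[of "\<lambda>_. P" "\<lambda>_. R"] P0 step by metis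
  have inc: "incseq B" using B(2) by (intro incseq_SucI) (simp add: R_def)
  define U where "U = (\<Union>n. B n)"
  have U: "U \<in> sets M" "U \<subseteq> A" using B(1) by (auto simp: U_def P_def)
  have "(\<lambda>n. measure M (B n)) \<longlonglongrightarrow> measure M U" unfolding U_def
  proof (rule Lim_measure_incseq)
    have "U \<in> fmeasurable M" using U A by (intro fmeasurable_subset) auto
    then show "emeasure M (\<Union>n. B n) \<noteq> \<infinity>" by (simp add: fmeasurable_def U_def less_top)
  qed (use B(1) inc in \<open>auto simp: P_def\<close>)
  note lim = this
  have le: "measure M U \<le> t" using B(1) by (intro LIMSEQ_le_const2[OF lim]) (auto simp: P_def)
  have "measure M U = t"
  proof (rule ccontr)
    assume "measure M U \<noteq> t"
    with le have lt: "0 < t - measure M U" by simp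
    have "0 < measure M (A - U)" using measure_subset_diff[OF A U] t lt by simp
    then obtain C where C: "C \<in> sets M" "C \<subseteq> A - U" "0 < measure M C" "measure M C < t - measure M U"
      using ex_subset_small[of "A - U", OF _ _ _ lt] A U by auto
    \<comment> \<open>The missing piece \<open>C\<close> could have been added to every
      \<open>B n\<close>, so each greedy step gains at least half of its measure; but the gains tend
      to 0.\<close>
    have "measure M C \<le> 2 * (measure M (B (Suc n)) - measure M (B n))" for n
    proof -
      have Bn: "B n \<subseteq> U" "B n \<in> sets M" using B(1) by (auto simp: U_def P_def)
      then have dis: "B n \<inter> C = {}" using C by auto
      have un: "measure M (B n \<union> C) = measure M (B n) + measure M C"
        using Bn C U A dis by (intro measure_Un_AE fmeasurable_subset AE_I2) auto
      have "measure M (B n) \<le> measure M U" using Bn U A by (intro measure_mono_fmeasurable) (auto intro!: fmeasurable_subset)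
      then have "P (B n \<union> C)" using un C Bn U by (auto simp: P_def)
      then have "measure M (B n \<union> C) - measure M (B n) \<le> 2 * (measure M (B (Suc n)) - measure M (B n))"
        using B(2)[of n] by (simp add: R_def)
      with un show ?thesis by simp
    qed
    moreover have "(\<lambda>n. 2 * (measure M (B (Suc n)) - measure M (B n))) \<longlonglongrightarrow> 2 * (measure M U - measure M U)"
      by (intro tendsto_intros lim LIMSEQ_Suc)
    ultimately have "measure M C \<le> 2 * (measure M U - measure M U)"
      by (intro LIMSEQ_le_const) auto
    with C(3) show False by simp
  qed
  then show ?thesis using U by blast
qed

text \<open>By induction: one part of the right measure is split off, and the rest is divided into
  one part fewer. Writing the number as \<open>Suc k\<close> excludes division into no
  parts.\<close>

lemma equipartition:
  assumes "A \<in> sets M" "A \<subseteq> E"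
  shows "\<exists>p. (\<forall>c<Suc k. p c \<in> sets M \<and> measure M (p c) = measure M A / Suc k) \<and>
    disjoint_family_on p {..<Suc k} \<and> (\<Union>c<Suc k. p c) = A"
  using assms
proof (induction k arbitrary: A)
  case 0
  then show ?case by (intro exI[of _ "\<lambda>_. A"]) (auto simp: disjoint_family_on_def lessThan_Suc)
next
  case (Suc k)
  have "measure M A / Suc (Suc k) \<le> measure M A" 
    using divide_left_mono[of 1 "real (Suc (Suc k))" "measure M A"] by simp
  then obtain B where B: "B \<in> sets M" "B \<subseteq> A" "measure M B = measure M A / Suc (Suc k)"
    using ex_subset_measure_eq[OF Suc.prems, of "measure M A / Suc (Suc k)"] by auto
  have mAB: "measure M (A - B) = measure M A - measure M B" by (rule measure_subset_diff) (use Suc.prems B in auto)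
  obtain p where p: "\<And>c. c < Suc k \<Longrightarrow> p c \<in> sets M \<and> measure M (p c) = measure M (A - B) / Suc k"
    "disjoint_family_on p {..<Suc k}" "(\<Union>c<Suc k. p c) = A - B"
  proof -
    have "A - B \<in> sets M" "A - B \<subseteq> E" using Suc.prems B by auto
    from Suc.IH[OF this] show ?thesis using that by blast
  qed
  have e: "measure M (A - B) / Suc k = measure M A / Suc (Suc k)"
  proof -
    have "(a - a / (x + 2)) / (x + 1) = a / (x + 2)" if "0 \<le> x" for a x :: real
    proof -
      have "a - a / (x + 2) = a / (x + 2) * (x + 1)" using that by (simp add: field_simps)
      then show ?thesis using that by simp
    qed
    from this[of "real k" "measure M A"] show ?thesis unfolding mAB B(3) by (simp add: add.commute)
  qed
  let ?q = "p(Suc k := B)"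
  have sub: "p c \<subseteq> A - B" if "c < Suc k" for c using p(3) that by blast
  show ?case
  proof (intro exI[of _ ?q] conjI allI impI)
    fix c assume "c < Suc (Suc k)"
    then show "?q c \<in> sets M" "measure M (?q c) = measure M A / Suc (Suc k)"
      using p(1)[of c] e B by (auto simp: less_Suc_eq)
  next
    show "disjoint_family_on ?q {..<Suc (Suc k)}"
      unfolding disjoint_family_on_def
    proof (intro ballI impI)
      fix c d assume "c \<in> {..<Suc (Suc k)}" "d \<in> {..<Suc (Suc k)}" "c \<noteq> d"
      then consider "c < Suc k" "d < Suc k" "c \<noteq> d" | "c < Suc k" "d = Suc k" | "c = Suc k" "d < Suc k"
        by (auto simp: less_Suc_eq)
      then show "?q c \<inter> ?q d = {}"
      proof cases
        case 1
        then show ?thesis using disjoint_family_onD[OF p(2), of c d] by simp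
      next
        case 2
        then show ?thesis using sub[of c] by auto
      next
        case 3
        then show ?thesis using sub[of d] by auto
      qed
    qed
    have "(\<Union>c<Suc (Suc k). ?q c) = ?q (Suc k) \<union> (\<Union>c<Suc k. ?q c)"
      unfolding lessThan_Suc[of "Suc k"] UN_insert ..
    also have "(\<Union>c<Suc k. ?q c) = (\<Union>c<Suc k. p c)" by (intro SUP_cong) auto
    finally show "(\<Union>c<Suc (Suc k). ?q c) = A" using p(3) B by auto
  qed
qed

end

section \<open>Removing the atoms from a set that is not purely atomic\<close>

lemma disjoint_atoms_countable:
  assumes E: "E \<in> fmeasurable M" and D: "disjoint \<D>" and A: "\<And>A. A \<in> \<D> \<Longrightarrow> atom M A \<and> A \<subseteq> E"
  shows "countable \<D>"
proof -
  have f: "A \<in> fmeasurable M" if "A \<in> \<D>" for A using A[OF that] by (auto simp: atom_def fmeasurable_def)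
  \<comment> \<open>Disjointness bounds every finite sum by \<open>measure M E\<close>, and a
    summable family has only countably many nonzero terms.\<close>
  have "(\<lambda>A. measure M A) summable_on \<D>"
  proof (rule nonneg_bdd_above_summable_on)
    show "bdd_above (sum (measure M) ` {F. F \<subseteq> \<D> \<and> finite F})"
    proof (rule bdd_aboveI2)
      fix F assume F: "F \<in> {F. F \<subseteq> \<D> \<and> finite F}"
      have "sum (measure M) F = measure M (\<Union>F)"
        using F f D by (intro measure_Union'[symmetric]) (auto simp: disjoint_def pairwise_def disjnt_def)
      also have "\<dots> \<le> measure M E"
        using F A E f by (intro measure_mono_fmeasurable) (auto intro!: sets.finite_Union)
      finally show "sum (measure M) F \<le> measure M E" .
    qed
  qed auto
  then have "countable {A\<in>\<D>. measure M A \<noteq> 0}" by (rule summable_countable_real)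
  moreover have "measure M A \<noteq> 0" if "A \<in> \<D>" for A
    using A[OF that] emeasure_eq_measure2[OF f[OF that]] by (auto simp: atom_def)
  then have "{A\<in>\<D>. measure M A \<noteq> 0} = \<D>" by auto
  ultimately show ?thesis by simp
qed

lemma atom_subset:
  assumes A: "atom M A" and B: "B \<in> sets M" "B \<subseteq> A" "emeasure M B \<noteq> 0"
  shows "atom M B"
proof -
  have eq: "emeasure M B = emeasure M A" using A B by (auto simp: atom_def)
  show ?thesis unfolding atom_def
  proof (intro conjI ballI impI)
    fix C assume "C \<in> sets M" "C \<subseteq> B"
    then show "emeasure M C = 0 \<or> emeasure M C = emeasure M B"
      using A B unfolding eq by (auto simp: atom_def)
  qed (use A B eq in \<open>auto simp: atom_def zero_less_iff_neq_zero\<close>)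
qed

text \<open>The intersection is a non-null subset of both atoms, hence of full measure in
  each.\<close>

lemma atoms_eq_mod_null:
  assumes A: "atom M A" and B: "atom M B" and "emeasure M (A \<inter> B) \<noteq> 0"
  shows "sym_diff A B \<in> null_sets M"
proof -
  have s: "A \<in> sets M" "B \<in> sets M" using A B by (auto simp: atom_def)
  have "A - B \<in> null_sets M" if A: "atom M A" and n: "emeasure M (A \<inter> B) \<noteq> 0" and s: "A \<in> sets M" "B \<in> sets M" for A B
  proof -
    have "emeasure M (A \<inter> B) = emeasure M A" using A n s by (auto simp: atom_def)
    then have "emeasure M (A - (A \<inter> B)) = 0"
      using emeasure_Diff[of M "A \<inter> B" A] s A by (auto simp: atom_def)
    then show ?thesis using s by (simp add: null_sets_def Diff_Int_distrib Diff_Int)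
  qed
  from this[OF A assms(3) s] this[OF B _ s(2,1)] assms(3) show ?thesis
    by (auto simp: Int_commute intro: null_sets.Un)
qed

text \<open>Zorn's lemma gives a maximal disjoint family of atoms inside a set that is not purely
  atomic. The family is countable, represents every atom of the set modulo null sets, and by
  maximality leaves no atom over; so the remainder cannot be null, and it is the atomless
  set.\<close>

lemma not_purely_atomic_atomless:
  assumes "\<not> purely_atomic M"
  obtains E where "atomless M E" "0 < measure M E"
proof -
  obtain E where E: "E \<in> sets M" "0 < emeasure M E" "emeasure M E < \<infinity>" "\<not> purely_atomic_set M E"
    using assms by (auto simp: purely_atomic_def)
  have fE: "E \<in> fmeasurable M" using E by (simp add: fmeasurable_def)
  define \<F> where "\<F> = {\<D>. disjoint \<D> \<and> (\<forall>A\<in>\<D>. atom M A \<and> A \<subseteq> E)}"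
  have "\<exists>\<D>\<in>\<F>. \<forall>\<D>'\<in>\<F>. \<D> \<subseteq> \<D>' \<longrightarrow> \<D>' = \<D>"
  proof (rule subset_Zorn')
    fix \<C> assume c: "subset.chain \<F> \<C>"
    then have sub: "\<C> \<subseteq> \<F>" and ch: "\<And>\<D> \<D>'. \<D> \<in> \<C> \<Longrightarrow> \<D>' \<in> \<C> \<Longrightarrow> \<D> \<subseteq> \<D>' \<or> \<D>' \<subseteq> \<D>"
      by (auto simp: subset_chain_def)
    have "disjoint (\<Union>\<C>)"
    proof (rule disjointI)
      fix A B assume "A \<in> \<Union>\<C>" "B \<in> \<Union>\<C>" "A \<noteq> B"
      then obtain \<D> \<D>' where D: "\<D> \<in> \<C>" "\<D>' \<in> \<C>" "A \<in> \<D>" "B \<in> \<D>'" by blast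
      then obtain \<G> where "\<G> \<in> \<C>" "A \<in> \<G>" "B \<in> \<G>" using ch[OF D(1,2)] by blast
      then show "A \<inter> B = {}" using sub \<open>A \<noteq> B\<close> by (auto simp: \<F>_def disjoint_def)
    qed
    moreover have "\<forall>A\<in>\<Union>\<C>. atom M A \<and> A \<subseteq> E" using sub by (auto simp: \<F>_def)
    ultimately show "\<Union>\<C> \<in> \<F>" by (simp add: \<F>_def)
  qed
  then obtain \<D> where D: "\<D> \<in> \<F>" and max: "\<And>\<D>'. \<D>' \<in> \<F> \<Longrightarrow> \<D> \<subseteq> \<D>' \<Longrightarrow> \<D>' = \<D>" by blast
  have D': "disjoint \<D>" "\<And>A. A \<in> \<D> \<Longrightarrow> atom M A \<and> A \<subseteq> E" using D by (auto simp: \<F>_def)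
  have cD: "countable \<D>" by (rule disjoint_atoms_countable[OF fE D'])
  have sD: "\<Union>\<D> \<in> sets M" using D'(2) cD by (intro sets.countable_Union) (auto simp: atom_def)
  have no: "\<not> atom M A" if "A \<subseteq> E - \<Union>\<D>" for A
  proof
    assume A: "atom M A"
    then have "A \<noteq> {}" by (auto simp: atom_def)
    have "insert A \<D> \<in> \<F>"
      using D' A that by (auto simp: \<F>_def disjoint_def)
    then have "A \<in> \<D>" using max[of "insert A \<D>"] by auto
    with that \<open>A \<noteq> {}\<close> show False by blast
  qed
  \<comment> \<open>An atom meeting every member in a null set would remain an atom after removal of
    the countable union, against maximality.\<close>
  have rep: "\<exists>A'\<in>\<D>. sym_diff A A' \<in> null_sets M" if A: "atom M A" "A \<subseteq> E" for A
  proof (rule ccontr)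
    assume neg: "\<not> ?thesis"
    have sA: "A \<in> sets M" using A by (simp add: atom_def)
    have z: "A \<inter> B \<in> null_sets M" if "B \<in> \<D>" for B
      using atoms_eq_mod_null[OF A(1), of B] D'(2)[OF that] neg that sA by (auto simp: atom_def null_sets_def)
    have "(\<Union>B\<in>\<D>. A \<inter> B) \<in> null_sets M" by (rule null_sets_UN'[OF cD z])
    moreover have "(\<Union>B\<in>\<D>. A \<inter> B) = A \<inter> \<Union>\<D>" by auto
    ultimately have n: "A \<inter> \<Union>\<D> \<in> null_sets M" by (simp only:)
    have "emeasure M (A - \<Union>\<D>) = emeasure M A"
      using emeasure_Diff_null_set[OF n sA] by (simp add: Diff_Int)
    then have "atom M (A - \<Union>\<D>)"
      using A sA sD by (intro atom_subset[OF A(1)]) (auto simp: atom_def)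
    with no[of "A - \<Union>\<D>"] A show False by blast
  qed
  have "E - \<Union>\<D> \<notin> null_sets M"
  proof
    assume null: "E - \<Union>\<D> \<in> null_sets M"
    have "purely_atomic_set M E"
      unfolding purely_atomic_set_def
    proof (intro exI[of _ \<D>] conjI)
      show "\<forall>A\<in>\<D>. atom M A \<and> A \<subseteq> E" using D'(2) by simp
      show "\<forall>A. atom M A \<and> A \<subseteq> E \<longrightarrow> (\<exists>A'\<in>\<D>. sym_diff A A' \<in> null_sets M)"
        using rep by simp
    qed (rule cD null)+
    with E show False by simp
  qed
  moreover have f: "E - \<Union>\<D> \<in> fmeasurable M" by (rule fmeasurableI2[OF fE]) (use E sD in auto)
  ultimately have "measure M (E - \<Union>\<D>) \<noteq> 0"
    using emeasure_eq_measure2[OF f] by (auto simp: null_sets_def)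
  then have "0 < measure M (E - \<Union>\<D>)" by (simp add: zero_less_measure_iff)
  then show ?thesis using that[of "E - \<Union>\<D>"] f no by (simp add: atomless_def)
qed

section \<open>Words\<close>

text \<open>Widths growing fast enough that \<open>(\<Sum>n. 1 / wid n) < 1\<close>, which keeps \<open>dens\<close> bounded away from 0.\<close>

definition wid :: "nat \<Rightarrow> nat" where "wid n = 2 ^ (n + 2)"

lemma wid_pos [simp]: "0 < wid n" by (simp add: wid_def)

text \<open>Letters are added at the head: in \<open>c # d\<close> the head \<open>c\<close> is the
  newest letter, number \<open>n\<close>, and the tail \<open>d\<close> names the parent
  cell.\<close>

primrec words :: "nat \<Rightarrow> nat list set" where
  "words 0 = {[]}"
| "words (Suc n) = (\<lambda>(c, d). c # d) ` ({..<wid n} \<times> words n)"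

primrec good :: "nat \<Rightarrow> (nat list \<times> nat list) set" where
  "good 0 = {([], [])}"
| "good (Suc n) = (\<lambda>((c, c'), (d, d')). (c # d, c' # d')) ` (({..<wid n} \<times> {..<wid n} - Id) \<times> good n)"

lemma finite_words [simp]: "finite (words n)"
  by (induction n) auto

lemma words_SucI: "c < wid n \<Longrightarrow> d \<in> words n \<Longrightarrow> c # d \<in> words (Suc n)"
  by auto

lemma sum_words_Suc: "(\<Sum>d\<in>words (Suc n). f d) = (\<Sum>d\<in>words n. \<Sum>c<wid n. f (c # d))"
proof -
  have inj: "inj_on (\<lambda>(c, d). c # d) ({..<wid n} \<times> words n)" by (auto simp: inj_on_def)
  have "(\<Sum>d\<in>words (Suc n). f d) = (\<Sum>c<wid n. \<Sum>d\<in>words n. f (c # d))"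
    unfolding words.simps sum.reindex[OF inj] sum.cartesian_product by (intro sum.cong) auto
  also have "\<dots> = (\<Sum>d\<in>words n. \<Sum>c<wid n. f (c # d))" by (rule sum.swap)
  finally show ?thesis .
qed

lemma good_subset: "good n \<subseteq> words n \<times> words n"
  by (induction n) auto

lemma finite_good [simp]: "finite (good n)"
  by (rule finite_subset[OF good_subset]) simp

declare good.simps(2) [simp del]

lemma sum_good_Suc:
  "(\<Sum>(d, d')\<in>good (Suc n). f d d') =
   (\<Sum>(d, d')\<in>good n. \<Sum>(c, c')\<in>{..<wid n} \<times> {..<wid n} - Id. f (c # d) (c' # d'))"
proof -
  have inj: "inj_on (\<lambda>((c, c'), (d, d')). (c # d, c' # d')) (({..<wid n} \<times> {..<wid n} - Id) \<times> good n)"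
    by (auto simp: inj_on_def)
  let ?g = "\<lambda>(c, c') (d, d'). f (c # d) (c' # d')"
  have "(\<Sum>(d, d')\<in>good (Suc n). f d d') = (\<Sum>C\<in>{..<wid n} \<times> {..<wid n} - Id. \<Sum>D\<in>good n. ?g C D)"
    unfolding good.simps sum.reindex[OF inj] sum.cartesian_product by (intro sum.cong) auto
  also have "\<dots> = (\<Sum>D\<in>good n. \<Sum>C\<in>{..<wid n} \<times> {..<wid n} - Id. ?g C D)" by (rule sum.swap)
  finally show ?thesis by (simp add: case_prod_unfold)
qed

definition cnt :: "nat \<Rightarrow> real" where "cnt n = (\<Prod>i<n. real (wid i))"

lemma cnt_pos [simp]: "0 < cnt n" by (simp add: cnt_def prod_pos)

lemma cnt_nonzero [simp]: "cnt n \<noteq> 0" by (rule less_imp_neq[OF cnt_pos, symmetric])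

lemma cnt_Suc: "cnt (Suc n) = cnt n * wid n" by (simp add: cnt_def)

lemma card_words: "real (card (words n)) = cnt n"
proof (induction n)
  case (Suc n)
  have "real (card (words (Suc n))) = (\<Sum>d\<in>words (Suc n). 1)" by simp
  also have "\<dots> = (\<Sum>d\<in>words n. \<Sum>c<wid n. 1)" by (rule sum_words_Suc)
  finally show ?case using Suc by (simp add: cnt_Suc)
qed (simp add: cnt_def)

lemma card_good_Suc: "real (card (good (Suc n))) = real (card (good n)) * (real (wid n) * (real (wid n) - 1))"
proof -
  have "real (card (good (Suc n))) = (\<Sum>(d, d')\<in>good (Suc n). 1)" by simp
  also have "\<dots> = (\<Sum>(d, d')\<in>good n. \<Sum>(c, c')\<in>{..<wid n} \<times> {..<wid n} - Id. 1)" by (rule sum_good_Suc)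
  also have "\<dots> = real (card (good n)) * real (card ({..<wid n} \<times> {..<wid n} - Id))" by simp
  also have "{..<wid n} \<times> {..<wid n} - Id = {..<wid n} \<times> {..<wid n} - (\<lambda>c. (c, c)) ` {..<wid n}" by auto
  also have "card \<dots> = wid n * wid n - wid n"
    by (subst card_Diff_subset) (auto simp: card_image inj_on_def)
  also have "real (wid n * wid n - wid n) = real (wid n) * (real (wid n) - 1)"
    using wid_pos[of n] by (subst of_nat_diff) (simp_all add: algebra_simps Suc_le_eq del: wid_pos)
  finally show ?thesis .
qed

text \<open>The proportion of rectangles of level \<open>n\<close> whose two words differ in every
  letter, that is, the product of the \<open>1 - 1 / wid i\<close>. As all rectangles of a level
  have equal measure, it is also the relative measure of their union.\<close>

definition dens :: "nat \<Rightarrow> real" where "dens n = real (card (good n)) / (cnt n)\<^sup>2"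

lemma dens_Suc: "dens (Suc n) = dens n * (1 - 1 / real (wid n))"
proof -
  have "(g * (k * (k - 1))) / (c * k)\<^sup>2 = g / c\<^sup>2 * (1 - 1 / k)" if "k \<noteq> 0" "c \<noteq> 0" for g k c :: real
    using that by (simp add: divide_simps power2_eq_square)
  moreover have "real (wid n) \<noteq> 0" using wid_pos[of n] by linarith
  ultimately show ?thesis
    unfolding dens_def card_good_Suc cnt_Suc using cnt_nonzero by blast
qed

lemma dens_nonneg: "0 \<le> dens n" by (simp add: dens_def)

lemma dens_le_1: "dens n \<le> 1"
proof (induction n)
  case (Suc n)
  have "1 \<le> real (wid n)" using wid_pos[of n] by linarith
  then have "dens n * (1 - 1 / real (wid n)) \<le> 1 * 1"
    using Suc dens_nonneg[of n] by (intro mult_mono) auto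
  then show ?case by (simp add: dens_Suc)
qed (simp add: dens_def cnt_def)

lemma dens_diff: "dens n - dens (Suc n) = dens n / wid n"
  by (simp add: dens_Suc algebra_simps)

text \<open>The extra term makes the bound inductive: it starts from 1 = 1/2 + 1/2, and step
  \<open>n\<close> loses at most \<open>1 / wid n = (1/2)^(n+2)\<close>, which is exactly the
  decrease of the bound.\<close>

lemma dens_ge: "1/2 + (1/2)^(n+1) \<le> dens n"
proof (induction n)
  case (Suc n)
  have "dens n / wid n \<le> 1 / wid n" using dens_le_1 by (intro divide_right_mono) auto
  then have "dens n - dens (Suc n) \<le> (1/2)^(n+2)"
    unfolding dens_diff by (simp add: wid_def power_divide)
  with Suc show ?case by (simp add: field_simps)
qed (simp add: dens_def cnt_def)

lemma dens_limit: obtains p where "dens \<longlonglongrightarrow> p" "1/2 \<le> p"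
proof -
  have "decseq dens"
    using dens_diff dens_nonneg by (intro decseq_SucI) (metis diff_ge_0_iff_ge of_nat_0_le_iff zero_le_divide_iff)
  then obtain p where p: "dens \<longlonglongrightarrow> p"
    using decseq_convergent[of dens 0] dens_nonneg by blast
  moreover have "1/2 \<le> p"
  proof (rule LIMSEQ_le_const[OF p])
    have "1/2 \<le> dens n" for n
      using dens_ge[of n] by (rule order_trans[rotated]) simp
    then show "\<exists>N. \<forall>n\<ge>N. 1/2 \<le> dens n" by blast
  qed
  ultimately show ?thesis by (rule that)
qed

text \<open>The energies \<open>cnt n * (\<Sum>d\<in>words n. (s d)\<^sup>2)\<close> increase and stay below \<open>m\<^sup>2\<close>, so their increments, which
  dominate the deviation from equidistribution of the \<open>n\<close>-th letter, tend to 0.\<close>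

lemma equidistribution:
  fixes s :: "nat list \<Rightarrow> real"
  assumes nonneg: "\<And>n d. d \<in> words n \<Longrightarrow> 0 \<le> s d"
    and add: "\<And>n d. d \<in> words n \<Longrightarrow> (\<Sum>c<wid n. s (c # d)) = s d"
    and le: "\<And>n d. d \<in> words n \<Longrightarrow> s d \<le> m / cnt n"
  shows "(\<lambda>n. wid n * (\<Sum>c<wid n. ((\<Sum>d\<in>words n. s (c # d)) - s [] / wid n)\<^sup>2)) \<longlonglongrightarrow> 0"
proof -
  \<comment> \<open>If \<open>s d\<close> is the measure of the trace of a set on a cell of measure
    \<open>m / cnt n\<close>, this is \<open>m\<close> times the squared L2 norm of the conditional
    expectation of its indicator: energies of a martingale.\<close>
  define e where "e n = cnt n * (\<Sum>d\<in>words n. (s d)\<^sup>2)" for n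
  define q where "q n = wid n * (\<Sum>c<wid n. ((\<Sum>d\<in>words n. s (c # d)) - s [] / wid n)\<^sup>2)" for n
  have total: "(\<Sum>d\<in>words n. s d) = s []" for n
  proof (induction n)
    case (Suc n)
    then show ?case using add by (simp add: sum_words_Suc del: words.simps)
  qed simp
  have step: "q n \<le> e (Suc n) - e n" for n
  proof -
    let ?K = "real (wid n)"
    have K: "0 < ?K" by simp
    \<comment> \<open>Decomposition of the second moment into variance and squared mean, within one
      parent cell.\<close>
    have split: "(\<Sum>c<wid n. (s (c # d))\<^sup>2) = (\<Sum>c<wid n. (s (c # d) - s d / ?K)\<^sup>2) + (s d)\<^sup>2 / ?K"
      if "d \<in> words n" for d
    proof -
      have "(\<Sum>c<wid n. (s (c # d) - s d / ?K)\<^sup>2)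
        = (\<Sum>c<wid n. (s (c # d))\<^sup>2 - 2 * (s d / ?K) * s (c # d) + (s d / ?K)\<^sup>2)"
        by (simp add: power2_diff algebra_simps)
      also have "\<dots> = (\<Sum>c<wid n. (s (c # d))\<^sup>2) - 2 * (s d / ?K) * (\<Sum>c<wid n. s (c # d)) + ?K * (s d / ?K)\<^sup>2"
        by (simp add: sum.distrib sum_subtractf sum_distrib_left)
      also have "\<dots> = (\<Sum>c<wid n. (s (c # d))\<^sup>2) - (s d)\<^sup>2 / ?K"
        unfolding add[OF that] using K by (simp add: power2_eq_square field_simps)
      finally show ?thesis by simp
    qed
    have "e (Suc n) = cnt n * ?K * (\<Sum>d\<in>words n. \<Sum>c<wid n. (s (c # d))\<^sup>2)"
      by (simp add: e_def cnt_Suc sum_words_Suc del: words.simps)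
    also have "(\<Sum>d\<in>words n. \<Sum>c<wid n. (s (c # d))\<^sup>2)
        = (\<Sum>d\<in>words n. \<Sum>c<wid n. (s (c # d) - s d / ?K)\<^sup>2) + (\<Sum>d\<in>words n. (s d)\<^sup>2) / ?K"
      by (simp add: split sum.distrib sum_divide_distrib)
    finally have "e (Suc n) - e n = ?K * (\<Sum>d\<in>words n. \<Sum>c<wid n. (s (c # d) - s d / ?K)\<^sup>2) * cnt n"
      using K by (simp add: e_def algebra_simps)
    also have "\<dots> = ?K * (\<Sum>c<wid n. (\<Sum>d\<in>words n. (s (c # d) - s d / ?K)\<^sup>2) * cnt n)"
      by (subst sum.swap) (simp add: sum_distrib_right)
    \<comment> \<open>Cauchy-Schwarz over the \<open>cnt n\<close> words passes from the deviations
      in single cells to the deviation of the whole letter.\<close>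
    also have "\<dots> \<ge> ?K * (\<Sum>c<wid n. (\<Sum>d\<in>words n. s (c # d) - s d / ?K)\<^sup>2)"
      using sum_squared_le_sum_of_squares[of _ "words n"] unfolding card_words
      by (intro mult_left_mono sum_mono) auto
    also have "?K * (\<Sum>c<wid n. (\<Sum>d\<in>words n. s (c # d) - s d / ?K)\<^sup>2) = q n"
      by (simp add: q_def sum_subtractf sum_divide_distrib[symmetric] total)
    finally show ?thesis by simp
  qed
  have q0: "0 \<le> q n" for n unfolding q_def by (intro mult_nonneg_nonneg sum_nonneg) auto
  have bound: "e n \<le> m\<^sup>2" for n
  proof -
    have "(\<Sum>d\<in>words n. (s d)\<^sup>2) \<le> (\<Sum>d\<in>words n. (m / cnt n)\<^sup>2)"
      using nonneg le by (intro sum_mono power_mono) auto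
    then have "e n \<le> cnt n * (cnt n * (m / cnt n)\<^sup>2)"
      unfolding e_def using cnt_pos[of n] by (intro mult_left_mono) (auto simp: card_words less_imp_le)
    also have "\<dots> = m\<^sup>2" by (simp add: power2_eq_square)
    finally show ?thesis .
  qed
  have "incseq e" using step q0 by (intro incseq_SucI) (metis diff_ge_0_iff_ge order_trans)
  then obtain L where L: "e \<longlonglongrightarrow> L" using incseq_convergent[of e "m\<^sup>2"] bound by blast
  have "(\<lambda>n. e (Suc n) - e n) \<longlonglongrightarrow> L - L" by (intro tendsto_diff LIMSEQ_Suc L)
  then have "(\<lambda>n. e (Suc n) - e n) \<longlonglongrightarrow> 0" by simp
  then have "q \<longlonglongrightarrow> 0" using q0 step by (rule LIMSEQ_0_le)
  then show ?thesis unfolding q_def .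
qed

text \<open>For large \<open>n\<close> both families give nearly the same weight to every value of
  the n-th letter. If they never share a value, \<open>a n c * b n c\<close> vanishes for all
  \<open>c\<close>, and one of the two totals must be 0.\<close>

lemma letters_meet:
  fixes s t :: "nat list \<Rightarrow> real"
  assumes s: "\<And>n d. d \<in> words n \<Longrightarrow> 0 \<le> s d" "\<And>n d. d \<in> words n \<Longrightarrow> (\<Sum>c<wid n. s (c # d)) = s d"
      "\<And>n d. d \<in> words n \<Longrightarrow> s d \<le> m / cnt n"
    and t: "\<And>n d. d \<in> words n \<Longrightarrow> 0 \<le> t d" "\<And>n d. d \<in> words n \<Longrightarrow> (\<Sum>c<wid n. t (c # d)) = t d"
      "\<And>n d. d \<in> words n \<Longrightarrow> t d \<le> m' / cnt n"
    and zero: "\<And>n c d d'. c < wid n \<Longrightarrow> d \<in> words n \<Longrightarrow> d' \<in> words n \<Longrightarrow> s (c # d) * t (c # d') = 0"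
  shows "s [] * t [] = 0"
proof -
  define a where "a n c = (\<Sum>d\<in>words n. s (c # d))" for n c
  define b where "b n c = (\<Sum>d\<in>words n. t (c # d))" for n c
  define q where "q n = wid n * (\<Sum>c<wid n. (a n c - s [] / wid n)\<^sup>2)" for n
  define r where "r n = wid n * (\<Sum>c<wid n. (b n c - t [] / wid n)\<^sup>2)" for n
  have tot: "(\<Sum>d\<in>words n. s d) = s []" "(\<Sum>d\<in>words n. t d) = t []" for n
    by (induction n) (simp_all add: sum_words_Suc s t del: words.simps(2))
  have ab: "a n c * b n c = 0" if "c < wid n" for n c
    unfolding a_def b_def sum_product using that by (intro sum.neutral ballI zero)
  have sa: "(\<Sum>c<wid n. a n c) = s []" "(\<Sum>c<wid n. b n c) = t []" for n
    unfolding a_def b_def by (subst sum.swap, simp add: s t tot)+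
  have "s [] * t [] \<le> (q n + r n) / 2" for n
  proof -
    let ?K = "real (wid n)"
    have K: "0 < ?K" by simp
    \<comment> \<open>The covariance of the two distributions of letters: since the mixed terms
      vanish, it is exactly \<open>- s [] * t [] / ?K\<close>.\<close>
    have "(\<Sum>c<wid n. (a n c - s [] / ?K) * (b n c - t [] / ?K))
      = (\<Sum>c<wid n. a n c * b n c - (t [] / ?K) * a n c - (s [] / ?K) * b n c + s [] * t [] / ?K\<^sup>2)"
      by (intro sum.cong refl) (simp add: algebra_simps power2_eq_square)
    also have "\<dots> = (\<Sum>c<wid n. a n c * b n c) - (t [] / ?K) * s [] - (s [] / ?K) * t [] + ?K * (s [] * t [] / ?K\<^sup>2)"
      by (simp add: sum.distrib sum_subtractf sum_distrib_left[symmetric] sa del: times_divide_eq_left)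
    also have "\<dots> = - (s [] * t [] / ?K)"
    proof -
      have "(\<Sum>c<wid n. a n c * b n c) = 0" using ab by (intro sum.neutral ballI) simp
      then show ?thesis using K by (simp add: power2_eq_square field_simps)
    qed
    finally have eq: "s [] * t [] / ?K = - (\<Sum>c<wid n. (a n c - s [] / ?K) * (b n c - t [] / ?K))" by simp
    \<comment> \<open>This bounds the covariance by the two deviations separately; the factor
      \<open>?K\<close> then turns them into \<open>q n\<close> and \<open>r n\<close>, which tend
      to 0.\<close>
    have "- (x * y) \<le> (x\<^sup>2 + y\<^sup>2) / 2" for x y :: real
      using zero_le_power2[of "x + y"] by (simp add: power2_sum)
    then have "s [] * t [] / ?K \<le> (\<Sum>c<wid n. ((a n c - s [] / ?K)\<^sup>2 + (b n c - t [] / ?K)\<^sup>2) / 2)"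
      unfolding eq sum_negf[symmetric] by (intro sum_mono) simp
    then have "?K * (s [] * t [] / ?K) \<le> ?K * (\<Sum>c<wid n. ((a n c - s [] / ?K)\<^sup>2 + (b n c - t [] / ?K)\<^sup>2) / 2)"
      using K by (intro mult_left_mono) auto
    also have "\<dots> = (q n + r n) / 2"
      by (simp add: q_def r_def sum.distrib sum_divide_distrib[symmetric] algebra_simps)
    finally show ?thesis using K by simp
  qed
  moreover have "(\<lambda>n. (q n + r n) / 2) \<longlonglongrightarrow> (0 + 0) / 2"
    unfolding q_def r_def a_def b_def
    by (intro tendsto_divide tendsto_add equidistribution[of s m] equidistribution[of t m'] s t tendsto_const) auto
  ultimately have "s [] * t [] \<le> (0 + 0) / 2" by (intro LIMSEQ_le_const[where X="\<lambda>n. (q n + r n) / 2"]) auto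
  moreover have "0 \<le> s [] * t []" using s(1)[of "[]" 0] t(1)[of "[]" 0] by simp
  ultimately show ?thesis by simp
qed

section \<open>Cells\<close>

locale cells =
  fixes M :: "'a measure" and E :: "'a set" and cell :: "nat list \<Rightarrow> 'a set"
  assumes E: "E \<in> fmeasurable M" and cell_Nil: "cell [] = E"
    and cell_Cons: "\<And>n c d. d \<in> words n \<Longrightarrow> c < wid n \<Longrightarrow>
      cell (c # d) \<in> sets M \<and> measure M (cell (c # d)) = measure M (cell d) / wid n"
    and disj_Cons: "\<And>n d. d \<in> words n \<Longrightarrow> disjoint_family_on (\<lambda>c. cell (c # d)) {..<wid n}"
    and UN_Cons: "\<And>n d. d \<in> words n \<Longrightarrow> (\<Union>c<wid n. cell (c # d)) = cell d"
begin

lemma cell_sets: "d \<in> words n \<Longrightarrow> cell d \<in> sets M"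
  by (cases n) (use E cell_Nil cell_Cons in auto)

lemma cell_measure: "d \<in> words n \<Longrightarrow> measure M (cell d) = measure M E / cnt n"
  by (induction n arbitrary: d) (auto simp: cell_Nil cell_Cons cnt_def)

lemma cell_Cons_subset: "d \<in> words n \<Longrightarrow> c < wid n \<Longrightarrow> cell (c # d) \<subseteq> cell d"
  using UN_Cons[of d n] by blast

lemma UN_cells: "(\<Union>d\<in>words n. cell d) = E"
proof (induction n)
  case (Suc n)
  have "(\<Union>d\<in>words (Suc n). cell d) = (\<Union>d\<in>words n. \<Union>c<wid n. cell (c # d))" by auto
  also have "\<dots> = (\<Union>d\<in>words n. cell d)" using UN_Cons by (intro SUP_cong) auto
  finally show ?case using Suc by simp
qed (simp add: cell_Nil)

lemma cell_subset: "d \<in> words n \<Longrightarrow> cell d \<subseteq> E"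
  using UN_cells[of n] by blast

lemma cell_fmeasurable: "d \<in> words n \<Longrightarrow> cell d \<in> fmeasurable M"
  using fmeasurableI2[OF E cell_subset cell_sets] .

lemma disj_cells: "disjoint_family_on cell (words n)"
proof (induction n)
  case (Suc n)
  show ?case unfolding disjoint_family_on_def
  proof (intro ballI impI)
    fix v w assume "v \<in> words (Suc n)" "w \<in> words (Suc n)" and ne: "v \<noteq> w"
    then obtain c d c' d' where cd: "v = c # d" "w = c' # d'" "c < wid n" "c' < wid n" "d \<in> words n" "d' \<in> words n"
      by auto
    show "cell v \<inter> cell w = {}"
    proof (cases "d = d'")
      case True
      then show ?thesis using disjoint_family_onD[OF disj_Cons[OF cd(5)], of c c'] cd ne by auto
    next
      case False
      then show ?thesis
        using disjoint_family_onD[OF Suc.IH cd(5,6)] cell_Cons_subset[OF cd(5,3)] cell_Cons_subset[OF cd(6,4)] cd by auto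
    qed
  qed
qed (simp add: disjoint_family_on_def)

end

lemma (in atomless) cells_exist: obtains cell where "cells M E cell"
proof -
  define part where "part A k = (SOME p. (\<forall>c<k. p c \<in> sets M \<and> measure M (p c) = measure M A / k) \<and>
    disjoint_family_on p {..<k} \<and> (\<Union>c<k. p c) = A)" for A and k :: nat
  \<comment> \<open>The length of the tail is the level, which fixes the number of children.\<close>
  define cell where "cell = rec_list E (\<lambda>c d A. part A (wid (length d)) c)"
  have cell_simps: "cell [] = E" "cell (c # d) = part (cell d) (wid (length d)) c" for c d
    by (simp_all add: cell_def)
  have part: "(\<forall>c<wid n. part A (wid n) c \<in> sets M \<and> measure M (part A (wid n) c) = measure M A / wid n) \<and>
    disjoint_family_on (part A (wid n)) {..<wid n} \<and> (\<Union>c<wid n. part A (wid n) c) = A"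
    if "A \<in> sets M" "A \<subseteq> E" for A n
  proof -
    obtain k where k: "wid n = Suc k" using wid_pos[of n] by (cases "wid n") auto
    show ?thesis unfolding part_def k by (rule someI_ex[OF equipartition[OF that]])
  qed
  have len: "length d = n" if "d \<in> words n" for d n using that by (induction n arbitrary: d) auto
  have inv: "cell d \<in> sets M \<and> cell d \<subseteq> E" if "d \<in> words n" for d n
    using that
  proof (induction n arbitrary: d)
    case 0
    then show ?case using E by (simp add: cell_simps)
  next
    case (Suc n)
    then obtain c e where d: "d = c # e" "c < wid n" "e \<in> words n" by auto
    then show ?case
      using part[of "cell e" n] Suc.IH[OF d(3)] by (simp add: cell_simps len) blast
  qed
  have "cells M E cell"
  proof
    fix n d assume d: "d \<in> words n"
    note p = part[of "cell d" n] inv[OF d]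
    show "cell (c # d) \<in> sets M \<and> measure M (cell (c # d)) = measure M (cell d) / wid n" if "c < wid n" for c
      using p that by (simp add: cell_simps len[OF d])
    show "disjoint_family_on (\<lambda>c. cell (c # d)) {..<wid n}"
      using p by (simp add: cell_simps len[OF d])
    show "(\<Union>c<wid n. cell (c # d)) = cell d"
      using p by (simp add: cell_simps len[OF d])
  qed (use E in \<open>auto simp: cell_simps\<close>)
  then show ?thesis by (rule that)
qed

section \<open>A tensor that does not attain its norm\<close>

text \<open>Allows integrals of \<open>norm f\<close> over cells to be replaced by traces of the
  support. Equidistribution requires a bounded density; the trace of a set has one, while
  \<open>f\<close> itself may be unbounded.\<close>

lemma integral_indicator_norm_eq_0:
  fixes f :: "'a \<Rightarrow> 'b::{banach, second_countable_topology}"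
  assumes f: "integrable M f" and A: "A \<in> fmeasurable M"
  shows "(\<integral>x. indicator A x * norm (f x) \<partial>M) = 0 \<longleftrightarrow> measure M (A \<inter> {x\<in>space M. f x \<noteq> 0}) = 0"
proof -
  have sA: "A \<in> sets M" "A \<subseteq> space M" using A sets.sets_into_space by (auto simp: fmeasurable_def)
  have [measurable]: "f \<in> borel_measurable M" using f by (rule borel_measurable_integrable)
  have m: "{x\<in>space M. f x \<noteq> 0} \<in> sets M" by measurable
  have "integrable M (\<lambda>x. indicator A x * norm (f x))"
    using bdd_fun_integrable[of M "indicator A" "\<lambda>x. norm (f x)"] f sA by auto
  then have "(\<integral>x. indicator A x * norm (f x) \<partial>M) = 0 \<longleftrightarrow> (AE x in M. indicator A x * norm (f x) = 0)"
    by (intro integral_nonneg_eq_0_iff_AE) auto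
  also have "\<dots> \<longleftrightarrow> emeasure M (A \<inter> {x\<in>space M. f x \<noteq> 0}) = 0"
    using sA m by (intro AE_iff_measurable) (auto simp: indicator_def)
  also have "\<dots> \<longleftrightarrow> measure M (A \<inter> {x\<in>space M. f x \<noteq> 0}) = 0"
    using emeasure_eq_measure2[OF fmeasurableI2[OF A, of "A \<inter> {x\<in>space M. f x \<noteq> 0}"]] sA m by auto
  finally show ?thesis .
qed

context cells begin

text \<open>Supplies the hypotheses of \<open>letters_meet\<close> for the weights
  \<open>measure M (cell d \<inter> S)\<close>.\<close>

lemma cell_trace:
  assumes S: "S \<in> sets M"
  shows "d \<in> words n \<Longrightarrow> (\<Sum>c<wid n. measure M (cell (c # d) \<inter> S)) = measure M (cell d \<inter> S)"
    "d \<in> words n \<Longrightarrow> measure M (cell d \<inter> S) \<le> measure M E / cnt n"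
proof -
  assume d: "d \<in> words n"
  have f: "cell (c # d) \<inter> S \<in> fmeasurable M" if "c < wid n" for c
    using cell_fmeasurable[OF words_SucI[OF that d]] S by (intro fmeasurable_Int_fmeasurable)
  have "(\<Sum>c<wid n. measure M (cell (c # d) \<inter> S)) = measure M (\<Union>c<wid n. cell (c # d) \<inter> S)"
    using f disj_Cons[OF d]
    by (intro measure_UNION'[symmetric]) (auto simp: pairwise_def disjnt_def disjoint_family_on_def)
  also have "(\<Union>c<wid n. cell (c # d) \<inter> S) = cell d \<inter> S"
    using UN_Cons[OF d] by blast
  finally show "(\<Sum>c<wid n. measure M (cell (c # d) \<inter> S)) = measure M (cell d \<inter> S)" .
  have "measure M (cell d \<inter> S) \<le> measure M (cell d)"
    using cell_sets[OF d] cell_fmeasurable[OF d] S by (intro measure_mono_fmeasurable) auto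
  then show "measure M (cell d \<inter> S) \<le> measure M E / cnt n" by (simp add: cell_measure[OF d])
qed

lemma sum_indicator_children:
  assumes "d \<in> words n"
  shows "(\<Sum>c<wid n. indicator (cell (c # d)) x) = (indicator (cell d) x :: 'k::comm_semiring_1)"
  unfolding UN_Cons[OF assms, symmetric]
  by (rule indicator_UN_disjoint[symmetric, OF finite_lessThan disj_Cons[OF assms]])

lemma sum_indicator_cells: "(\<Sum>d\<in>words n. indicator (cell d) x) = (indicator E x :: 'k::comm_semiring_1)"
  unfolding UN_cells[of n, symmetric]
  by (rule indicator_UN_disjoint[symmetric, OF finite_words disj_cells])

lemma integrable_cell: "d \<in> words n \<Longrightarrow> integrable M (indicator (cell d) :: 'a \<Rightarrow> 'k::{real_normed_field, banach, second_countable_topology})"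
proof -
  assume d: "d \<in> words n"
  have "integrable M (\<lambda>x. of_real (indicat_real (cell d) x) :: 'k)"
    using cell_fmeasurable[OF d] by (intro integrable_of_real) (auto simp: fmeasurable_def)
  moreover have "(\<lambda>x. of_real (indicat_real (cell d) x) :: 'k) = indicator (cell d)"
    by (auto simp: indicator_def)
  ultimately show ?thesis by simp
qed

lemma norm_cell: "d \<in> words n \<Longrightarrow>
  vnorm (L1 TYPE('k::{real_normed_field, banach, second_countable_topology}) M) (L1_class M (indicator (cell d))) = measure M E / cnt n"
  using sets.sets_into_space[OF cell_sets[of d n]]
  by (simp add: L1_norm_class integrable_cell norm_indicator Int_absorb2 cell_measure)

lemma sum_cell_integrals:
  fixes f :: "'a \<Rightarrow> 'b::{banach, second_countable_topology}"
  assumes f: "integrable M f"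
  shows "(\<Sum>d\<in>words n. \<integral>x. indicator (cell d) x * norm (f x) \<partial>M) \<le> (\<integral>x. norm (f x) \<partial>M)"
proof -
  have i: "integrable M (\<lambda>x. indicator A x * norm (f x))" if "A \<in> sets M" for A
    using bdd_fun_integrable[of M "indicator A" "\<lambda>x. norm (f x)"] f that by auto
  have "(\<Sum>d\<in>words n. \<integral>x. indicator (cell d) x * norm (f x) \<partial>M)
      = (\<integral>x. (\<Sum>d\<in>words n. indicator (cell d) x * norm (f x)) \<partial>M)"
    by (intro Bochner_Integration.integral_sum[symmetric] i cell_sets)
  also have "\<dots> = (\<integral>x. indicator E x * norm (f x) \<partial>M)"
    by (simp add: sum_distrib_right[symmetric] sum_indicator_cells)
  also have "\<dots> \<le> (\<integral>x. norm (f x) \<partial>M)"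
    using i[of E] E f by (intro integral_mono) (auto simp: fmeasurable_def indicator_def)
  finally show ?thesis .
qed

lemma pairing_cells:
  assumes d: "d \<in> words n" and e: "e \<in> words k"
  shows "pairing M (indicator (cell e)) (L1_class M (indicator (cell d)))
    = (of_real (measure M (cell e \<inter> cell d)) :: 'k::{real_normed_field, banach, second_countable_topology})"
proof -
  have "pairing M (indicator (cell e)) (L1_class M (indicator (cell d)))
    = (\<integral>x. indicator (cell e) x * indicator (cell d) x \<partial>M :: 'k)"
    by (intro pairing_class bdd_fun_indicator cell_sets[OF e] integrable_cell[OF d])
  also have "\<dots> = (\<integral>x. indicat_real (cell e \<inter> cell d) x *\<^sub>R 1 \<partial>M)"
    by (intro Bochner_Integration.integral_cong) (auto simp: indicator_def)
  also have "\<dots> = (\<integral>x. indicat_real (cell e \<inter> cell d) x \<partial>M) *\<^sub>R 1"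
  proof (rule integral_scaleR_left)
    have "cell e \<inter> cell d \<in> fmeasurable M"
      using cell_fmeasurable[OF e] cell_sets[OF d] by (rule fmeasurable_Int_fmeasurable)
    then show "integrable M (indicat_real (cell e \<inter> cell d))" by (auto simp: fmeasurable_def)
  qed
  also have "\<dots> = of_real (measure M (cell e \<inter> cell d))"
    using sets.sets_into_space[OF cell_sets[OF d]] by (simp add: Int_absorb2 Int_assoc of_real_def)
  finally show ?thesis .
qed

end

context L1_tensor begin

theorem atomless_not_attained:
  assumes ce: "cells M E ce" and cf: "cells N F cf" and pos: "0 < measure M E" "0 < measure N F"
  shows "\<exists>s. cauchy s \<and> \<not> attains s"
proof -
  interpret E: cells M E ce by (rule ce)
  interpret F: cells N F cf by (rule cf)
  define m where "m = measure M E * measure N F"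
  have m: "0 < m" using pos by (simp add: m_def)
  define iM where "iM d = L1_class M (indicator (ce d) :: 'a \<Rightarrow> 'k)" for d
  define iN where "iN d = L1_class N (indicator (cf d) :: 'b \<Rightarrow> 'k)" for d
  have iM: "iM d \<in> vcarrier X" "vnorm X (iM d) = measure M E / cnt n" if "d \<in> words n" for d n
    unfolding iM_def using E.integrable_cell[OF that] E.norm_cell[OF that] by (auto intro: L1_class_in)
  have iN: "iN d \<in> vcarrier Y" "vnorm Y (iN d) = measure N F / cnt n" if "d \<in> words n" for d n
    unfolding iN_def using F.integrable_cell[OF that] F.norm_cell[OF that] by (auto intro: L1_class_in)
  have gw: "fst D \<in> words n" "snd D \<in> words n" if "D \<in> good n" for D n using that good_subset[of n] by auto
  have gi: "iM (fst D) \<in> vcarrier X" "iN (snd D) \<in> vcarrier Y" if "D \<in> good n" for D n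
    using iM(1)[OF gw(1)[OF that]] iN(1)[OF gw(2)[OF that]] .
  \<comment> \<open>The tensor of the indicator of the union of the good rectangles of level
    \<open>n\<close>. These unions decrease, and the class of this sequence will be the element that
    does not attain its norm.\<close>
  define u where "u n B = (\<Sum>D\<in>good n. et (iM (fst D)) (iN (snd D)) B)" for n B
  have u: "u n \<in> vcarrier T" for n unfolding u_def by (rule finite_sum_in[OF finite_good gi])
  have pn_u: "pn (u n) \<le> m * dens n" for n
  proof -
    have "pn (u n) \<le> (\<Sum>D\<in>good n. vnorm X (iM (fst D)) * vnorm Y (iN (snd D)))"
      unfolding u_def by (rule finite_sum_pn[OF finite_good gi])
    also have "\<dots> = (\<Sum>D\<in>good n. (measure M E / cnt n) * (measure N F / cnt n))"
      using iM(2)[OF gw(1)] iN(2)[OF gw(2)] by (intro sum.cong) auto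
    also have "\<dots> = m * dens n" by (simp add: m_def dens_def power2_eq_square)
    finally show ?thesis .
  qed
  have split: "et (iM d) (iN d') B = (\<Sum>(c, c')\<in>{..<wid n} \<times> {..<wid n}. et (iM (c # d)) (iN (c' # d')) B)"
    if d: "d \<in> words n" "d' \<in> words n" for d d' n B
  proof -
    have ic: "integrable M (indicator (ce (c # d)) :: 'a \<Rightarrow> 'k)" "integrable N (indicator (cf (c # d')) :: 'b \<Rightarrow> 'k)"
      if "c \<in> {..<wid n}" for c
      using that E.integrable_cell[OF words_SucI[OF _ d(1)]] F.integrable_cell[OF words_SucI[OF _ d(2)]] by auto
    have "et (L1_class M (\<lambda>x. \<Sum>c<wid n. 1 * indicator (ce (c # d)) x)) (iN d') B
        = (\<Sum>c<wid n. 1 * et (iM (c # d)) (iN d') B)"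
      unfolding iM_def by (rule et_sum_left[OF finite_lessThan ic(1) iN(1)[OF d(2)]])
    then have "et (iM d) (iN d') B = (\<Sum>c<wid n. et (iM (c # d)) (iN d') B)"
      by (simp only: mult_1 E.sum_indicator_children[OF d(1)] iM_def)
    also have "\<dots> = (\<Sum>c<wid n. \<Sum>c'<wid n. et (iM (c # d)) (iN (c' # d')) B)"
    proof (intro sum.cong refl)
      fix c assume "c \<in> {..<wid n}"
      then have X: "iM (c # d) \<in> vcarrier X" using iM(1)[OF words_SucI[OF _ d(1)]] by auto
      have "et (iM (c # d)) (L1_class N (\<lambda>x. \<Sum>c'<wid n. 1 * indicator (cf (c' # d')) x)) B
          = (\<Sum>c'<wid n. 1 * et (iM (c # d)) (iN (c' # d')) B)"
        unfolding iN_def by (rule et_sum_right[OF finite_lessThan ic(2) X])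
      then show "et (iM (c # d)) (iN d') B = (\<Sum>c'<wid n. et (iM (c # d)) (iN (c' # d')) B)"
        by (simp only: mult_1 F.sum_indicator_children[OF d(2)] iN_def)
    qed
    finally show ?thesis by (simp add: sum.cartesian_product)
  qed
  \<comment> \<open>After both sides are split into children, the difference consists of the
    rectangles whose new letters agree; their total measure bounds the distance.\<close>
  have step: "td (u n) (u (Suc n)) \<le> m * (dens n - dens (Suc n))" for n
  proof -
    let ?W = "{..<wid n} \<times> {..<wid n}"
    have "u n B - u (Suc n) B = (\<Sum>(D, c)\<in>good n \<times> {..<wid n}. et (iM (c # fst D)) (iN (c # snd D)) B)" for B
    proof -
      have un: "u n B = (\<Sum>D\<in>good n. \<Sum>(c, c')\<in>?W. et (iM (c # fst D)) (iN (c' # snd D)) B)"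
        unfolding u_def by (intro sum.cong refl split gw)
      have us: "u (Suc n) B = (\<Sum>D\<in>good n. \<Sum>(c, c')\<in>?W - Id. et (iM (c # fst D)) (iN (c' # snd D)) B)"
        using sum_good_Suc[of "\<lambda>d d'. et (iM d) (iN d') B" n] unfolding u_def by (simp add: case_prod_unfold)
      have diag: "(\<Sum>(c, c')\<in>?W. g c c') - (\<Sum>(c, c')\<in>?W - Id. g c c') = (\<Sum>c<wid n. g c c)" for g :: "nat \<Rightarrow> nat \<Rightarrow> 'k"
      proof -
        have "(\<Sum>(c, c')\<in>?W. g c c') = (\<Sum>(c, c')\<in>?W - Id. g c c') + (\<Sum>(c, c')\<in>(\<lambda>c. (c, c)) ` {..<wid n}. g c c')"
          by (subst sum.union_disjoint[symmetric]) (auto intro!: sum.cong)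
        also have "(\<Sum>(c, c')\<in>(\<lambda>c. (c, c)) ` {..<wid n}. g c c') = (\<Sum>c<wid n. g c c)"
          by (subst sum.reindex) (auto simp: inj_on_def)
        finally show ?thesis by simp
      qed
      have "u n B - u (Suc n) B = (\<Sum>D\<in>good n. \<Sum>c<wid n. et (iM (c # fst D)) (iN (c # snd D)) B)"
        unfolding un us sum_subtractf[symmetric] by (intro sum.cong refl diag)
      then show ?thesis by (simp only: sum.cartesian_product)
    qed
    then have "td (u n) (u (Suc n)) = pn (\<lambda>B. \<Sum>p\<in>good n \<times> {..<wid n}. et (iM (snd p # fst (fst p))) (iN (snd p # snd (fst p))) B)"
      unfolding td_def by (simp add: case_prod_unfold)
    also have "\<dots> \<le> (\<Sum>p\<in>good n \<times> {..<wid n}. vnorm X (iM (snd p # fst (fst p))) * vnorm Y (iN (snd p # snd (fst p))))"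
    proof (rule finite_sum_pn)
      fix p assume "p \<in> good n \<times> {..<wid n}"
      then have "fst p \<in> good n" "snd p < wid n" by auto
      then show "iM (snd p # fst (fst p)) \<in> vcarrier X" "iN (snd p # snd (fst p)) \<in> vcarrier Y"
        using iM(1)[OF words_SucI[OF _ gw(1)]] iN(1)[OF words_SucI[OF _ gw(2)]] by blast+
    qed simp
    also have "\<dots> = (\<Sum>p\<in>good n \<times> {..<wid n}. (measure M E / cnt (Suc n)) * (measure N F / cnt (Suc n)))"
    proof (intro sum.cong refl)
      fix p assume "p \<in> good n \<times> {..<wid n}"
      then have "fst (fst p) \<in> words n" "snd (fst p) \<in> words n" "snd p < wid n" using gw by auto
      then show "vnorm X (iM (snd p # fst (fst p))) * vnorm Y (iN (snd p # snd (fst p)))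
          = (measure M E / cnt (Suc n)) * (measure N F / cnt (Suc n))"
        using iM(2)[OF words_SucI] iN(2)[OF words_SucI] by simp
    qed
    also have "\<dots> = m * (dens n / wid n)"
      by (simp add: m_def dens_def cnt_Suc power2_eq_square ac_simps)
    finally show ?thesis by (simp add: dens_diff)
  qed
  have far: "td (u n) (u (n + k)) \<le> m * (dens n - dens (n + k))" for n k
  proof (induction k)
    case (Suc k)
    then show ?case
      using step[of "n + k"] td_triangle[of "u n" "u (n + k)" "u (n + Suc k)", OF u u u] by (simp add: algebra_simps)
  qed (simp add: td_refl)
  obtain p where p: "dens \<longlonglongrightarrow> p" "1/2 \<le> p" by (rule dens_limit)
  have cu: "cauchy u"
    unfolding cauchy_iff
  proof (intro conjI allI impI u)
    fix e :: real assume "0 < e"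
    then have "0 < e / m" using m by simp
    moreover have "Cauchy dens" using p(1) by (rule LIMSEQ_imp_Cauchy)
    ultimately obtain K where K: "\<And>i j. i \<ge> K \<Longrightarrow> j \<ge> K \<Longrightarrow> norm (dens i - dens j) < e / m"
      unfolding Cauchy_iff by blast
    have le: "td (u i) (u j) < e" if "K \<le> i" "i \<le> j" for i j
    proof -
      have "m * (dens i - dens j) < m * (e / m)"
        using K[of i j] that m by (intro mult_strict_left_mono) auto
      then show ?thesis using far[of i "j - i"] that m by simp
    qed
    have "td (u i) (u j) < e" if "K \<le> i" "K \<le> j" for i j
      using le[of i j] le[of j i] td_commute[of "u i" "u j", OF u u] that by (cases "i \<le> j") auto
    then show "\<exists>N. \<forall>i\<ge>N. \<forall>j\<ge>N. td (u i) (u j) < e" by blast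
  qed
  \<comment> \<open>Words that differ in every letter still do so after the newest letters are
    dropped.\<close>
  have ancestor: "\<exists>e e'. (e, e') \<in> good n \<and> ce d \<subseteq> ce e \<and> cf d' \<subseteq> cf e'" if "(d, d') \<in> good (n + k)" for n k d d'
    using that
  proof (induction k arbitrary: d d')
    case (Suc k)
    then obtain c c' v v' where d: "d = c # v" "d' = c' # v'" "c < wid (n + k)" "c' < wid (n + k)" "(v, v') \<in> good (n + k)"
      by (auto simp: good.simps(2))
    then have "ce d \<subseteq> ce v" "cf d' \<subseteq> cf v'"
      using E.cell_Cons_subset[of v "n + k" c] F.cell_Cons_subset[of v' "n + k" c'] gw[OF d(5)] by auto
    with Suc.IH[OF d(5)] show ?case by blast
  qed auto
  define Q where "Q n x y = (\<Sum>D\<in>good n. pairing M (indicator (ce (fst D))) x * pairing N (indicator (cf (snd D))) y)"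
    for n and x :: "('a \<Rightarrow> 'k) set" and y :: "('b \<Rightarrow> 'k) set"
  have Q: "Q n \<in> bilinear_forms X Y" for n
    unfolding Q_def using gw E.cell_sets F.cell_sets by (intro pairing_sum_form bdd_fun_indicator) auto
  \<comment> \<open>For \<open>k\<close> at least \<open>n\<close>, every rectangle of
    \<open>u k\<close> lies in exactly one good rectangle of level \<open>n\<close>, so
    \<open>Q n\<close> sees the full mass of \<open>u k\<close>.\<close>
  have uQ: "u k (Q n) = of_real (m * dens k)" if "n \<le> k" for n k
  proof -
    have one: "et (iM (fst D)) (iN (snd D)) (Q n) = of_real ((measure M E / cnt k) * (measure N F / cnt k))" if D: "D \<in> good k" for D
    proof -
      have "(fst D, snd D) \<in> good (n + (k - n))" using D \<open>n \<le> k\<close> by simp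
      from ancestor[OF this] obtain e e' where e: "(e, e') \<in> good n" "ce (fst D) \<subseteq> ce e" "cf (snd D) \<subseteq> cf e'" by blast
      have w: "e \<in> words n" "e' \<in> words n" using gw[OF e(1)] by auto
      have zero: "pairing M (indicator (ce (fst P))) (iM (fst D)) * pairing N (indicator (cf (snd P))) (iN (snd D)) = 0"
        if P: "P \<in> good n - {(e, e')}" for P
      proof -
        have pw: "fst P \<in> words n" "snd P \<in> words n" using P gw[of P n] by auto
        have "fst P \<noteq> e \<or> snd P \<noteq> e'" using P by (cases P) auto
        then have "ce (fst P) \<inter> ce (fst D) = {} \<or> cf (snd P) \<inter> cf (snd D) = {}"
          using disjoint_family_onD[OF E.disj_cells pw(1) w(1)] disjoint_family_onD[OF F.disj_cells pw(2) w(2)] e by blast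
        then show ?thesis
          unfolding iM_def iN_def E.pairing_cells[OF gw(1)[OF D] pw(1)] F.pairing_cells[OF gw(2)[OF D] pw(2)] by auto
      qed
      have "Q n (iM (fst D)) (iN (snd D)) = pairing M (indicator (ce e)) (iM (fst D)) * pairing N (indicator (cf e')) (iN (snd D))"
        unfolding Q_def sum.remove[OF finite_good e(1)] by (simp, rule sum.neutral, intro ballI zero)
      also have "\<dots> = of_real ((measure M E / cnt k) * (measure N F / cnt k))"
        unfolding iM_def iN_def E.pairing_cells[OF gw(1)[OF D] w(1)] F.pairing_cells[OF gw(2)[OF D] w(2)]
        using e E.cell_measure[OF gw(1)[OF D]] F.cell_measure[OF gw(2)[OF D]] by (simp add: Int_absorb1)
      finally show ?thesis using Q by (simp add: elem_tensor_simps)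
    qed
    have "u k (Q n) = (\<Sum>D\<in>good k. of_real ((measure M E / cnt k) * (measure N F / cnt k)))"
      unfolding u_def by (intro sum.cong refl one)
    then show ?thesis by (simp add: m_def dens_def power2_eq_square)
  qed
  define \<alpha> where "\<alpha> x d = (\<integral>z. indicator (ce d) z * norm (rep x z) \<partial>M)" for x :: "('a \<Rightarrow> 'k) set" and d
  define \<beta> where "\<beta> y d = (\<integral>z. indicator (cf d) z * norm (rep y z) \<partial>N)" for y :: "('b \<Rightarrow> 'k) set" and d
  have nonneg: "0 \<le> \<alpha> x d" "0 \<le> \<beta> y d" for x y d by (auto simp: \<alpha>_def \<beta>_def)
  \<comment> \<open>The mass of \<open>norm x\<close> times \<open>norm y\<close> on the good
    rectangles of level \<open>n\<close>: the most that \<open>Q n\<close> can extract from the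
    pair.\<close>
  define C where "C n x y = (\<Sum>D\<in>good n. \<alpha> x (fst D) * \<beta> y (snd D))" for n x y
  have C0: "0 \<le> C n x y" for n x y unfolding C_def by (intro sum_nonneg mult_nonneg_nonneg nonneg)
  have QC: "norm (Q n x y) \<le> C n x y" for n x y
    unfolding Q_def C_def
  proof (rule sum_norm_le)
    fix D
    show "norm (pairing M (indicator (ce (fst D))) x * pairing N (indicator (cf (snd D))) y) \<le> \<alpha> x (fst D) * \<beta> y (snd D)"
      unfolding norm_mult using pairing_norm[of M "indicator (ce (fst D))" x] pairing_norm[of N "indicator (cf (snd D))" y]
      by (intro mult_mono nonneg) (auto simp: \<alpha>_def \<beta>_def norm_indicator)
  qed
  have full: "(\<Sum>D\<in>words n \<times> words n. \<alpha> x (fst D) * \<beta> y (snd D)) \<le> vnorm X x * vnorm Y y"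
    if "x \<in> vcarrier X" "y \<in> vcarrier Y" for n x y
  proof -
    have "(\<Sum>D\<in>words n \<times> words n. \<alpha> x (fst D) * \<beta> y (snd D)) = (\<Sum>d\<in>words n. \<alpha> x d) * (\<Sum>d\<in>words n. \<beta> y d)"
      by (simp add: sum_product sum.cartesian_product case_prod_unfold)
    also have "\<dots> \<le> vnorm X x * vnorm Y y"
      using E.sum_cell_integrals[OF integrable_rep[OF that(1)]] F.sum_cell_integrals[OF integrable_rep[OF that(2)]]
      by (intro mult_mono sum_nonneg nonneg L1_norm_nonneg) (auto simp: \<alpha>_def \<beta>_def L1_norm)
    finally show ?thesis .
  qed
  have CB: "C n x y + (\<Sum>D\<in>words n \<times> words n - good n. \<alpha> x (fst D) * \<beta> y (snd D)) \<le> vnorm X x * vnorm Y y"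
    if "x \<in> vcarrier X" "y \<in> vcarrier Y" for n x y
    using full[OF that, of n] sum.subset_diff[OF good_subset[of n], of "\<lambda>D. \<alpha> x (fst D) * \<beta> y (snd D)"]
    by (simp add: C_def)
  have Cle: "C n x y \<le> vnorm X x * vnorm Y y" if "x \<in> vcarrier X" "y \<in> vcarrier Y" for n x y
    using CB[OF that, of n] sum_nonneg[of "words n \<times> words n - good n" "\<lambda>D. \<alpha> x (fst D) * \<beta> y (snd D)"] nonneg
    by simp
  \<comment> \<open>If no mass is lost at any level, all rectangles that are not good carry none.
    The supports of \<open>x\<close> and \<open>y\<close> then never share a letter, and
    \<open>letters_meet\<close> applies.\<close>
  have meet: "vnorm X x * vnorm Y y = 0"
    if x: "x \<in> vcarrier X" and y: "y \<in> vcarrier Y" and eq: "\<And>n. C n x y = vnorm X x * vnorm Y y" for x y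
  proof -
    have bad: "\<alpha> x d * \<beta> y d' = 0" if "(d, d') \<in> words n \<times> words n - good n" for n d d'
    proof -
      have le: "(\<Sum>D\<in>words n \<times> words n - good n. \<alpha> x (fst D) * \<beta> y (snd D)) \<le> 0"
        using CB[OF x y, of n] eq[of n] by simp
      have "\<alpha> x d * \<beta> y d' \<le> (\<Sum>D\<in>words n \<times> words n - good n. \<alpha> x (fst D) * \<beta> y (snd D))"
        using member_le_sum[OF that, of "\<lambda>D. \<alpha> x (fst D) * \<beta> y (snd D)"] nonneg by simp
      with le nonneg(1)[of x d] nonneg(2)[of y d'] show ?thesis by (intro antisym) auto
    qed
    define S where "S = {z\<in>space M. rep x z \<noteq> 0}"
    define S' where "S' = {z\<in>space N. rep y z \<noteq> 0}"
    note [measurable] = borel_measurable_integrable[OF integrable_rep[OF x]]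
      borel_measurable_integrable[OF integrable_rep[OF y]]
    have mS: "S \<in> sets M" "S' \<in> sets N" unfolding S_def S'_def by measurable
    have z: "\<alpha> x d = 0 \<longleftrightarrow> measure M (ce d \<inter> S) = 0" "\<beta> y d = 0 \<longleftrightarrow> measure N (cf d \<inter> S') = 0" if "d \<in> words n" for d n
      unfolding \<alpha>_def \<beta>_def S_def S'_def
      by (intro integral_indicator_norm_eq_0 integrable_rep x y E.cell_fmeasurable[OF that] F.cell_fmeasurable[OF that])+
    have "measure M (ce [] \<inter> S) * measure N (cf [] \<inter> S') = 0"
    proof (rule letters_meet)
      fix n c d d' assume c: "c < wid n" "d \<in> words n" "d' \<in> words n"
      \<comment> \<open>Equal newest letters already exclude the pair, whatever the older letters
        are.\<close>
      have "(c # d, c # d') \<notin> good (Suc n)" by (auto simp: good.simps(2))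
      then have "\<alpha> x (c # d) * \<beta> y (c # d') = 0"
        using words_SucI[OF c(1,2)] words_SucI[OF c(1,3)] by (intro bad[of _ _ "Suc n"]) auto
      then show "measure M (ce (c # d) \<inter> S) * measure N (cf (c # d') \<inter> S') = 0"
        using z(1)[OF words_SucI[OF c(1,2)]] z(2)[OF words_SucI[OF c(1,3)]] by simp
    qed (auto intro: E.cell_trace F.cell_trace mS)
    then have "\<alpha> x [] * \<beta> y [] = 0" using z[of "[]" 0] by simp
    \<comment> \<open>Level 0 has the single pair of empty words, so \<open>C 0\<close> is the
      product of the integrals over \<open>E\<close> and \<open>F\<close>.\<close>
    then have "C 0 x y = 0" by (simp add: C_def)
    then show ?thesis using eq[of 0] by simp
  qed
  have "\<not> attains u"
  proof
    assume "attains u"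
    then obtain x y where x: "\<And>i. x i \<in> vcarrier X" and y: "\<And>i. y i \<in> vcarrier Y"
      and lim0: "(\<lambda>j. lim (\<lambda>k. td (\<lambda>B. \<Sum>i<j. et (x i) (y i) B) (u k))) \<longlonglongrightarrow> 0"
      and sums: "(\<lambda>i. vnorm X (x i) * vnorm Y (y i)) sums lim (\<lambda>k. pn (u k))"
      unfolding attains_def by auto
    let ?p = "\<lambda>i. vnorm X (x i) * vnorm Y (y i)" and ?T = "\<lambda>j B. \<Sum>i<j. et (x i) (y i) B"
    have T: "?T j \<in> vcarrier T" for j by (intro finite_sum_in) (use x y in auto)
    have md: "(\<lambda>k. m * dens k) \<longlonglongrightarrow> m * p" by (intro tendsto_mult tendsto_const p)
    have L: "suminf ?p \<le> m * p"
    proof -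
      have "(\<lambda>k. pn (u k)) \<longlonglongrightarrow> lim (\<lambda>k. pn (u k))"
        using cauchy_pn[OF cu] by (simp add: convergent_LIMSEQ_iff)
      then have "lim (\<lambda>k. pn (u k)) \<le> m * p" using md by (rule LIMSEQ_le) (use pn_u in blast)
      then show ?thesis using sums_unique[OF sums] by (simp only:)
    qed
    have sp: "summable ?p" using sums by (rule sums_summable)
    have sC: "summable (\<lambda>i. C n (x i) (y i))" for n
      by (rule summable_comparison_test'[OF sp, of 0]) (use C0 Cle x y in auto)
    \<comment> \<open>\<open>Q n\<close> has norm at most 1 and takes the values
      \<open>m * dens k\<close> on \<open>u k\<close>, which tend to \<open>m * p\<close>.
      Approximating by partial sums of the given series shows that its terms must supply this much
      mass.\<close>
    have CL: "m * p \<le> (\<Sum>i. C n (x i) (y i))" for n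
    proof -
      have 1: "m * p \<le> (\<Sum>i<j. C n (x i) (y i)) + lim (\<lambda>k. td (?T j) (u k))" for j
      proof (rule LIMSEQ_le[OF md])
        show "(\<lambda>k. (\<Sum>i<j. C n (x i) (y i)) + td (?T j) (u k)) \<longlonglongrightarrow> (\<Sum>i<j. C n (x i) (y i)) + lim (\<lambda>k. td (?T j) (u k))"
          using cauchy_td[OF cauchy_const[OF T] cu] by (intro tendsto_intros) (simp add: convergent_LIMSEQ_iff)
        have "m * dens k \<le> (\<Sum>i<j. C n (x i) (y i)) + td (?T j) (u k)" if "n \<le> k" for k
        proof -
          have "norm (?T j (Q n) - u k (Q n)) \<le> 1 * td (?T j) (u k)"
            unfolding td_def
          proof (rule form_bound[OF diff_in[OF T u] Q])
            show "norm (Q n a b) \<le> 1 * (vnorm X a * vnorm Y b)" if "a \<in> vcarrier X" "b \<in> vcarrier Y" for a b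
              using QC[of n a b] Cle[OF that, of n] by simp
          qed simp
          moreover have "norm (?T j (Q n)) \<le> (\<Sum>i<j. C n (x i) (y i))"
            by (rule sum_norm_le) (use QC Q in \<open>simp add: elem_tensor_simps\<close>)
          moreover have "norm (u k (Q n)) = m * dens k"
            unfolding uQ[OF that] norm_of_real using m dens_nonneg[of k] by simp
          ultimately show ?thesis
            using norm_triangle_ineq2[of "u k (Q n)" "?T j (Q n)"] norm_minus_commute[of "u k (Q n)" "?T j (Q n)"] by linarith
        qed
        then show "\<exists>K. \<forall>k\<ge>K. m * dens k \<le> (\<Sum>i<j. C n (x i) (y i)) + td (?T j) (u k)" by blast
      qed
      have "(\<lambda>j. (\<Sum>i<j. C n (x i) (y i)) + lim (\<lambda>k. td (?T j) (u k))) \<longlonglongrightarrow> (\<Sum>i. C n (x i) (y i)) + 0"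
        by (intro tendsto_add lim0 summable_LIMSEQ sC)
      then show ?thesis
        using 1 by (intro LIMSEQ_le_const[where X="\<lambda>j. (\<Sum>i<j. C n (x i) (y i)) + lim (\<lambda>k. td (?T j) (u k))"]) auto
    qed
    \<comment> \<open>The sums are squeezed: the products add up to at most \<open>m * p\<close>,
      while the termwise smaller \<open>C n\<close> add up to at least \<open>m * p\<close>.
      Equality must then hold in every term.\<close>
    have "C n (x i) (y i) = ?p i" for n i
    proof -
      have "(\<Sum>i. ?p i - C n (x i) (y i)) = suminf ?p - (\<Sum>i. C n (x i) (y i))"
        by (rule suminf_diff[OF sp sC, symmetric])
      also have "\<dots> \<le> 0" using L CL[of n] by simp
      finally have le: "(\<Sum>i. ?p i - C n (x i) (y i)) \<le> 0" .
      have "?p i - C n (x i) (y i) = (\<Sum>i\<in>{i}. ?p i - C n (x i) (y i))" by simp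
      also have "\<dots> \<le> (\<Sum>i. ?p i - C n (x i) (y i))"
        by (intro sum_le_suminf summable_diff sp sC) (use Cle x y in auto)
      finally show ?thesis using le Cle[OF x y, of n i i] by simp
    qed
    \<comment> \<open>Every term of the supposed series vanishes, although their sum is at least
      \<open>m * p > 0\<close>.\<close>
    then have "?p i = 0" for i using meet[OF x y, of i i] by simp
    then have "suminf ?p = 0" by (simp only: suminf_zero)
    moreover have "suminf ?p \<ge> (\<Sum>i. C 0 (x i) (y i))"
      by (intro suminf_le sC sp) (use Cle x y in auto)
    moreover have "0 < m * p" using m p(2) by simp
    ultimately show False using CL[of 0] by simp
  qed
  with cu show ?thesis by blast
qed

section \<open>The equivalence\<close>

theorem NA_all_imp_purely_atomic:
  assumes "NA_proj X Y = vcarrier (proj_tensor X Y)"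
  shows "purely_atomic M \<or> purely_atomic N"
proof (rule ccontr)
  assume neg: "\<not> ?thesis"
  obtain E where E: "atomless M E" "0 < measure M E" using not_purely_atomic_atomless[of M] neg by blast
  obtain F where F: "atomless N F" "0 < measure N F" using not_purely_atomic_atomless[of N] neg by blast
  obtain ce where "cells M E ce" using atomless.cells_exist[OF E(1)] by blast
  moreover obtain cf where "cells N F cf" using atomless.cells_exist[OF F(1)] by blast
  ultimately show False
    using atomless_not_attained[OF _ _ E(2) F(2)] assms unfolding NA_all_iff by blast
qed

lemma purely_atomic_imp_NA_all: "purely_atomic M \<Longrightarrow> NA_proj X Y = vcarrier (proj_tensor X Y)"
  unfolding NA_all_iff using purely_atomic_attains by blast

end

text \<open>One argument serves the real and the complex case, since signs are written as
  \<open>norm f / f\<close> and no conjugation occurs.\<close>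

lemma purely_atomic_iff_NA_all:
  fixes \<mu> :: "'a measure" and \<nu> :: "'b measure"
  shows "purely_atomic \<mu> \<or> purely_atomic \<nu> \<longleftrightarrow>
    NA_proj (L1 TYPE('k::{real_normed_field, banach, second_countable_topology}) \<mu>) (L1 TYPE('k) \<nu>) =
    vcarrier (proj_tensor (L1 TYPE('k) \<mu>) (L1 TYPE('k) \<nu>))"
proof
  assume "NA_proj (L1 TYPE('k) \<mu>) (L1 TYPE('k) \<nu>) = vcarrier (proj_tensor (L1 TYPE('k) \<mu>) (L1 TYPE('k) \<nu>))"
  then show "purely_atomic \<mu> \<or> purely_atomic \<nu>" by (rule L1_tensor.NA_all_imp_purely_atomic)
next
  assume "purely_atomic \<mu> \<or> purely_atomic \<nu>"
  then show "NA_proj (L1 TYPE('k) \<mu>) (L1 TYPE('k) \<nu>) = vcarrier (proj_tensor (L1 TYPE('k) \<mu>) (L1 TYPE('k) \<nu>))"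
  proof
    assume "purely_atomic \<mu>"
    then show ?thesis by (rule L1_tensor.purely_atomic_imp_NA_all)
  next
    assume "purely_atomic \<nu>"
    then have "NA_proj (L1 TYPE('k) \<nu>) (L1 TYPE('k) \<mu>) = vcarrier (proj_tensor (L1 TYPE('k) \<nu>) (L1 TYPE('k) \<mu>))"
      by (rule L1_tensor.purely_atomic_imp_NA_all)
    then show ?thesis by (rule norm_pair.NA_all_swap[OF L1_norm_pair])
  qed
qed

theorem theorem4p10:
  fixes \<mu> :: "'a measure" and \<nu> :: "'b measure"
  shows "(purely_atomic \<mu> \<or> purely_atomic \<nu> \<longleftrightarrow>
            NA_proj (L1 TYPE(real) \<mu>) (L1 TYPE(real) \<nu>) =
            vcarrier (proj_tensor (L1 TYPE(real) \<mu>) (L1 TYPE(real) \<nu>)))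
       \<and> (purely_atomic \<mu> \<or> purely_atomic \<nu> \<longleftrightarrow>
            NA_proj (L1 TYPE(complex) \<mu>) (L1 TYPE(complex) \<nu>) =
            vcarrier (proj_tensor (L1 TYPE(complex) \<mu>) (L1 TYPE(complex) \<nu>)))"
  by (intro conjI purely_atomic_iff_NA_all)

end
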